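(* For every integer $r\ge 2$, as $n\to\infty$, $$\mathrm{diam}(D(n,r)) = (1+\eta_r+o_p(1))\log_r n \quad\text{and}\quad \mathrm{diam}(D_0(n,r)) = (1+\eta_r+o_p(1))\log_r n .$$
   Context: Random digraph: let $(L_{i,j})_{(i,j)\in[n]\times[r]}$ be independent uniformly random elements of $[n]=\{1,\dots,n\}$. $D(n,r)$ is the directed multigraph (loops and multiple edges allowed) with vertex set $[n]$ and edges $(i,L_{i,j})$, $(i,j)\in[n]\times[r]$, each oriented from $i$ to $L_{i,j}$; every vertex has out-degree $r$. For a digraph $D$ and vertices $u,v$, $\mathrm{dist}_D(u,v)$ is the number of edges in a shortest oriented path from $u$ to $v$ ($\infty$ if there is none). The diameter is $\mathrm{diam}(D)=\max\{\mathrm{dist}_D(u,v): u,v\in V(D),\ \mathrm{dist}_D(u,v)<\infty\}$. $D_0(n,r)$ is the strongly connected component of $D(n,r)$ (a maximal strongly connected induced subgraph) with the largest number of vertices; in case of a tie, it is the one whose smallest labelled vertex is minimal. Constants: $\lambda_r=\max\{\lambda: 1-\lambda=e^{-r\lambda}\}$ and $$\eta_r=\frac{1}{\log_r\big((1-\lambda_r)^{-1}\big)-1}=\frac{\log r}{\lambda_r r-\log r}.$$ The notation $X_n=(X+o_p(1))Y_n$ means $X_n/Y_n\to X$ in probability as $n\to\infty$. $\log$ is the natural logarithm. *)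

theory Defs
  imports "HOL-Probability.Probability" "Graph_Theory.Graph_Theory"
begin

text \<open>
  The digraph with vertex set \<open>[n]\<close> and an arc from \<open>i\<close> to \<open>L (i, j)\<close> for every
  \<open>(i, j) \<in> [n] \<times> [r]\<close>. The arcs are the index pairs themselves, so that loops and parallel
  arcs are kept.
\<close>
definition out_digraph :: "nat \<Rightarrow> nat \<Rightarrow> (nat \<times> nat \<Rightarrow> nat) \<Rightarrow> (nat, nat \<times> nat) pre_digraph" where
  "out_digraph n r L = \<lparr>verts = {1..n}, arcs = {1..n} \<times> {1..r}, tail = fst, head = L\<rparr>"

text \<open>The infimum over the empty set of paths is \<open>\<infinity>\<close>.\<close>
definition digraph_dist :: "('a, 'b) pre_digraph \<Rightarrow> 'a \<Rightarrow> 'a \<Rightarrow> enat" where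
  "digraph_dist D u v = (INF p \<in> {p. pre_digraph.apath D u p v}. enat (length p))"

definition digraph_diam :: "('a, 'b) pre_digraph \<Rightarrow> nat" where
  "digraph_diam D =
     Max {the_enat (digraph_dist D u v) | u v.
            u \<in> verts D \<and> v \<in> verts D \<and> digraph_dist D u v < \<infinity>}"

text \<open>Ties are broken in favour of the component with the smallest minimal vertex label.\<close>
definition largest_scc :: "(nat, 'b) pre_digraph \<Rightarrow> (nat, 'b) pre_digraph" where
  "largest_scc D =
     (THE H. H \<in> pre_digraph.sccs D \<and>
        (\<forall>H' \<in> pre_digraph.sccs D.
           card (verts H') < card (verts H) \<or>
           (card (verts H') = card (verts H) \<and> Min (verts H) \<le> Min (verts H'))))"

lemma largest_scc_ex1:
  assumes "fin_digraph D" "verts D \<noteq> {}"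
  shows "\<exists>!H. H \<in> pre_digraph.sccs D \<and>
        (\<forall>H' \<in> pre_digraph.sccs D.
           card (verts H') < card (verts H) \<or>
           (card (verts H') = card (verts H) \<and> Min (verts H) \<le> Min (verts (H' :: (nat,'b) pre_digraph))))"
proof -
  interpret fin_digraph D by fact
  have cv: "sccs_verts = scc_of ` verts D" by (rule sccs_verts_conv_scc_of)
  have sv: "sccs_verts = verts ` sccs" by (rule sccs_verts_conv)
  have ne: "sccs_verts \<noteq> {}" and fin: "finite sccs_verts" using assms cv by auto
  have fin': "finite sccs" using sccs_conv_sccs_verts fin by simp
  have vp: "finite (verts H) \<and> verts H \<noteq> {}" if "H \<in> sccs" for H
    using that finite_verts unfolding sccs_def strongly_connected_def induced_subgraph_def subgraph_def
    by (auto dest: finite_subset)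
  have dis: "H = H'" if "H \<in> sccs" "H' \<in> sccs" "Min (verts H) = Min (verts H')" for H H'
    using scc_disj[OF that(1,2)] Min_in[of "verts H"] Min_in[of "verts H'"] vp[OF that(1)] vp[OF that(2)] that(3) by (metis disjoint_iff)
  define m where "m = Max ((card \<circ> verts) ` sccs)"
  let ?S = "{H \<in> sccs. card (verts H) = m}"
  have "sccs \<noteq> {}" using ne sv by auto
  then have "m \<in> (card \<circ> verts) ` sccs" unfolding m_def using fin' by (intro Max_in) auto
  then have S: "?S \<noteq> {}" "finite ?S" using fin' by auto
  have "Min ((\<lambda>H. Min (verts H)) ` ?S) \<in> (\<lambda>H. Min (verts H)) ` ?S" using S by (intro Min_in) auto
  then obtain H where H0: "H \<in> ?S" "Min ((\<lambda>H. Min (verts H)) ` ?S) = Min (verts H)" by blast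
  have H: "H \<in> ?S" "\<And>H'. H' \<in> ?S \<Longrightarrow> Min (verts H) \<le> Min (verts H')"
    unfolding H0(2)[symmetric] using H0(1) S by (auto intro!: Min_le)
  have le: "card (verts H') \<le> m" if "H' \<in> sccs" for H'
    unfolding m_def using that fin' by (intro Max_ge) auto
  show ?thesis
  proof (rule ex1I[of _ H])
    show "H \<in> sccs \<and> (\<forall>H'\<in>sccs. card (verts H') < card (verts H) \<or>
           card (verts H') = card (verts H) \<and> Min (verts H) \<le> Min (verts H'))"
    proof (intro conjI ballI)
      show "H \<in> sccs" using H(1) by blast
      fix H' assume "H' \<in> sccs"
      then show "card (verts H') < card (verts H) \<or>
           card (verts H') = card (verts H) \<and> Min (verts H) \<le> Min (verts H')"
        using H(1) H(2)[of H'] le[of H'] by fastforce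
    qed
  next
    fix K assume K: "K \<in> sccs \<and> (\<forall>H'\<in>sccs. card (verts H') < card (verts K) \<or>
           card (verts H') = card (verts K) \<and> Min (verts K) \<le> Min (verts H'))"
    have "\<not> card (verts H) < card (verts K)" using le[of K] K H(1) by simp
    then have c: "card (verts K) = m" "Min (verts K) \<le> Min (verts H)" using K H(1) by auto
    have "Min (verts H) \<le> Min (verts K)" using H(2)[of K] K c(1) by blast
    then have "Min (verts K) = Min (verts H)" using c(2) by simp
    then show "K = H" using dis K H(1) by blast
  qed
qed

text \<open>\<open>GREATEST\<close> rather than \<open>Max\<close>: the latter is unspecified unless the set is known to be finite.\<close>
definition lambda_const :: "nat \<Rightarrow> real" where
  "lambda_const r = (GREATEST l. 1 - l = exp (- (real r * l)))"

definition eta_const :: "nat \<Rightarrow> real" where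
  "eta_const r = 1 / (log (real r) (inverse (1 - lambda_const r)) - 1)"

lemma lambda_greatest:
  assumes "r \<ge> 2"
  shows "1 - lambda_const r = exp (- (real r * lambda_const r))"
    "\<And>l. 1 - l = exp (- (real r * l)) \<Longrightarrow> l \<le> lambda_const r" "lambda_const r > 0"
proof -
  let ?f = "\<lambda>l::real. 1 - l - exp (- (real r * l))"
  let ?S = "{0..1} \<inter> ?f -` {0}"
  have "closed (?f -` {0})" by (intro continuous_closed_vimage continuous_intros)
  then have "compact ?S" by (rule compact_Int_closed[OF compact_Icc])
  moreover have "0 \<in> ?S" by simp
  ultimately obtain m where m: "m \<in> ?S" "\<And>t. t \<in> ?S \<Longrightarrow> t \<le> m"
    using compact_attains_sup[of ?S] by blast
  have all: "l \<le> m" if "1 - l = exp (- (real r * l))" for l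
  proof (cases "l \<ge> 0")
    case True
    moreover have "l \<le> 1" using that exp_gt_zero[of "- (real r * l)"] by linarith
    ultimately have "l \<in> ?S" using that by simp
    then show ?thesis by (rule m(2))
  next
    case False then show ?thesis using m(1) by simp
  qed
  have "lambda_const r = m" unfolding lambda_const_def
    using m all by (intro Greatest_equality) auto
  have d: "DERIV ?f 0 :> real r - 1" by (auto intro!: derivative_eq_intros)
  obtain e where e: "e > 0" "\<And>h. 0 < h \<Longrightarrow> h < e \<Longrightarrow> ?f 0 < ?f (0 + h)"
    using DERIV_pos_inc_right[OF d] assms by auto
  define h where "h = min (e/2) (1/2)"
  have h: "0 < h" "h < e" "h < 1" using e by (auto simp: h_def)
  have "\<exists>x\<ge>h. x \<le> 1 \<and> ?f x = 0"
    using e(2)[OF h(1,2)] h by (intro IVT2) (auto intro!: continuous_intros)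
  then show "lambda_const r > 0" "1 - lambda_const r = exp (- (real r * lambda_const r))"
    "\<And>l. 1 - l = exp (- (real r * l)) \<Longrightarrow> l \<le> lambda_const r"
    using m all h \<open>lambda_const r = m\<close> by - fastforce+
qed

lemma eta_const_alt:
  assumes "r \<ge> 2"
  shows "eta_const r = ln (real r) / (lambda_const r * real r - ln (real r))"
proof -
  have "log (real r) (inverse (1 - lambda_const r)) = real r * lambda_const r / ln (real r)"
    unfolding log_def lambda_greatest(1)[OF assms] by (simp add: exp_minus)
  moreover have "ln (real r) > 0" using assms by simp
  moreover have "1 / (x / y - 1) = y / (x - y)" if "y > 0" for x y :: real
    proof -
    have "x / y - 1 = (x - y) / y" using that by (simp add: diff_divide_distrib)
    then show ?thesis by simp
  qed
  ultimately show ?thesis unfolding eta_const_def by (simp add: mult.commute)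
qed
text \<open>Convergence in probability to a constant; the \<open>n\<close>-th variable lives on its own space \<open>M n\<close>.\<close>
definition tendsto_in_prob :: "(nat \<Rightarrow> 'w measure) \<Rightarrow> (nat \<Rightarrow> 'w \<Rightarrow> real) \<Rightarrow> real \<Rightarrow> bool" where
  "tendsto_in_prob M X c \<longleftrightarrow>
     (\<forall>\<epsilon>>0. (\<lambda>n. measure (M n) {w \<in> space (M n). \<bar>X n w - c\<bar> > \<epsilon>}) \<longlonglongrightarrow> 0)"

end

theory Submission
  imports Defs "HOL-Real_Asymp.Real_Asymp"
begin

text \<open>
  Explore backwards from a vertex \<open>v\<close>, one distance layer at a time. Given the layers so far, the next
  one is binomial, and as long as few vertices are explored it is nearly a Poisson branching step with
  mean \<open>r\<close>. Such a process stays alive but small for \<open>t\<close> steps with probability about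
  \<open>(r q)\<^sup>t = r\<^bsup>-t/\<eta>\<^esup>\<close>, where \<open>q = 1 - \<lambda>\<^sub>r\<close> is the extinction probability. Hence no vertex stays
  thin for longer than \<open>(\<eta> + \<epsilon>) log\<^sub>r n\<close> steps. Once a layer has order \<open>log n\<close> vertices, the layers grow by a
  factor close to \<open>r\<close> until they have linear size, after \<open>log\<^sub>r n\<close> further steps; then the number
  of unexplored vertices decreases superexponentially, and the last \<open>n\<^sup>\<zeta>\<close> of them are absorbed because small
  vertex sets expand. So every vertex is either reached by few vertices, all of them close, or by all vertices
  within \<open>(1 + \<eta> + \<epsilon>) log\<^sub>r n\<close> steps; the vertices of the second kind form the largest component, which
  is closed under arcs. Conversely, by the second moment method some vertex of the second kind stays thin for
  \<open>(\<eta> - \<epsilon>) log\<^sub>r n\<close> steps, and since layers grow at most by a factor \<open>r\<close> in the mean, its ball of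
  radius \<open>(1 + \<eta> - \<epsilon>) log\<^sub>r n\<close> misses most of the component.
\<close>

section \<open>The dual parameter\<close>

text \<open>Out-degrees are fixed, so the fluctuations that matter lie in the sets of vertices that
  can reach a given vertex; a shortest path is delayed at its target end only, and
  \<open>\<eta>\<close> enters once. Two thresholds for a thin layer are in play. The upper bound
  must hold for all \<open>n\<close> vertices at once, so Chernoff bounds start at layers of order
  log n, where one failing step is polynomially rare. The lower bound needs a single vertex; there a
  large constant threshold and plain Poisson limits suffice. Two thin explorations are not
  independent, since both look at the arcs of every vertex. Counting maps turns conditioning on
  histories into product sets, and correlations are then compared vertex by vertex. Chernoff bounds
  lose their force once few vertices are left, because a failure must still be summed over all
  starting vertices; expansion of small sets is a single event, common to all starting vertices, and
  closes this gap.\<close>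

definition ext_prob :: "nat \<Rightarrow> real" where
  "ext_prob r = 1 - lambda_const r"

text \<open>The probability generating function of the Poisson law with mean \<open>r\<close>;
  \<open>ext_prob r\<close> is its least fixed point, as \<open>lambda_const r\<close> is the
  greatest solution.\<close>

definition ext_gf :: "nat \<Rightarrow> real \<Rightarrow> real" where
  "ext_gf r x = exp (- (real r * (1 - x)))"

lemma ext_prob_fixed: "r \<ge> 2 \<Longrightarrow> ext_gf r (ext_prob r) = ext_prob r"
  using lambda_greatest(1)[of r] by (simp add: ext_gf_def ext_prob_def)

lemma ext_prob_pos: "r \<ge> 2 \<Longrightarrow> 0 < ext_prob r"
  using ext_prob_fixed[of r] by (metis exp_gt_zero ext_gf_def)

lemma ext_prob_less_1: "r \<ge> 2 \<Longrightarrow> ext_prob r < 1"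
  using lambda_greatest(3)[of r] by (simp add: ext_prob_def)

lemma ext_gf_mono: "x \<le> y \<Longrightarrow> ext_gf r x \<le> ext_gf r y"
  by (simp add: ext_gf_def mult_left_mono)

lemma ext_gf_pos: "0 < ext_gf r x"
  by (simp add: ext_gf_def)

lemma ext_gf_deriv: "(ext_gf r has_real_derivative real r * ext_gf r x) (at x)"
  unfolding ext_gf_def by (auto intro!: derivative_eq_intros)

text \<open>By the mean value theorem the slope is 1 somewhere between two fixed points, and the
  slope is \<open>r\<close> times the function itself.\<close>

lemma ext_gf_mvt:
  assumes "a < b" "ext_gf r a = a" "ext_gf r b = b"
  obtains z where "a < z" "z < b" "real r * ext_gf r z = 1"
proof -
  have "\<exists>z. a < z \<and> z < b \<and> (ext_gf r b - ext_gf r a) = (b - a) * (real r * ext_gf r z)"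
    using assms(1) by (intro MVT2) (auto intro: ext_gf_deriv)
  then show ?thesis using assms that by auto
qed

lemma ext_gf_1 [simp]: "ext_gf r 1 = 1"
  by (simp add: ext_gf_def)

text \<open>A third fixed point would give two places with slope 1, but the slope
  \<open>real r * ext_gf r x\<close> is strictly increasing in \<open>x\<close>.\<close>

lemma no_fixed_point:
  assumes r: "r \<ge> 2" and x: "ext_prob r < x" "x < 1"
  shows "ext_gf r x \<noteq> x"
proof
  assume fx: "ext_gf r x = x"
  obtain z where z: "ext_prob r < z" "z < x" "real r * ext_gf r z = 1"
    using ext_gf_mvt[OF x(1) ext_prob_fixed[OF r] fx] by blast
  obtain z' where z': "x < z'" "z' < 1" "real r * ext_gf r z' = 1"
    using ext_gf_mvt[OF x(2) fx] by auto
  from z(3) z'(3) have "ext_gf r z = ext_gf r z'" using r by (metis mult_cancel_left mult_zero_left zero_neq_one)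
  then have "z = z'" using r by (simp add: ext_gf_def)
  with z z' show False by simp
qed

text \<open>The left side is the slope at \<open>ext_prob r\<close>; slope 1 is attained strictly to
  the right of this point, and the slope increases. It is the mean of the dual, subcritical
  branching process.\<close>

lemma mean_ext_less_1:
  assumes r: "r \<ge> 2"
  shows "real r * ext_prob r < 1"
proof -
  obtain z where z: "ext_prob r < z" "real r * ext_gf r z = 1"
    using ext_gf_mvt[OF ext_prob_less_1[OF r] ext_prob_fixed[OF r]] by auto
  have "ext_gf r (ext_prob r) < ext_gf r z" using z(1) r by (simp add: ext_gf_def)
  then have "real r * ext_prob r < real r * ext_gf r z"
    using r ext_prob_fixed[OF r] by simp
  then show ?thesis using z by simp
qed

text \<open>The slope at \<open>ext_prob r\<close> is below 1, so the inequality holds just to the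
  right of it; a change of sign before \<open>x\<close> would produce a forbidden fixed
  point.\<close>

lemma ext_gf_less:
  assumes r: "r \<ge> 2" and x: "ext_prob r < x" "x < 1"
  shows "ext_gf r x < x"
proof (rule ccontr)
  assume "\<not> ext_gf r x < x"
  then have gx: "ext_gf r x > x" using no_fixed_point[OF assms] by simp
  let ?q = "ext_prob r" and ?f = "\<lambda>x. x - ext_gf r x"
  have "((\<lambda>x. x - ext_gf r x) has_real_derivative 1 - real r * ext_gf r ?q) (at ?q)"
    by (auto intro!: derivative_eq_intros ext_gf_deriv)
  moreover have "1 - real r * ext_gf r ?q > 0" using mean_ext_less_1[OF r] ext_prob_fixed[OF r] by simp
  ultimately have "\<exists>d>0. \<forall>h>0. h < d \<longrightarrow> ?f ?q < ?f (?q + h)"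
    by (rule DERIV_pos_inc_right)
  then obtain d where d: "d > 0" "\<And>h. 0 < h \<Longrightarrow> h < d \<Longrightarrow> ?f ?q < ?f (?q + h)"
    by blast
  define h where "h = min (d / 2) ((x - ?q) / 2)"
  have h: "0 < h" "h < d" "?q + h < x" using d(1) x(1) by (auto simp: h_def min_def field_simps)
  have pos: "?f (?q + h) > 0" using d(2)[OF h(1,2)] ext_prob_fixed[OF r] by simp
  have "\<exists>y\<ge>?q + h. y \<le> x \<and> ?f y = 0"
    using pos gx h by (intro IVT2) (auto intro!: continuous_intros simp: ext_gf_def)
  then obtain y where "y \<ge> ?q + h" "y \<le> x" "ext_gf r y = y" by auto
  then show False using no_fixed_point[OF r, of y] h x by auto
qed

text \<open>The iterates decrease and stay above \<open>ext_prob r\<close>, and their limit is a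
  fixed point below 1.\<close>

lemma ext_gf_iterates:
  assumes r: "r \<ge> 2" and s: "ext_prob r < s" "s < 1" and \<delta>: "\<delta> > 0"
  obtains J where "(ext_gf r ^^ J) s < ext_prob r + \<delta>"
proof -
  let ?x = "\<lambda>k. (ext_gf r ^^ k) s" and ?q = "ext_prob r"
  have rng: "?q < ?x k \<and> ?x k < 1" for k
  proof (induction k)
    case (Suc k)
    have "ext_gf r ?q < ext_gf r (?x k)" using Suc r unfolding ext_gf_def[of r ?q] ext_gf_def[of r "?x k"] by simp
    then show ?case using ext_gf_less[OF r, of "?x k"] Suc ext_prob_fixed[OF r] by simp
  qed (use s in simp)
  have dec: "?x (Suc k) \<le> ?x k" for k using ext_gf_less[OF r, of "?x k"] rng[of k] by simp
  have "decseq ?x" using dec by (rule decseq_SucI)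
  then obtain L where L: "?x \<longlonglongrightarrow> L" "\<And>i. L \<le> ?x i"
    using decseq_convergent[of ?x ?q] rng by (metis less_imp_le)
  have "(\<lambda>k. ext_gf r (?x k)) \<longlonglongrightarrow> ext_gf r L"
    using isCont_tendsto_compose[OF DERIV_isCont[OF ext_gf_deriv] L(1)] .
  moreover have "(\<lambda>k. ?x (Suc k)) \<longlonglongrightarrow> L" using L(1) by (rule LIMSEQ_Suc)
  ultimately have "ext_gf r L = L" by (simp add: LIMSEQ_unique)
  moreover have "L \<ge> ?q" using L(1) rng by (meson LIMSEQ_le_const less_imp_le)
  moreover have "L < 1" using L(2)[of 0] s by simp
  ultimately have "L = ?q" using no_fixed_point[OF r, of L] by fastforce
  then have "\<forall>\<^sub>F k in sequentially. ?x k < ?q + \<delta>"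
    using order_tendstoD(2)[OF L(1), of "?q + \<delta>"] \<delta> by simp
  then show ?thesis using that by (meson eventually_happens trivial_limit_sequentially)
qed

text \<open>This identity is where \<open>eta_const\<close> enters: the powers of
  \<open>real r * ext_prob r\<close> fall to \<open>1 / n\<close> after \<open>eta_const r\<close>
  times \<open>log r n\<close> steps.\<close>

lemma eta_pos_ln:
  assumes r: "r \<ge> 2"
  shows "eta_const r > 0" "ln (real r * ext_prob r) = - ln (real r) / eta_const r"
proof -
  have q: "ext_prob r > 0" by (rule ext_prob_pos[OF r])
  have "ln (ext_prob r) = - (real r * lambda_const r)"
    using ext_prob_fixed[OF r] by (metis ext_gf_def ext_prob_def ln_exp diff_diff_eq2 add_diff_cancel_left' )
  then have e: "ln (real r * ext_prob r) = ln (real r) - real r * lambda_const r"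
    using q r by (simp add: ln_mult)
  moreover have n: "ln (real r * ext_prob r) < 0" using mean_ext_less_1[OF r] q r by simp
  moreover have l: "ln (real r) > 0" using r by simp
  ultimately show "eta_const r > 0" unfolding eta_const_alt[OF r] by (simp add: mult.commute)
  show "ln (real r * ext_prob r) = - ln (real r) / eta_const r"
    unfolding eta_const_alt[OF r] using e l by (simp add: mult.commute)
qed

section \<open>Binomial expectations\<close>

definition binex :: "nat \<Rightarrow> real \<Rightarrow> (nat \<Rightarrow> real) \<Rightarrow> real" where
  "binex N p g = (\<Sum>j\<le>N. real (N choose j) * p ^ j * (1 - p) ^ (N - j) * g j)"

lemma binex_power: "binex N p (\<lambda>j. x ^ j) = (1 - p + p * x) ^ N"
proof -
  have "(p * x + (1 - p)) ^ N = (\<Sum>j\<le>N. real (N choose j) * (p * x) ^ j * (1 - p) ^ (N - j))"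
    by (rule binomial_ring)
  then show ?thesis unfolding binex_def by (simp add: power_mult_distrib algebra_simps)
qed

lemma binex_const: "binex N p (\<lambda>j. c) = c"
  using binex_power[of N p 1] by (simp add: binex_def flip: sum_distrib_right)

lemma binex_cmult: "binex N p (\<lambda>j. c * g j) = c * binex N p g"
  unfolding binex_def by (simp add: sum_distrib_left algebra_simps)

lemma binex_mono:
  assumes "0 \<le> p" "p \<le> 1" "\<And>j. j \<le> N \<Longrightarrow> g j \<le> h j"
  shows "binex N p g \<le> binex N p h"
  unfolding binex_def using assms by (intro sum_mono mult_left_mono) auto

text \<open>The derivative of \<open>binex_power\<close> with respect to \<open>x\<close>. The
  factor \<open>j\<close> discards empty layers, which a generating function alone would
  count.\<close>

lemma binex_size_biased:
  "binex N p (\<lambda>j. real j * x ^ (j - 1)) = real N * p * (1 - p + p * x) ^ (N - 1)"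
proof (cases N)
  case (Suc M)
  have "binex N p (\<lambda>j. real j * x ^ (j - 1)) =
    (\<Sum>j\<le>Suc M. real (Suc M choose j) * p ^ j * (1 - p) ^ (Suc M - j) * (real j * x ^ (j - 1)))"
    by (simp add: binex_def Suc)
  also have "\<dots> = (\<Sum>j\<le>M. real (Suc M choose Suc j) * p ^ Suc j * (1 - p) ^ (M - j) * (real (Suc j) * x ^ j))"
    by (subst sum.atMost_Suc_shift) simp
  also have "\<dots> = (\<Sum>j\<le>M. real (Suc M) * p * (real (M choose j) * p ^ j * (1 - p) ^ (M - j) * x ^ j))"
  proof (intro sum.cong refl)
    fix j
    have "real (Suc j) * real (Suc M choose Suc j) = real (Suc M) * real (M choose j)"
      by (metis Suc_times_binomial_eq mult.commute of_nat_mult)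
    then show "real (Suc M choose Suc j) * p ^ Suc j * (1 - p) ^ (M - j) * (real (Suc j) * x ^ j) =
      real (Suc M) * p * (real (M choose j) * p ^ j * (1 - p) ^ (M - j) * x ^ j)"
      by (simp add: algebra_simps del: binomial_Suc_Suc of_nat_Suc)
  qed
  also have "\<dots> = real (Suc M) * p * binex M p (\<lambda>j. x ^ j)"
    by (simp add: binex_def sum_distrib_left)
  finally show ?thesis by (simp add: binex_power Suc)
qed (simp add: binex_def)

lemma binex_id: "binex N p real = real N * p"
  using binex_size_biased[of N p 1] by (simp add: binex_def)

lemma binex_flip: "binex N p (\<lambda>j. g (N - j)) = binex N (1 - p) g"
  unfolding binex_def
proof (rule sum.reindex_bij_witness[of _ "\<lambda>j. N - j" "\<lambda>j. N - j"])
  fix j assume "j \<in> {..N}"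
  then show "real (N choose (N - j)) * (1 - p) ^ (N - j) * (1 - (1 - p)) ^ (N - (N - j)) * g (N - j) =
    real (N choose j) * p ^ j * (1 - p) ^ (N - j) * g (N - j)"
    using binomial_symmetric[of j N] by simp
qed auto

section \<open>Exponential tail bounds\<close>

lemma one_plus_power_le_exp:
  fixes y :: real
  assumes "-1 \<le> y"
  shows "(1 + y) ^ N \<le> exp (real N * y)"
proof -
  have "(1 + y) ^ N \<le> exp y ^ N" using assms by (intro power_mono) auto
  then show ?thesis by (simp add: exp_of_nat_mult)
qed

text \<open>Inverting the quadratic Taylor bound for \<open>exp y\<close> suffices, because the
  product of the two quadratics is \<open>1 + y ^ 4 / 4\<close>.\<close>

lemma exp_minus_le:
  fixes y :: real
  assumes y: "0 \<le> y"
  shows "exp (- y) \<le> 1 - y + y ^ 2 / 2"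
proof -
  have "exp (-y) \<le> 1 / (1 + y + y ^ 2 / 2)"
    unfolding exp_minus inverse_eq_divide using y exp_lower_Taylor_quadratic[OF y]
    by (intro divide_left_mono mult_pos_pos) (auto intro: add_pos_nonneg)
  also have "\<dots> \<le> 1 - y + y ^ 2 / 2"
  proof -
    have "(1 - y + y ^ 2 / 2) * (1 + y + y ^ 2 / 2) = 1 + y ^ 4 / 4"
      by (simp add: power2_eq_square power4_eq_xxxx algebra_simps)
    then have "1 \<le> (1 - y + y ^ 2 / 2) * (1 + y + y ^ 2 / 2)" by simp
    moreover have "1 + y + y ^ 2 / 2 > 0" using y by (simp add: add_pos_nonneg)
    ultimately show ?thesis by (simp add: divide_le_eq)
  qed
  finally show ?thesis .
qed

text \<open>Exponential Markov inequality with \<open>d\<close> itself as the tilt; this is not the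
  optimal tilt, but it keeps the exponent quadratic in \<open>d\<close>.\<close>

lemma chernoff_lower:
  fixes d :: real
  assumes p: "0 \<le> p" "p \<le> 1" and d: "0 \<le> d" "d \<le> 1" and y: "y \<le> (1 - d) * (real N * p)"
  shows "binex N p (\<lambda>j. of_bool (real j < y)) \<le> exp (- (d ^ 2 * (real N * p) / 2))"
proof -
  let ?m = "real N * p"
  have "binex N p (\<lambda>j. of_bool (real j < y)) \<le> binex N p (\<lambda>j. exp (d * y) * exp (- d) ^ j)"
  proof (intro binex_mono p)
    fix j
    have e: "exp (d * y) * exp (- d) ^ j = exp (d * (y - real j))"
      by (simp add: exp_of_nat_mult[symmetric] exp_add[symmetric]) (simp add: algebra_simps)
    have "1 \<le> exp (d * (y - real j))" if "real j < y" using that d by simp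
    then show "of_bool (real j < y) \<le> exp (d * y) * exp (- d) ^ j" unfolding e by simp
  qed
  also have "\<dots> = exp (d * y) * (1 + p * (exp (-d) - 1)) ^ N"
    unfolding binex_cmult binex_power by (simp add: algebra_simps)
  also have "\<dots> \<le> exp (d * y) * exp (real N * (p * (exp (-d) - 1)))"
  proof (intro mult_left_mono one_plus_power_le_exp)
    have "p * (1 - exp (-d)) \<le> 1 * 1" using p d by (intro mult_mono) auto
    then show "- 1 \<le> p * (exp (- d) - 1)" by (simp add: algebra_simps)
  qed simp
  also have "\<dots> = exp (d * y - ?m * (1 - exp (-d)))"
    by (simp add: exp_add[symmetric] algebra_simps)
  also have "\<dots> \<le> exp (- (d ^ 2 * ?m / 2))"
  proof -
    have "exp (-d) \<le> 1 - d + d ^ 2 / 2" using exp_minus_le[OF d(1)] .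
    then have "?m * (1 - exp (-d)) \<ge> ?m * (d - d ^ 2 / 2)" using p by (intro mult_left_mono) auto
    moreover have "d * y \<le> d * ((1 - d) * ?m)" using y d by (intro mult_left_mono)
    ultimately have "d * y - ?m * (1 - exp (-d)) \<le> d * ((1 - d) * ?m) - ?m * (d - d ^ 2 / 2)" by linarith
    also have "\<dots> = - (d ^ 2 * ?m / 2)" by (simp add: power2_eq_square algebra_simps)
    finally show ?thesis by simp
  qed
  finally show ?thesis .
qed

text \<open>The exponent contains the threshold \<open>y\<close> and not the mean, so the bound
  stays useful when the mean is far below \<open>y\<close>, as happens where \<open>y\<close> is
  kept above a floor. The tilt is \<open>d / 2\<close>.\<close>

lemma chernoff_upper:
  fixes d :: real
  assumes p: "0 \<le> p" "p \<le> 1" and d: "0 \<le> d" "d \<le> 1" and y: "(1 + d) * (real N * p) \<le> y"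
  shows "binex N p (\<lambda>j. of_bool (y < real j)) \<le> exp (- (d ^ 2 * y / 8))"
proof -
  let ?m = "real N * p" and ?t = "d / 2"
  have y0: "y \<ge> 0" using y p d by (smt (verit) mult_nonneg_nonneg of_nat_0_le_iff)
  have "binex N p (\<lambda>j. of_bool (y < real j)) \<le> binex N p (\<lambda>j. exp (- ?t * y) * exp ?t ^ j)"
  proof (intro binex_mono p)
    fix j
    have e: "exp (- ?t * y) * exp ?t ^ j = exp (?t * (real j - y))"
      by (simp add: exp_of_nat_mult[symmetric] exp_add[symmetric]) (simp add: algebra_simps)
    have "1 \<le> exp (?t * (real j - y))" if "y < real j" using that d by simp
    then show "of_bool (y < real j) \<le> exp (- ?t * y) * exp ?t ^ j" unfolding e by simp
  qed
  also have "\<dots> = exp (- ?t * y) * (1 + p * (exp ?t - 1)) ^ N"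
    unfolding binex_cmult binex_power by (simp add: algebra_simps)
  also have "\<dots> \<le> exp (- ?t * y) * exp (real N * (p * (exp ?t - 1)))"
  proof (intro mult_left_mono one_plus_power_le_exp)
    have "0 \<le> p * (exp ?t - 1)" using p d by (intro mult_nonneg_nonneg) auto
    then show "- 1 \<le> p * (exp ?t - 1)" by linarith
  qed simp
  also have "\<dots> = exp (?m * (exp ?t - 1) - ?t * y)"
    by (simp add: exp_add[symmetric] algebra_simps)
  also have "\<dots> \<le> exp (- (d ^ 2 * y / 8))"
  proof -
    have "exp ?t \<le> 1 + ?t + ?t ^ 2" using exp_bound[of ?t] d by simp
    then have "?m * (exp ?t - 1) \<le> ?m * (?t + ?t ^ 2)" using p by (intro mult_left_mono) auto
    also have "?m * (?t + ?t ^ 2) \<le> y / (1 + d) * (?t + ?t ^ 2)"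
      using y d by (intro mult_right_mono) (auto simp: field_simps)
    finally have "?m * (exp ?t - 1) - ?t * y \<le> y * ((?t + ?t ^ 2) / (1 + d) - ?t)"
      unfolding right_diff_distrib by (simp add: mult.commute)
    also have "(?t + ?t ^ 2) / (1 + d) - ?t = - (d ^ 2 / 4 / (1 + d))"
      using d by (simp add: field_simps power2_eq_square)
    also have "y * (- (d ^ 2 / 4 / (1 + d))) \<le> y * (- (d ^ 2 / 8))"
    proof (intro mult_left_mono y0)
      have "d ^ 2 / 4 / 2 \<le> d ^ 2 / 4 / (1 + d)" using d by (intro divide_left_mono) auto
      then show "- (d ^ 2 / 4 / (1 + d)) \<le> - (d ^ 2 / 8)" by simp
    qed
    finally show ?thesis by (simp add: mult.commute)
  qed
  finally show ?thesis .
qed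

section \<open>Counting maps by exploration history\<close>

locale rout =
  fixes n r :: nat
  assumes n: "n \<ge> 1" and r: "r \<ge> 2"
begin

definition V :: "nat set" where "V = {1..n}"
definition J :: "nat set" where "J = {1..r}"
text \<open>All \<open>r\<close> arcs of one vertex form a single coordinate, because a history
  restricts these tuples vertex by vertex.\<close>

definition T :: "(nat \<Rightarrow> nat) set" where "T = PiE J (\<lambda>_. V)"
definition \<Omega> :: "(nat \<Rightarrow> nat \<Rightarrow> nat) set" where "\<Omega> = PiE V (\<lambda>_. T)"

text \<open>Explored against the arcs: the vertices from which \<open>v\<close> is reached in at
  most \<open>k\<close> steps.\<close>

primrec ball :: "nat \<Rightarrow> (nat \<Rightarrow> nat \<Rightarrow> nat) \<Rightarrow> nat \<Rightarrow> nat set" where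
  "ball v \<omega> 0 = {v}"
| "ball v \<omega> (Suc k) = ball v \<omega> k \<union> {i \<in> V. \<exists>j\<in>J. \<omega> i j \<in> ball v \<omega> k}"

text \<open>The empty set at 0 is a genuine initial value: before the first step no arc has been
  looked at, so at \<open>k = 0\<close> the value of \<open>pfree\<close> is \<open>n\<close> and
  that of \<open>layer\<close> is 1.\<close>

definition pre :: "(nat \<Rightarrow> nat set) \<Rightarrow> nat \<Rightarrow> nat set" where
  "pre \<sigma> k = (case k of 0 \<Rightarrow> {} | Suc l \<Rightarrow> \<sigma> l)"

lemma pre_simps [simp]: "pre \<sigma> 0 = {}" "pre \<sigma> (Suc l) = \<sigma> l"
  by (auto simp: pre_def)

text \<open>Once the balls of radius at most \<open>k\<close> are known, the arcs of an unexplored vertex are uniform on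
  the complement of the ball of radius \<open>k - 1\<close>, so it joins layer \<open>k + 1\<close> with probability \<open>hit\<close>.\<close>

definition free :: "nat \<Rightarrow> (nat \<Rightarrow> nat \<Rightarrow> nat) \<Rightarrow> nat \<Rightarrow> nat" where
  "free v \<omega> k = n - card (ball v \<omega> k)"
definition pfree :: "nat \<Rightarrow> (nat \<Rightarrow> nat \<Rightarrow> nat) \<Rightarrow> nat \<Rightarrow> nat" where
  "pfree v \<omega> k = n - card (pre (ball v \<omega>) k)"
definition layer :: "nat \<Rightarrow> (nat \<Rightarrow> nat \<Rightarrow> nat) \<Rightarrow> nat \<Rightarrow> nat" where
  "layer v \<omega> k = card (ball v \<omega> k) - card (pre (ball v \<omega>) k)"
definition hit :: "nat \<Rightarrow> (nat \<Rightarrow> nat \<Rightarrow> nat) \<Rightarrow> nat \<Rightarrow> real" where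
  "hit v \<omega> k = 1 - (real (free v \<omega> k) / real (pfree v \<omega> k)) ^ r"

text \<open>Averages over a finite set: up to the last section all probability is counting.\<close>

definition ex :: "((nat \<Rightarrow> nat \<Rightarrow> nat) \<Rightarrow> real) \<Rightarrow> real" where
  "ex f = (\<Sum>\<omega>\<in>\<Omega>. f \<omega>) / real (card \<Omega>)"
definition prb :: "((nat \<Rightarrow> nat \<Rightarrow> nat) \<Rightarrow> bool) \<Rightarrow> real" where
  "prb P = ex (\<lambda>\<omega>. of_bool (P \<omega>))"

text \<open>The counterpart of measurability with respect to the first \<open>k\<close> layers.
  \<open>G\<close> may be function-valued, so that a test applied to the next layer can depend on
  the history.\<close>

definition determined :: "nat \<Rightarrow> nat \<Rightarrow> ((nat \<Rightarrow> nat \<Rightarrow> nat) \<Rightarrow> 'b) \<Rightarrow> bool" where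
  "determined v k G \<longleftrightarrow>
     (\<forall>\<omega>\<in>\<Omega>. \<forall>\<omega>'\<in>\<Omega>. (\<forall>i\<le>k. ball v \<omega> i = ball v \<omega>' i) \<longrightarrow> G \<omega> = G \<omega>')"

lemma finite_V [simp]: "finite V" and finite_J [simp]: "finite J"
  and card_V [simp]: "card V = n" and card_J [simp]: "card J = r"
  by (auto simp: V_def J_def)

lemma finite_T [simp]: "finite T" and card_T: "card T = n ^ r"
  by (auto simp: T_def intro!: finite_PiE) (simp add: card_PiE)

lemma finite_\<Omega> [simp]: "finite \<Omega>" and card_\<Omega>: "card \<Omega> = (n ^ r) ^ n"
  by (auto simp: \<Omega>_def intro!: finite_PiE) (simp add: card_PiE card_T)

lemma card_\<Omega>_pos [simp]: "0 < card \<Omega>"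
  using n by (simp add: card_\<Omega>)

lemma ball_subset: "v \<in> V \<Longrightarrow> ball v \<omega> k \<subseteq> V"
  by (induction k) auto

lemma finite_ball [simp]: "v \<in> V \<Longrightarrow> finite (ball v \<omega> k)"
  using ball_subset finite_V by (metis finite_subset)

lemma ball_mono: "k \<le> l \<Longrightarrow> ball v \<omega> k \<subseteq> ball v \<omega> l"
  by (rule lift_Suc_mono_le[of "ball v \<omega>"]) auto

lemma pre_ball_subset: "pre (ball v \<omega>) k \<subseteq> ball v \<omega> k"
  using ball_mono[of "k - 1" k v \<omega>] by (cases k) auto

lemma card_ball_le: "v \<in> V \<Longrightarrow> card (ball v \<omega> k) \<le> n"
  using card_mono[OF finite_V ball_subset] by simp

lemma card_pre_ball_le: "v \<in> V \<Longrightarrow> card (pre (ball v \<omega>) k) \<le> card (ball v \<omega> k)"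
  by (intro card_mono pre_ball_subset) auto

lemma free_le_pfree: "v \<in> V \<Longrightarrow> free v \<omega> k \<le> pfree v \<omega> k"
  using card_pre_ball_le unfolding free_def pfree_def by (simp add: diff_le_mono2)

lemma pfree_Suc: "pfree v \<omega> (Suc k) = free v \<omega> k"
  by (simp add: pfree_def free_def)

lemma free_layer: "v \<in> V \<Longrightarrow> free v \<omega> k + layer v \<omega> k = pfree v \<omega> k"
  using card_pre_ball_le[of v \<omega> k] card_ball_le[of v \<omega> k] by (simp add: free_def layer_def pfree_def)

lemma hit_01: "v \<in> V \<Longrightarrow> 0 \<le> hit v \<omega> k \<and> hit v \<omega> k \<le> 1"
  using free_le_pfree[of v \<omega> k]
  by (auto simp: hit_def divide_le_eq_1 intro!: power_le_one)

lemma card_ball_sum: "v \<in> V \<Longrightarrow> card (ball v \<omega> k) = (\<Sum>i\<le>k. layer v \<omega> i)"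
proof (induction k)
  case 0 then show ?case by (simp add: layer_def)
next
  case (Suc k)
  have "card (ball v \<omega> k) \<le> card (ball v \<omega> (Suc k))"
    using Suc.prems by (intro card_mono ball_mono) auto
  then show ?case using Suc by (simp add: layer_def del: ball.simps)
qed

definition hist_set :: "nat \<Rightarrow> (nat \<Rightarrow> nat set) \<Rightarrow> nat \<Rightarrow> (nat \<Rightarrow> nat) set" where
  "hist_set t \<sigma> i = {\<tau> \<in> T. \<forall>k<t. i \<in> \<sigma> (Suc k) \<longleftrightarrow> i \<in> \<sigma> k \<or> (\<exists>j\<in>J. \<tau> j \<in> \<sigma> k)}"

lemma finite_hist_set [simp]: "finite (hist_set t \<sigma> i)"
  by (auto simp: hist_set_def)

lemma \<Omega>_mem: "\<omega> \<in> \<Omega> \<Longrightarrow> i \<in> V \<Longrightarrow> \<omega> i \<in> T"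
  by (auto simp: \<Omega>_def)

text \<open>A history constrains the arcs of each vertex separately, so its class is a product set.\<close>

lemma history_class:
  assumes v: "v \<in> V" and \<sigma>: "\<sigma> 0 = {v}" "\<And>k. k \<le> t \<Longrightarrow> \<sigma> k \<subseteq> V"
  shows "{\<omega> \<in> \<Omega>. \<forall>i\<le>t. ball v \<omega> i = \<sigma> i} = PiE V (hist_set t \<sigma>)"
proof (intro set_eqI iffI)
  fix \<omega> assume "\<omega> \<in> {\<omega> \<in> \<Omega>. \<forall>i\<le>t. ball v \<omega> i = \<sigma> i}"
  then have w: "\<omega> \<in> \<Omega>" and b: "\<And>i. i \<le> t \<Longrightarrow> ball v \<omega> i = \<sigma> i" by auto
  show "\<omega> \<in> PiE V (hist_set t \<sigma>)"
  proof (rule PiE_I)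
    fix i assume i: "i \<in> V"
    have "i \<in> \<sigma> (Suc k) \<longleftrightarrow> i \<in> \<sigma> k \<or> (\<exists>j\<in>J. \<omega> i j \<in> \<sigma> k)" if "k < t" for k
      using that b[of k] b[of "Suc k"] i by auto
    then show "\<omega> i \<in> hist_set t \<sigma> i" using \<Omega>_mem[OF w i] by (auto simp: hist_set_def)
  next
    fix i assume "i \<notin> V" then show "\<omega> i = undefined" using w by (auto simp: \<Omega>_def)
  qed
next
  fix \<omega> assume h: "\<omega> \<in> PiE V (hist_set t \<sigma>)"
  then have w: "\<omega> \<in> \<Omega>" by (auto simp: \<Omega>_def PiE_iff hist_set_def)
  have "k \<le> t \<longrightarrow> ball v \<omega> k = \<sigma> k" for k
  proof (induction k)
    case (Suc k)
    show ?case
    proof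
      assume k: "Suc k \<le> t"
      have "i \<in> \<sigma> (Suc k) \<longleftrightarrow> i \<in> \<sigma> k \<or> (\<exists>j\<in>J. \<omega> i j \<in> \<sigma> k)" if "i \<in> V" for i
        using h that k by (auto simp: hist_set_def PiE_iff)
      then show "ball v \<omega> (Suc k) = \<sigma> (Suc k)"
        using Suc k \<sigma>(2)[of k] \<sigma>(2)[of "Suc k"] by auto
    qed
  qed (use \<sigma> in simp)
  then show "\<omega> \<in> {\<omega> \<in> \<Omega>. \<forall>i\<le>t. ball v \<omega> i = \<sigma> i}" using w by auto
qed

lemma card_avoid:
  assumes "A \<subseteq> V"
  shows "card {\<tau> \<in> T. \<forall>j\<in>J. \<tau> j \<notin> A} = (n - card A) ^ r"
proof -
  have "{\<tau> \<in> T. \<forall>j\<in>J. \<tau> j \<notin> A} = PiE J (\<lambda>_. V - A)" by (auto simp: T_def PiE_iff extensional_def)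
  then show ?thesis using assms
    by (simp add: card_PiE card_Diff_subset finite_subset[OF assms])
qed

lemma card_avoid_hit:
  assumes "A \<subseteq> B" "B \<subseteq> V"
  shows "card {\<tau> \<in> T. (\<forall>j\<in>J. \<tau> j \<notin> A) \<and> (\<exists>j\<in>J. \<tau> j \<in> B)} = (n - card A) ^ r - (n - card B) ^ r"
proof -
  have "{\<tau> \<in> T. (\<forall>j\<in>J. \<tau> j \<notin> A) \<and> (\<exists>j\<in>J. \<tau> j \<in> B)} =
    {\<tau> \<in> T. \<forall>j\<in>J. \<tau> j \<notin> A} - {\<tau> \<in> T. \<forall>j\<in>J. \<tau> j \<notin> B}" using assms by auto
  then show ?thesis
    using assms card_avoid[of A] card_avoid[of B]
    by (simp only:, subst card_Diff_subset) auto
qed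

text \<open>For a vertex outside all sets so far the constraints are nested, and only the largest
  set to be avoided, the one before the last, remains.\<close>

lemma hist_set_outside:
  assumes mono: "\<forall>k<t. \<sigma> k \<subseteq> \<sigma> (Suc k)" and i: "i \<notin> \<sigma> t"
  shows "hist_set t \<sigma> i = {\<tau> \<in> T. \<forall>j\<in>J. \<tau> j \<notin> pre \<sigma> t}"
proof -
  have sub: "\<sigma> k \<subseteq> \<sigma> l" if "k \<le> l" "l \<le> t" for k l
    using that
  proof (induction l rule: dec_induct)
    case (step m)
    then have "\<sigma> m \<subseteq> \<sigma> (Suc m)" using mono by auto
    then show ?case using step by auto
  qed auto
  have ni: "i \<notin> \<sigma> k" if "k \<le> t" for k using sub[OF that] i by auto
  show ?thesis
  proof (cases t)
    case (Suc l)
    have "(\<forall>k<t. i \<in> \<sigma> (Suc k) \<longleftrightarrow> i \<in> \<sigma> k \<or> (\<exists>j\<in>J. \<tau> j \<in> \<sigma> k)) \<longleftrightarrow> (\<forall>k<t. \<forall>j\<in>J. \<tau> j \<notin> \<sigma> k)" for \<tau>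
    proof -
      have "i \<notin> \<sigma> k \<and> i \<notin> \<sigma> (Suc k)" if "k < t" for k using ni[of k] ni[of "Suc k"] that by auto
      then show ?thesis by blast
    qed
    moreover have "(\<forall>k<t. \<forall>j\<in>J. \<tau> j \<notin> \<sigma> k) \<longleftrightarrow> (\<forall>j\<in>J. \<tau> j \<notin> \<sigma> l)" for \<tau>
      using sub[of _ l] Suc by (auto simp: less_Suc_eq_le)
    ultimately show ?thesis by (simp add: hist_set_def Suc)
  qed (simp add: hist_set_def)
qed

lemma hist_set_Suc:
  "hist_set (Suc t) (\<sigma>(Suc t := A)) i =
    {\<tau> \<in> hist_set t \<sigma> i. i \<in> A \<longleftrightarrow> i \<in> \<sigma> t \<or> (\<exists>j\<in>J. \<tau> j \<in> \<sigma> t)}"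
proof -
  have eq: "(\<sigma>(Suc t := A)) (Suc k) = \<sigma> (Suc k)" "(\<sigma>(Suc t := A)) k = \<sigma> k" if "k < t" for k
    using that by auto
  have "(\<forall>k<Suc t. i \<in> (\<sigma>(Suc t := A)) (Suc k) \<longleftrightarrow> i \<in> (\<sigma>(Suc t := A)) k \<or> (\<exists>j\<in>J. \<tau> j \<in> (\<sigma>(Suc t := A)) k)) \<longleftrightarrow>
    (i \<in> A \<longleftrightarrow> i \<in> \<sigma> t \<or> (\<exists>j\<in>J. \<tau> j \<in> \<sigma> t)) \<and>
    (\<forall>k<t. i \<in> \<sigma> (Suc k) \<longleftrightarrow> i \<in> \<sigma> k \<or> (\<exists>j\<in>J. \<tau> j \<in> \<sigma> k))" for \<tau>
    unfolding All_less_Suc using eq by simp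
  then show ?thesis unfolding hist_set_def by blast
qed

lemma hist_set_extend:
  assumes i: "i \<in> \<sigma> t"
  shows "hist_set (Suc t) (\<sigma>(Suc t := \<sigma> t \<union> S)) i = hist_set t \<sigma> i"
  unfolding hist_set_Suc using i by auto

lemma hist_set_extend_out:
  assumes mono: "\<forall>k<t. \<sigma> k \<subseteq> \<sigma> (Suc k)" and i: "i \<notin> \<sigma> t"
  shows "hist_set (Suc t) (\<sigma>(Suc t := \<sigma> t \<union> S)) i =
    (if i \<in> S then {\<tau> \<in> T. (\<forall>j\<in>J. \<tau> j \<notin> pre \<sigma> t) \<and> (\<exists>j\<in>J. \<tau> j \<in> \<sigma> t)}
     else {\<tau> \<in> T. \<forall>j\<in>J. \<tau> j \<notin> \<sigma> t})"
proof -
  have pre: "pre \<sigma> t \<subseteq> \<sigma> t" using mono by (cases t) auto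
  show ?thesis
    unfolding hist_set_Suc hist_set_outside[of t \<sigma>, OF mono i] using i pre by auto
qed

text \<open>Explored vertices are not constrained further. An outside vertex has
  \<open>M ^ r\<close> tuples left; it joins with \<open>M ^ r - N ^ r\<close> of them and stays out
  with \<open>N ^ r\<close>, in the proportions \<open>p\<close> and \<open>1 - p\<close>. One step
  is therefore a binomial choice.\<close>

lemma card_history_extend:
  assumes mono: "\<forall>k<t. \<sigma> k \<subseteq> \<sigma> (Suc k)" and sub: "\<sigma> t \<subseteq> V" and S: "S \<subseteq> V - \<sigma> t"
  defines "p \<equiv> 1 - (real (n - card (\<sigma> t)) / real (n - card (pre \<sigma> t))) ^ r"
  shows "real (card (PiE V (hist_set (Suc t) (\<sigma>(Suc t := \<sigma> t \<union> S))))) =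
    real (card (PiE V (hist_set t \<sigma>))) * (p ^ card S * (1 - p) ^ (n - card (\<sigma> t) - card S))"
proof -
  define N where "N = n - card (\<sigma> t)"
  define M where "M = n - card (pre \<sigma> t)"
  have pre: "pre \<sigma> t \<subseteq> \<sigma> t" using mono by (cases t) auto
  have fin: "finite (\<sigma> t)" "finite S" using sub S finite_V by (auto intro: finite_subset)
  have NM: "N \<le> M" unfolding N_def M_def using card_mono[OF fin(1) pre] by simp
  let ?h = "\<lambda>i. real (card (hist_set t \<sigma> i))"
  let ?h' = "\<lambda>i. real (card (hist_set (Suc t) (\<sigma>(Suc t := \<sigma> t \<union> S)) i))"
  define R where "R = V - \<sigma> t - S"
  have split: "(\<Prod>i\<in>V. f i) = (\<Prod>i\<in>\<sigma> t. f i) * ((\<Prod>i\<in>S. f i) * (\<Prod>i\<in>R. f i))" for f :: "nat \<Rightarrow> real"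
  proof -
    have V: "V = \<sigma> t \<union> (S \<union> R)" using sub S by (auto simp: R_def)
    have R: "finite R" by (simp add: R_def)
    have "\<sigma> t \<inter> (S \<union> R) = {}" "S \<inter> R = {}" using S by (auto simp: R_def)
    then show ?thesis using fin R
      by (subst V) (simp only: prod.union_disjoint finite_UnI)
  qed
  have cR: "card R = N - card S" "card S \<le> N"
  proof -
    have c: "card (V - \<sigma> t) = N" using card_Diff_subset[OF fin(1) sub] by (simp add: N_def)
    show "card R = N - card S" unfolding R_def using card_Diff_subset[OF fin(2) S] c by simp
    show "card S \<le> N" using card_mono[OF _ S] c by simp
  qed
  have preV: "pre \<sigma> t \<subseteq> V" using pre sub by auto
  have h_out: "?h i = real M ^ r" if "i \<notin> \<sigma> t" for i
    unfolding hist_set_outside[of t \<sigma>, OF mono that] card_avoid[OF preV] by (simp add: M_def)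
  have h'_S: "?h' i = real M ^ r - real N ^ r" if "i \<in> S" for i
  proof -
    have i: "i \<notin> \<sigma> t" using that S by auto
    have "?h' i = real (M ^ r - N ^ r)"
      unfolding hist_set_extend_out[of t \<sigma>, OF mono i] using that card_avoid_hit[OF pre sub] by (simp add: M_def N_def)
    then show ?thesis using NM by (simp add: of_nat_diff power_mono)
  qed
  have h'_R: "?h' i = real N ^ r" if "i \<in> R" for i
  proof -
    have i: "i \<notin> \<sigma> t" "i \<notin> S" using that by (auto simp: R_def)
    show ?thesis unfolding hist_set_extend_out[of t \<sigma>, OF mono i(1)] using i(2) card_avoid[OF sub] by (simp add: N_def)
  qed
  have p': "1 - p = (real N / real M) ^ r" by (simp add: p_def N_def M_def)
  \<comment> \<open>If \<open>M\<close> is 0 then so is \<open>N\<close>, and both sides vanish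
    because \<open>r\<close> is positive.\<close>
  have Mp: "real M ^ r * (1 - p) = real N ^ r"
    unfolding p' using NM r by (cases "M = 0") (auto simp: power_divide)
  then have Mp': "real M ^ r - real N ^ r = real M ^ r * p" by (simp add: algebra_simps)
  have "real (card (PiE V (hist_set (Suc t) (\<sigma>(Suc t := \<sigma> t \<union> S))))) = (\<Prod>i\<in>V. ?h' i)"
    by (simp add: card_PiE)
  also have "\<dots> = (\<Prod>i\<in>\<sigma> t. ?h i) * ((real M ^ r * p) ^ card S * (real M ^ r * (1 - p)) ^ card R)"
    unfolding split[of ?h'] using h'_S h'_R hist_set_extend[of _ \<sigma> t S] Mp Mp' by simp
  also have "\<dots> = (\<Prod>i\<in>\<sigma> t. ?h i) * ((real M ^ r) ^ card S * (real M ^ r) ^ card R) * (p ^ card S * (1 - p) ^ card R)"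
    by (simp add: power_mult_distrib)
  also have "(\<Prod>i\<in>\<sigma> t. ?h i) * ((real M ^ r) ^ card S * (real M ^ r) ^ card R) = (\<Prod>i\<in>V. ?h i)"
  proof -
    have "(\<Prod>i\<in>S. ?h i) = (real M ^ r) ^ card S" using h_out S by (subst prod.cong[OF refl, of S _ "\<lambda>_. real M ^ r"]) auto
    moreover have "(\<Prod>i\<in>R. ?h i) = (real M ^ r) ^ card R" using h_out by (subst prod.cong[OF refl, of R _ "\<lambda>_. real M ^ r"]) (auto simp: R_def)
    ultimately show ?thesis unfolding split[of ?h] by simp
  qed
  also have "(\<Prod>i\<in>V. ?h i) = real (card (PiE V (hist_set t \<sigma>)))" by (simp add: card_PiE)
  finally show ?thesis unfolding cR(1) N_def .
qed

lemma sum_Pow_card: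
  fixes f :: "nat \<Rightarrow> real"
  assumes "finite X"
  shows "(\<Sum>S\<in>Pow X. f (card S)) = (\<Sum>j\<le>card X. real (card X choose j) * f j)"
proof -
  have "(\<Sum>S\<in>Pow X. f (card S)) = (\<Sum>j\<in>{..card X}. \<Sum>S\<in>{S \<in> Pow X. card S = j}. f (card S))"
    using assms by (intro sum.group[symmetric]) (auto intro: card_mono)
  also have "\<dots> = (\<Sum>j\<le>card X. real (card X choose j) * f j)"
    using n_subsets[OF assms] by (intro sum.cong) (auto simp: Pow_def)
  finally show ?thesis .
qed

text \<open>A history class is split by the set of new vertices, and the weight of a part depends
  only on how many new vertices there are.\<close>

lemma class_sum:
  fixes k :: nat and f :: "nat \<Rightarrow> real"
  assumes v: "v \<in> V" and w: "\<omega>\<^sub>0 \<in> \<Omega>"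
  defines "E \<equiv> {\<omega> \<in> \<Omega>. \<forall>i\<le>k. ball v \<omega> i = ball v \<omega>\<^sub>0 i}"
  shows "(\<Sum>\<omega>\<in>E. f (layer v \<omega> (Suc k))) =
    real (card E) * binex (free v \<omega>\<^sub>0 k) (hit v \<omega>\<^sub>0 k) f"
proof -
  let ?\<sigma> = "ball v \<omega>\<^sub>0" and ?X = "V - ball v \<omega>\<^sub>0 k"
  let ?p = "hit v \<omega>\<^sub>0 k" and ?N = "free v \<omega>\<^sub>0 k"
  let ?new = "\<lambda>\<omega>. ball v \<omega> (Suc k) - ball v \<omega> k"
  have cX: "card ?X = ?N"
    using card_Diff_subset[OF _ ball_subset[OF v]] v by (simp add: free_def)
  have E: "E = PiE V (hist_set k ?\<sigma>)"
    unfolding E_def using v by (intro history_class) (auto dest: ball_subset)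
  have ES: "{\<omega> \<in> E. ?new \<omega> = S} = PiE V (hist_set (Suc k) (?\<sigma>(Suc k := ?\<sigma> k \<union> S)))"
    if S: "S \<subseteq> ?X" for S
  proof -
    have "PiE V (hist_set (Suc k) (?\<sigma>(Suc k := ?\<sigma> k \<union> S))) =
      {\<omega> \<in> \<Omega>. \<forall>i\<le>Suc k. ball v \<omega> i = (?\<sigma>(Suc k := ?\<sigma> k \<union> S)) i}"
      using v S by (intro history_class[symmetric]) (auto dest: ball_subset split: if_splits)
    also have "\<dots> = {\<omega> \<in> E. ball v \<omega> (Suc k) = ?\<sigma> k \<union> S}"
      by (auto simp: E_def le_Suc_eq simp del: ball.simps)
    also have "\<dots> = {\<omega> \<in> E. ?new \<omega> = S}"
    proof -
      have "ball v \<omega> (Suc k) = ?\<sigma> k \<union> S \<longleftrightarrow> ?new \<omega> = S" if "\<omega> \<in> E" for \<omega>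
      proof -
        have "ball v \<omega> k = ?\<sigma> k" using that by (auto simp: E_def)
        then have "?\<sigma> k \<subseteq> ball v \<omega> (Suc k)" "?new \<omega> = ball v \<omega> (Suc k) - ?\<sigma> k"
          using ball_mono[of k "Suc k" v \<omega>] by auto
        then show ?thesis using S by blast
      qed
      then show ?thesis by blast
    qed
    finally show ?thesis by simp
  qed
  have finE: "finite E" by (simp add: E_def)
  have lay: "layer v \<omega> (Suc k) = card (?new \<omega>)" for \<omega>
    using card_Diff_subset[OF finite_ball[OF v] ball_mono[of k "Suc k" v \<omega>]] by (simp add: layer_def del: ball.simps)
  have "(\<Sum>\<omega>\<in>E. f (layer v \<omega> (Suc k))) = (\<Sum>S\<in>Pow ?X. \<Sum>\<omega>\<in>{\<omega> \<in> E. ?new \<omega> = S}. f (layer v \<omega> (Suc k)))"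
    using finE v by (intro sum.group[symmetric]) (auto simp: E_def dest: ball_subset)
  also have "\<dots> = (\<Sum>S\<in>Pow ?X. real (card {\<omega> \<in> E. ?new \<omega> = S}) * f (card S))"
    by (intro sum.cong refl) (simp add: lay)
  also have "\<dots> = (\<Sum>S\<in>Pow ?X. real (card E) * (?p ^ card S * (1 - ?p) ^ (?N - card S) * f (card S)))"
  proof (intro sum.cong refl)
    fix S assume "S \<in> Pow ?X"
    then have S: "S \<subseteq> ?X" by auto
    show "real (card {\<omega> \<in> E. ?new \<omega> = S}) * f (card S) =
      real (card E) * (?p ^ card S * (1 - ?p) ^ (?N - card S) * f (card S))"
      unfolding ES[OF S] unfolding E hit_def free_def pfree_def
      using card_history_extend[of k ?\<sigma>, OF _ ball_subset[OF v] S] ball_mono[of _ "Suc _" v \<omega>\<^sub>0]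
      by (simp del: ball.simps)
  qed
  also have "\<dots> = real (card E) * (\<Sum>S\<in>Pow ?X. ?p ^ card S * (1 - ?p) ^ (?N - card S) * f (card S))"
    by (simp add: sum_distrib_left)
  also have "(\<Sum>S\<in>Pow ?X. ?p ^ card S * (1 - ?p) ^ (?N - card S) * f (card S)) = binex ?N ?p f"
    using sum_Pow_card[of ?X "\<lambda>j. ?p ^ j * (1 - ?p) ^ (?N - j) * f j"] cX
    by (simp add: binex_def mult.assoc)
  finally show ?thesis .
qed

text \<open>Conditional expectation given the first \<open>k\<close> layers, obtained by summing
  \<open>class_sum\<close> over all history classes; \<open>G \<omega>\<close> is constant on each
  class.\<close>

lemma tower:
  assumes v: "v \<in> V" and G: "determined v k G"
  shows "ex (\<lambda>\<omega>. G \<omega> (layer v \<omega> (Suc k))) = ex (\<lambda>\<omega>. binex (free v \<omega> k) (hit v \<omega> k) (G \<omega>))"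
proof -
  \<comment> \<open>Cutting off at \<open>k\<close> makes agreement of histories an equality of
    functions, so the classes are the fibres of one map.\<close>
  define key where "key = (\<lambda>\<omega> i. if i \<le> k then ball v \<omega> i else {})"
  have eq: "key \<omega> = key \<omega>' \<longleftrightarrow> (\<forall>i\<le>k. ball v \<omega> i = ball v \<omega>' i)" for \<omega> \<omega>'
    unfolding key_def fun_eq_iff by auto
  have "(\<Sum>\<omega>\<in>\<Omega>. G \<omega> (layer v \<omega> (Suc k))) =
    (\<Sum>y\<in>key ` \<Omega>. \<Sum>\<omega>\<in>{\<omega> \<in> \<Omega>. key \<omega> = y}. G \<omega> (layer v \<omega> (Suc k)))"
    by (rule sum.image_gen) simp
  also have "\<dots> = (\<Sum>y\<in>key ` \<Omega>. \<Sum>\<omega>\<in>{\<omega> \<in> \<Omega>. key \<omega> = y}. binex (free v \<omega> k) (hit v \<omega> k) (G \<omega>))"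
  proof (rule sum.cong[OF refl])
    fix y assume "y \<in> key ` \<Omega>"
    then obtain \<omega>\<^sub>0 where w: "\<omega>\<^sub>0 \<in> \<Omega>" and y: "y = key \<omega>\<^sub>0" by auto
    let ?E = "{\<omega> \<in> \<Omega>. \<forall>i\<le>k. ball v \<omega> i = ball v \<omega>\<^sub>0 i}"
    have E: "{\<omega> \<in> \<Omega>. key \<omega> = y} = ?E" using eq y by auto
    have Gw: "G \<omega> = G \<omega>\<^sub>0" if "\<omega> \<in> ?E" for \<omega> using that G w unfolding determined_def by blast
    have pre: "pre (ball v \<omega>) k = pre (ball v \<omega>\<^sub>0) k" if "\<omega> \<in> ?E" for \<omega>
      using that by (cases k) auto
    have "(\<Sum>\<omega>\<in>?E. G \<omega> (layer v \<omega> (Suc k))) = (\<Sum>\<omega>\<in>?E. G \<omega>\<^sub>0 (layer v \<omega> (Suc k)))"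
      using Gw by (intro sum.cong) auto
    also have "\<dots> = real (card ?E) * binex (free v \<omega>\<^sub>0 k) (hit v \<omega>\<^sub>0 k) (G \<omega>\<^sub>0)"
      by (rule class_sum[OF v w])
    also have "\<dots> = (\<Sum>\<omega>\<in>?E. binex (free v \<omega> k) (hit v \<omega> k) (G \<omega>))"
      using Gw pre by (subst sum.cong[OF refl, of ?E _ "\<lambda>_. binex (free v \<omega>\<^sub>0 k) (hit v \<omega>\<^sub>0 k) (G \<omega>\<^sub>0)"])
        (auto simp: free_def pfree_def hit_def)
    finally show "(\<Sum>\<omega>\<in>{\<omega> \<in> \<Omega>. key \<omega> = y}. G \<omega> (layer v \<omega> (Suc k))) =
      (\<Sum>\<omega>\<in>{\<omega> \<in> \<Omega>. key \<omega> = y}. binex (free v \<omega> k) (hit v \<omega> k) (G \<omega>))" unfolding E .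
  qed
  also have "\<dots> = (\<Sum>\<omega>\<in>\<Omega>. binex (free v \<omega> k) (hit v \<omega> k) (G \<omega>))"
    by (rule sum.image_gen[symmetric]) simp
  finally show ?thesis by (simp add: ex_def)
qed

section \<open>Calculus of finite averages and probabilities\<close>

lemma ex_mono: "(\<And>\<omega>. \<omega> \<in> \<Omega> \<Longrightarrow> f \<omega> \<le> g \<omega>) \<Longrightarrow> ex f \<le> ex g"
  unfolding ex_def by (intro divide_right_mono sum_mono) auto

lemma ex_cong: "(\<And>\<omega>. \<omega> \<in> \<Omega> \<Longrightarrow> f \<omega> = g \<omega>) \<Longrightarrow> ex f = ex g"
  unfolding ex_def by (auto intro!: sum.cong)

lemma ex_cmult: "ex (\<lambda>\<omega>. c * f \<omega>) = c * ex f"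
  by (simp add: ex_def sum_distrib_left)

lemma ex_add: "ex (\<lambda>\<omega>. f \<omega> + g \<omega>) = ex f + ex g"
  by (simp add: ex_def sum.distrib add_divide_distrib)

lemma ex_sum: "ex (\<lambda>\<omega>. \<Sum>i\<in>I. f i \<omega>) = (\<Sum>i\<in>I. ex (f i))"
  unfolding ex_def by (subst sum.swap) (simp add: sum_divide_distrib)

lemma ex_const: "ex (\<lambda>_. c) = c"
proof -
  have "real (card \<Omega>) \<noteq> 0" using card_\<Omega>_pos by linarith
  then show ?thesis unfolding ex_def sum_constant by (metis nonzero_mult_div_cancel_left)
qed

lemma prb_mono: "(\<And>\<omega>. \<omega> \<in> \<Omega> \<Longrightarrow> P \<omega> \<Longrightarrow> Q \<omega>) \<Longrightarrow> prb P \<le> prb Q"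
  unfolding prb_def by (intro ex_mono) auto

lemma prb_nonneg: "0 \<le> prb P"
  unfolding prb_def ex_def by (intro divide_nonneg_nonneg sum_nonneg) auto

lemma prb_le_1: "prb P \<le> 1"
  using ex_mono[of "\<lambda>\<omega>. of_bool (P \<omega>)" "\<lambda>_. 1"] by (simp add: prb_def ex_const)

lemma prb_disj: "prb (\<lambda>\<omega>. P \<omega> \<or> Q \<omega>) \<le> prb P + prb Q"
  unfolding prb_def ex_add[symmetric] by (intro ex_mono) auto

lemma prb_union:
  assumes "finite I"
  shows "prb (\<lambda>\<omega>. \<exists>i\<in>I. P i \<omega>) \<le> (\<Sum>i\<in>I. prb (P i))"
  unfolding prb_def ex_sum[symmetric]
proof (intro ex_mono)
  fix \<omega>
  show "of_bool (\<exists>i\<in>I. P i \<omega>) \<le> (\<Sum>i\<in>I. of_bool (P i \<omega>) :: real)"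
  proof (cases "\<exists>i\<in>I. P i \<omega>")
    case True
    then obtain i where "i \<in> I" "P i \<omega>" by auto
    then have "(1::real) \<le> (\<Sum>i\<in>I. of_bool (P i \<omega>))"
      using member_le_sum[of i I "\<lambda>i. of_bool (P i \<omega>) :: real"] assms by auto
    then show ?thesis using True by simp
  qed (simp add: sum_nonneg)
qed

lemma markov_ineq:
  assumes "\<And>\<omega>. \<omega> \<in> \<Omega> \<Longrightarrow> 0 \<le> f \<omega>" "c > 0"
  shows "prb (\<lambda>\<omega>. c \<le> f \<omega>) \<le> ex f / c"
proof -
  have "prb (\<lambda>\<omega>. c \<le> f \<omega>) \<le> ex (\<lambda>\<omega>. 1 / c * f \<omega>)"
    unfolding prb_def using assms by (intro ex_mono) (auto simp: field_simps)
  then show ?thesis unfolding ex_cmult by simp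
qed

text \<open>A bound valid after every history in \<open>A\<close> carries over to the joint
  probability, and the factor \<open>prb A\<close> is kept for estimates relative to
  \<open>A\<close>.\<close>

lemma prb_step:
  assumes v: "v \<in> V" and A: "determined v k A" and Q: "determined v k Q"
    and b: "\<And>\<omega>. \<omega> \<in> \<Omega> \<Longrightarrow> A \<omega> \<Longrightarrow>
      binex (free v \<omega> k) (hit v \<omega> k) (\<lambda>j. of_bool (Q \<omega> j)) \<le> \<beta>"
  shows "prb (\<lambda>\<omega>. A \<omega> \<and> Q \<omega> (layer v \<omega> (Suc k))) \<le> \<beta> * prb A"
proof -
  let ?G = "\<lambda>\<omega> j. of_bool (A \<omega>) * (of_bool (Q \<omega> j) :: real)"
  have G: "determined v k ?G"
    unfolding determined_def
  proof (intro ballI impI)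
    fix \<omega> \<omega>' assume "\<omega> \<in> \<Omega>" "\<omega>' \<in> \<Omega>" "\<forall>i\<le>k. ball v \<omega> i = ball v \<omega>' i"
    then have "A \<omega> = A \<omega>'" "Q \<omega> = Q \<omega>'" using A Q unfolding determined_def by blast+
    then show "?G \<omega> = ?G \<omega>'" by simp
  qed
  have "prb (\<lambda>\<omega>. A \<omega> \<and> Q \<omega> (layer v \<omega> (Suc k))) = ex (\<lambda>\<omega>. ?G \<omega> (layer v \<omega> (Suc k)))"
    unfolding prb_def by (intro ex_cong) auto
  also have "\<dots> = ex (\<lambda>\<omega>. of_bool (A \<omega>) * binex (free v \<omega> k) (hit v \<omega> k) (\<lambda>j. of_bool (Q \<omega> j)))"
    unfolding tower[OF v G] binex_cmult ..
  also have "\<dots> \<le> ex (\<lambda>\<omega>. \<beta> * of_bool (A \<omega>))" using b by (intro ex_mono) auto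
  finally show ?thesis by (simp add: ex_cmult prb_def)
qed

lemma determined_layer: "i \<le> k \<Longrightarrow> determined v k (\<lambda>\<omega>. layer v \<omega> i)"
  by (cases i) (auto simp: determined_def layer_def simp del: ball.simps)

lemma determined_balls:
  assumes "\<And>\<omega> \<omega>'. (\<forall>i\<le>k. ball v \<omega> i = ball v \<omega>' i) \<Longrightarrow> (\<forall>i\<le>k. layer v \<omega> i = layer v \<omega>' i) \<Longrightarrow> G \<omega> = G \<omega>'"
  shows "determined v k G"
  unfolding determined_def
proof (intro ballI impI)
  fix \<omega> \<omega>' assume w: "\<omega> \<in> \<Omega>" "\<omega>' \<in> \<Omega>" and b: "\<forall>i\<le>k. ball v \<omega> i = ball v \<omega>' i"
  have "\<forall>i\<le>k. layer v \<omega> i = layer v \<omega>' i"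
    using w b determined_layer[of _ k v] unfolding determined_def by blast
  then show "G \<omega> = G \<omega>'" using b by (rule assms[rotated])
qed

end

text \<open>Times \<open>x ^ b\<close>, the coefficient is one term in the expansion of
  \<open>(1 + x) ^ n\<close>.\<close>

lemma binomial_le_exp_pow:
  fixes x :: real
  assumes "x > 0"
  shows "real (n choose b) \<le> exp (real n * x) / x ^ b"
proof (cases "b \<le> n")
  case True
  have "real (n choose b) * x ^ b \<le> (\<Sum>k\<le>n. real (n choose k) * x ^ k)"
    using assms True by (intro member_le_sum[of b "{..n}" "\<lambda>k. real (n choose k) * x ^ k"]) auto
  also have "\<dots> = (1 + x) ^ n" using binomial_ring[of x 1 n] by (simp add: add.commute)
  also have "\<dots> \<le> exp (real n * x)" using assms by (intro one_plus_power_le_exp) auto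
  finally show ?thesis using assms by (simp add: field_simps)
next
  case False
  then show ?thesis using assms by (simp add: binomial_eq_0)
qed

lemma sum_half_powers: "(\<Sum>b\<le>m. real b * (1 / 2) ^ b) \<le> 2"
proof -
  have "(\<Sum>b\<le>m. real b * (1 / 2) ^ b) = 2 - (real m + 2) / 2 ^ m"
    by (induction m) (simp_all add: field_simps)
  then show ?thesis by simp
qed

context rout
begin

section \<open>One-step estimates\<close>

lemma hit_eq:
  assumes v: "v \<in> V" and M: "pfree v \<omega> k > 0"
  shows "hit v \<omega> k = 1 - (1 - real (layer v \<omega> k) / real (pfree v \<omega> k)) ^ r"
proof -
  have "real (free v \<omega> k) = real (pfree v \<omega> k) - real (layer v \<omega> k)"
    using free_layer[OF v, of \<omega> k] by linarith
  then show ?thesis using M by (simp add: hit_def diff_divide_distrib)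
qed

lemma layer_ratio:
  assumes v: "v \<in> V" and M: "pfree v \<omega> k > 0"
  shows "0 \<le> real (layer v \<omega> k) / real (pfree v \<omega> k)" "real (layer v \<omega> k) / real (pfree v \<omega> k) \<le> 1"
  using free_layer[OF v, of \<omega> k] M by (auto simp: divide_le_eq_1)

lemma hit_upper:
  assumes v: "v \<in> V" and M: "pfree v \<omega> k > 0"
  shows "hit v \<omega> k \<le> real r * real (layer v \<omega> k) / real (pfree v \<omega> k)"
proof -
  let ?x = "real (layer v \<omega> k) / real (pfree v \<omega> k)"
  have "1 + real r * (- ?x) \<le> (1 + (- ?x)) ^ r"
    using layer_ratio[OF assms] by (intro Bernoulli_inequality) auto
  then show ?thesis unfolding hit_eq[OF assms] by simp
qed

lemma hit_lower:
  assumes v: "v \<in> V" and M: "pfree v \<omega> k > 0"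
  defines "y \<equiv> real r * real (layer v \<omega> k) / real (pfree v \<omega> k)"
  shows "y - y ^ 2 / 2 \<le> hit v \<omega> k"
proof -
  let ?x = "real (layer v \<omega> k) / real (pfree v \<omega> k)"
  have "(1 + (- ?x)) ^ r \<le> exp (real r * (- ?x))"
    using layer_ratio[OF v M] by (intro one_plus_power_le_exp) auto
  also have "\<dots> = exp (- y)" by (simp add: y_def)
  also have "\<dots> \<le> 1 - y + y ^ 2 / 2" by (intro exp_minus_le) (simp add: y_def)
  finally show ?thesis unfolding hit_eq[OF v M] by simp
qed

lemma mean_upper:
  assumes v: "v \<in> V"
  shows "real (free v \<omega> k) * hit v \<omega> k \<le> real r * real (layer v \<omega> k)"
proof (cases "pfree v \<omega> k = 0")
  case True
  then have "free v \<omega> k = 0" using free_le_pfree[OF v, of \<omega> k] by simp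
  then show ?thesis by simp
next
  case False
  have "real (free v \<omega> k) * hit v \<omega> k \<le>
    real (pfree v \<omega> k) * (real r * real (layer v \<omega> k) / real (pfree v \<omega> k))"
    using False hit_01[OF v, of \<omega> k] free_le_pfree[OF v, of \<omega> k] hit_upper[OF v, of \<omega> k]
    by (intro mult_mono) auto
  then show ?thesis using False by simp
qed

text \<open>The product of \<open>r\<close>, the layer size \<open>z\<close> and
  \<open>ext_gf r s ^ z\<close> is the derivative at \<open>s\<close> of the Poisson generating
  function for \<open>z\<close> parents, so only the distance between binomial and Poisson has to be
  estimated. The error is of the order of the expected number of collisions,
  \<open>(r * K) ^ 2 / m\<close>.\<close>

lemma size_biased_step:
  assumes v: "v \<in> V" and s: "0 \<le> s" "s \<le> 1"
    and z: "1 \<le> layer v \<omega> k" "layer v \<omega> k \<le> K" and m: "0 < m" "m \<le> real (pfree v \<omega> k)"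
  shows "binex (free v \<omega> k) (hit v \<omega> k) (\<lambda>j. real j * s ^ (j - 1)) \<le>
    exp (2 * (real r * real K) ^ 2 / m) * (real r * real (layer v \<omega> k) * ext_gf r s ^ layer v \<omega> k)"
proof -
  let ?N = "free v \<omega> k" and ?M = "pfree v \<omega> k" and ?p = "hit v \<omega> k" and ?z = "layer v \<omega> k"
  let ?\<theta> = "2 * (real r * real K) ^ 2 / m"
  define w where "w = real r * real ?z"
  have M: "?M > 0" using m by simp
  have p: "0 \<le> ?p" "?p \<le> 1" using hit_01[OF v] by auto
  have w: "real ?z + 1 \<le> w" "0 < w" "w \<le> real r * real K"
  proof -
    have "2 * real ?z \<le> w" unfolding w_def using r by (intro mult_right_mono) auto
    then show "real ?z + 1 \<le> w" "0 < w" using z by linarith+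
    show "w \<le> real r * real K" unfolding w_def using z by (intro mult_left_mono) auto
  qed
  have key: "(1 - ?p + ?p * s) ^ (?N - 1) \<le> exp ?\<theta> * ext_gf r s ^ ?z" if N: "?N \<ge> 1"
  proof -
    have NM: "real (?N - 1) = real ?M - (real ?z + 1)" using free_layer[OF v, of \<omega> k] N by linarith
    have "(1 + ?p * (s - 1)) ^ (?N - 1) \<le> exp (real (?N - 1) * (?p * (s - 1)))"
    proof (intro one_plus_power_le_exp)
      have "?p * (1 - s) \<le> 1 * 1" using p s by (intro mult_mono) auto
      then show "- 1 \<le> ?p * (s - 1)" by (simp add: algebra_simps)
    qed
    also have "real (?N - 1) * (?p * (s - 1)) = - (real (?N - 1) * ?p) * (1 - s)" by (simp add: algebra_simps)
    \<comment> \<open>\<open>w\<close> is the limiting mean. The loss comes from the quadratic term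
      of \<open>hit_lower\<close> and from the \<open>z + 1\<close> missing trials. The first is
      \<open>w * y / 2\<close> and the second at most \<open>w * y\<close>, because
      \<open>r \<ge> 2\<close> gives \<open>z + 1 \<le> w\<close>.\<close>
    also have "\<dots> \<le> ?\<theta> - w * (1 - s)"
    proof -
      define y where "y = w / real ?M"
      have y: "0 \<le> y" "real ?M * y = w" using w M by (auto simp: y_def)
      have "real ?M * ?p \<ge> real ?M * (y - y ^ 2 / 2)"
        using hit_lower[OF v M] by (intro mult_left_mono) (auto simp: y_def w_def)
      moreover have "real ?M * (y - y ^ 2 / 2) = w - w * y / 2"
        using y(2) by (simp add: algebra_simps power2_eq_square)
      moreover have "(real ?z + 1) * ?p \<le> w * y"
        using w hit_upper[OF v M] p y by (intro mult_mono) (auto simp: y_def w_def)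
      ultimately have "real (?N - 1) * ?p \<ge> w - 2 * (w * y)"
        unfolding NM left_diff_distrib using y w by (smt (verit) field_sum_of_halves mult_nonneg_nonneg)
      moreover have "2 * (w * y) \<le> ?\<theta>"
      proof -
        have "w * y = w ^ 2 / real ?M" by (simp add: y_def power2_eq_square)
        also have "\<dots> \<le> (real r * real K) ^ 2 / m" using w m by (intro frac_le power_mono) auto
        finally show ?thesis by simp
      qed
      ultimately have "w - real (?N - 1) * ?p \<le> ?\<theta>" by linarith
      moreover have "0 \<le> ?\<theta>" using m by simp
      ultimately have "(w - real (?N - 1) * ?p) * (1 - s) \<le> ?\<theta>"
        using s by (cases "w - real (?N - 1) * ?p \<ge> 0")
          (smt (verit) mult_left_le mult_nonpos_nonneg)+
      then show ?thesis by (simp add: algebra_simps)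
    qed
    also have "exp (?\<theta> - w * (1 - s)) = exp ?\<theta> * ext_gf r s ^ ?z"
    proof -
      have "ext_gf r s ^ ?z = exp (real ?z * - (real r * (1 - s)))"
        unfolding ext_gf_def exp_of_nat_mult ..
      also have "real ?z * - (real r * (1 - s)) = - (w * (1 - s))" by (simp add: w_def)
      finally show ?thesis by (simp flip: exp_add)
    qed
    finally show ?thesis by (simp add: algebra_simps)
  qed
  have "binex ?N ?p (\<lambda>j. real j * s ^ (j - 1)) = real ?N * ?p * (1 - ?p + ?p * s) ^ (?N - 1)"
    by (rule binex_size_biased)
  also have "\<dots> \<le> w * (exp ?\<theta> * ext_gf r s ^ ?z)"
  proof (cases "?N \<ge> 1")
    case True
    have "0 \<le> (1 - ?p) + ?p * s" using p s by (intro add_nonneg_nonneg mult_nonneg_nonneg) auto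
    then show ?thesis using mean_upper[OF v, of \<omega> k] key[OF True] w
      by (intro mult_mono) (auto simp: w_def ext_gf_def)
  next
    case False
    then show ?thesis using w by (simp add: ext_gf_def not_le)
  qed
  finally show ?thesis by (simp add: w_def algebra_simps)
qed

text \<open>The bound on the ball limits collisions: missing trials and the quadratic term of
  \<open>hit_lower\<close> together lower the mean by a factor of at worst
  \<open>1 - \<delta> / 2\<close>. Another such factor is the deviation given to Chernoff, and the
  square of it is at least \<open>1 - \<delta>\<close>.\<close>

lemma growth_step:
  assumes v: "v \<in> V" and \<delta>: "0 < \<delta>" "\<delta> \<le> 1" and z: "1 \<le> layer v \<omega> k"
    and b: "real (card (ball v \<omega> k)) \<le> \<delta> / (4 * real r) * real n"
  shows "binex (free v \<omega> k) (hit v \<omega> k) (\<lambda>j. of_bool (real j < (1 - \<delta>) * real r * real (layer v \<omega> k)))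
    \<le> exp (- (\<delta> ^ 2 * real (layer v \<omega> k) / 8))"
proof -
  let ?N = "free v \<omega> k" and ?M = "pfree v \<omega> k" and ?p = "hit v \<omega> k" and ?z = "layer v \<omega> k"
  have rr: "real r \<ge> 2" using r by simp
  have c: "\<delta> / (4 * real r) \<le> 1 / 8" using \<delta> rr by (simp add: field_simps)
  have n0: "real n > 0" using n by simp
  have "real ?N = real n - real (card (ball v \<omega> k))" using card_ball_le[OF v] by (simp add: free_def)
  moreover have "\<delta> / (4 * real r) * real n \<le> 1 / 8 * real n" using c by (intro mult_right_mono) auto
  ultimately have N: "real ?N \<ge> real n / 2" using b n0 by linarith
  then have M: "real ?M \<ge> real n / 2" using free_le_pfree[OF v, of \<omega> k] by linarith
  then have M0: "?M > 0" using n0 by simp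
  have zb: "real ?z \<le> real (card (ball v \<omega> k))" by (simp add: layer_def)
  define x where "x = real ?z / real ?M"
  have x: "0 \<le> x" "x \<le> 1" using layer_ratio[OF v M0] by (auto simp: x_def)
  \<comment> \<open>Of the 4 in the hypothesis, one factor 2 pays for \<open>pfree\<close> being
    only at least \<open>n / 2\<close>, the other for the half in
    \<open>\<delta> / 2\<close>.\<close>
  have x\<delta>: "real r * x \<le> \<delta> / 2"
  proof -
    have "real ?z \<le> \<delta> / (2 * real r) * (real n / 2)" using zb b by simp
    also have "\<dots> \<le> \<delta> / (2 * real r) * real ?M" using M \<delta> by (intro mult_left_mono) auto
    finally show ?thesis using M0 rr by (simp add: x_def field_simps)
  qed
  have zx: "real ?z = real ?M * x" using M0 by (simp add: x_def)
  have NM: "real ?N = real ?M * (1 - x)" using free_layer[OF v, of \<omega> k] zx by (simp add: algebra_simps)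
  have "(1 - \<delta> / 2) * (real r * real ?z) \<le> real ?N * ?p"
  proof -
    have rx: "real r * x \<ge> 0" using x by simp
    have "real ?M * ((1 - x) * (real r * x - (real r * x) ^ 2 / 2)) \<le> real ?N * ?p"
      unfolding NM mult.assoc using x hit_lower[OF v M0]
      by (intro mult_left_mono) (auto simp: x_def)
    moreover have "(1 - \<delta> / 2) * (real r * x) \<le> (1 - x) * (real r * x - (real r * x) ^ 2 / 2)"
    proof -
      have "2 * x \<le> real r * x" using rr x by (intro mult_right_mono)
      then have "1 - \<delta> / 2 \<le> 1 - x - real r * x / 2" using x\<delta> by linarith
      also have "\<dots> \<le> (1 - x) * (1 - real r * x / 2)"
        using x rx by (simp add: algebra_simps)
      finally have "(1 - \<delta> / 2) * (real r * x) \<le> (1 - x) * (1 - real r * x / 2) * (real r * x)"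
        using rx by (rule mult_right_mono)
      then show ?thesis by (simp add: power2_eq_square algebra_simps)
    qed
    then have "real ?M * ((1 - \<delta> / 2) * (real r * x)) \<le> real ?M * ((1 - x) * (real r * x - (real r * x) ^ 2 / 2))"
      by (rule mult_left_mono) simp
    ultimately have "real ?M * ((1 - \<delta> / 2) * (real r * x)) \<le> real ?N * ?p" by linarith
    then show ?thesis unfolding zx by (simp add: mult.left_commute)
  qed
  note mean = this
  have y: "(1 - \<delta>) * real r * real ?z \<le> (1 - \<delta> / 2) * (real ?N * ?p)"
  proof -
    have "(1 - \<delta>) * (real r * real ?z) \<le> (1 - \<delta> / 2) * (1 - \<delta> / 2) * (real r * real ?z)"
      by (intro mult_right_mono) (auto simp: algebra_simps)
    also have "\<dots> = (1 - \<delta> / 2) * ((1 - \<delta> / 2) * (real r * real ?z))" by simp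
    also have "\<dots> \<le> (1 - \<delta> / 2) * (real ?N * ?p)" using mean \<delta> by (intro mult_left_mono) auto
    finally show ?thesis by (simp add: mult.assoc)
  qed
  \<comment> \<open>Since \<open>(1 - \<delta> / 2) * r \<ge> 1\<close>, the layer itself can
    replace the mean in the Chernoff exponent.\<close>
  have "real ?z \<le> real ?N * ?p"
  proof -
    have "1 * real ?z \<le> ((1 - \<delta> / 2) * real r) * real ?z"
    proof (intro mult_right_mono)
      have "(1/2) * 2 \<le> (1 - \<delta> / 2) * real r" using \<delta> rr by (intro mult_mono) auto
      then show "1 \<le> (1 - \<delta> / 2) * real r" by simp
    qed simp
    then show ?thesis using mean by (simp add: mult.assoc)
  qed
  then have "(\<delta> / 2) ^ 2 * real ?z \<le> (\<delta> / 2) ^ 2 * (real ?N * ?p)" by (intro mult_left_mono) auto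
  then have fin: "exp (- ((\<delta> / 2) ^ 2 * (real ?N * ?p) / 2)) \<le> exp (- (\<delta> ^ 2 * real ?z / 8))"
    by (simp add: power_divide)
  have "binex ?N ?p (\<lambda>j. of_bool (real j < (1 - \<delta>) * real r * real ?z)) \<le> exp (- ((\<delta> / 2) ^ 2 * (real ?N * ?p) / 2))"
    using hit_01[OF v, of \<omega> k] \<delta> y by (intro chernoff_lower) auto
  then show ?thesis using fin by linarith
qed

text \<open>An unexplored vertex stays unexplored with probability \<open>a ^ r\<close>, where
  \<open>a\<close> is the last survival ratio, and \<open>a ^ r \<le> a * (1 - c)\<close> as
  \<open>r \<ge> 2\<close>. Half of the gain \<open>c\<close> is spent on the deviation; flipping
  the binomial turns the count of remaining vertices into an upper tail.\<close>

lemma uncovered_step: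
  fixes g :: real
  assumes v: "v \<in> V" and c: "0 < c" "c \<le> 1"
    and N: "real (free v \<omega> k) \<le> (1 - c) * real (pfree v \<omega> k)"
  defines "y \<equiv> max ((1 - c / 2) * (real (free v \<omega> k) / real (pfree v \<omega> k)) * real (free v \<omega> k)) g"
  shows "binex (free v \<omega> k) (hit v \<omega> k) (\<lambda>j. of_bool (y < real (free v \<omega> k - j))) \<le> exp (- (c ^ 2 * g / 32))"
proof -
  let ?N = "free v \<omega> k" and ?M = "pfree v \<omega> k" and ?p = "hit v \<omega> k"
  define a where "a = real ?N / real ?M"
  have a: "0 \<le> a" "a \<le> 1 - c" using N c by (auto simp: a_def divide_le_eq mult_le_0_iff)
  have p: "1 - ?p = a ^ r" by (simp add: hit_def a_def)
  have "binex ?N ?p (\<lambda>j. of_bool (y < real (?N - j))) = binex ?N (1 - ?p) (\<lambda>j. of_bool (y < real j))"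
    using binex_flip[of ?N ?p "\<lambda>j. of_bool (y < real j)"] .
  also have "\<dots> \<le> exp (- ((c / 2) ^ 2 * y / 8))"
  proof (intro chernoff_upper)
    show "0 \<le> 1 - ?p" "1 - ?p \<le> 1" using hit_01[OF v, of \<omega> k] by auto
    show "0 \<le> c / 2" "c / 2 \<le> 1" using c by auto
    have "a ^ r \<le> a ^ 2" using a c r by (intro power_decreasing) auto
    also have "a ^ 2 \<le> a * (1 - c)" unfolding power2_eq_square using a by (intro mult_left_mono) auto
    finally have "(1 + c / 2) * a ^ r \<le> (1 + c / 2) * (a * (1 - c))" using c by (intro mult_left_mono) auto
    also have "\<dots> = a * ((1 + c / 2) * (1 - c))" by simp
    also have "\<dots> \<le> a * (1 - c / 2)"
    proof (intro mult_left_mono a)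
      have "c * c \<ge> 0" by simp
      then show "(1 + c / 2) * (1 - c) \<le> 1 - c / 2" by (simp add: algebra_simps)
    qed
    finally have "(1 + c / 2) * a ^ r * real ?N \<le> a * (1 - c / 2) * real ?N" by (rule mult_right_mono) simp
    then have "(1 + c / 2) * (real ?N * (1 - ?p)) \<le> (1 - c / 2) * a * real ?N" unfolding p by (simp add: algebra_simps)
    then show "(1 + c / 2) * (real ?N * (1 - ?p)) \<le> y" unfolding y_def a_def by simp
  qed
  also have "\<dots> \<le> exp (- (c ^ 2 * g / 32))"
  proof -
    have "c ^ 2 * g \<le> c ^ 2 * y" unfolding y_def by (intro mult_left_mono) auto
    then show ?thesis by (simp add: power_divide)
  qed
  finally show ?thesis .
qed

section \<open>Events that fail with small probability\<close>

lemma determined_compose: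
  assumes "determined v k f"
  shows "determined v k (\<lambda>\<omega>. h (f \<omega>))"
  unfolding determined_def
proof (intro ballI impI)
  fix \<omega> \<omega>' assume "\<omega> \<in> \<Omega>" "\<omega>' \<in> \<Omega>" "\<forall>i\<le>k. ball v \<omega> i = ball v \<omega>' i"
  then have "f \<omega> = f \<omega>'" using assms unfolding determined_def by blast
  then show "h (f \<omega>) = h (f \<omega>')" by simp
qed

section \<open>Thin explorations are unlikely to last\<close>

definition thin :: "nat \<Rightarrow> nat \<Rightarrow> nat \<Rightarrow> (nat \<Rightarrow> nat \<Rightarrow> nat) \<Rightarrow> bool" where
  "thin v K t \<omega> \<longleftrightarrow> (\<forall>i\<le>t. 1 \<le> layer v \<omega> i \<and> layer v \<omega> i \<le> K)"

lemma determined_thin: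
  assumes "t \<le> k"
  shows "determined v k (thin v K t)"
proof (rule determined_balls)
  fix \<omega> \<omega>' assume "\<forall>i\<le>k. layer v \<omega> i = layer v \<omega>' i"
  then have "\<forall>i\<le>t. layer v \<omega> i = layer v \<omega>' i" using assms by auto
  then show "thin v K t \<omega> = thin v K t \<omega>'" by (simp add: thin_def)
qed

lemma thin_card_ball:
  assumes "v \<in> V" "thin v K t \<omega>"
  shows "card (ball v \<omega> t) \<le> Suc t * K"
proof -
  have "(\<Sum>i\<le>t. layer v \<omega> i) \<le> (\<Sum>i\<le>t. K)" using assms(2) by (intro sum_mono) (auto simp: thin_def)
  then show ?thesis using card_ball_sum[OF assms(1)] by simp
qed

lemma layer_0: "v \<in> V \<Longrightarrow> layer v \<omega> 0 = 1"
  by (simp add: layer_def)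

text \<open>One step replaces the size-biased generating function at \<open>s\<close> by \<open>r f(s)\<close> times the one at \<open>f(s)\<close>,
  up to a factor near 1, and the iterates of \<open>f = ext_gf r\<close> decrease to the extinction probability.\<close>

definition thin_moment :: "nat \<Rightarrow> nat \<Rightarrow> nat \<Rightarrow> real \<Rightarrow> real" where
  "thin_moment v K k s = ex (\<lambda>\<omega>. of_bool (thin v K k \<omega>) * (real (layer v \<omega> k) * s ^ (layer v \<omega> k - 1)))"

lemma thin_moment_step:
  assumes v: "v \<in> V" and s: "0 \<le> s" "s \<le> 1" and m: "0 < m" "m + real (Suc k * K) \<le> real n"
  shows "thin_moment v K (Suc k) s \<le>
    exp (2 * (real r * real K) ^ 2 / m) * real r * ext_gf r s * thin_moment v K k (ext_gf r s)"
proof -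
  let ?\<theta> = "2 * (real r * real K) ^ 2 / m"
  have "thin_moment v K (Suc k) s \<le> ex (\<lambda>\<omega>. of_bool (thin v K k \<omega>) * (real (layer v \<omega> (Suc k)) * s ^ (layer v \<omega> (Suc k) - 1)))"
    unfolding thin_moment_def using s by (intro ex_mono) (auto simp: thin_def)
  also have "\<dots> = ex (\<lambda>\<omega>. binex (free v \<omega> k) (hit v \<omega> k) (\<lambda>j. of_bool (thin v K k \<omega>) * (real j * s ^ (j - 1))))"
  proof (rule tower[OF v])
    show "determined v k (\<lambda>\<omega> j. of_bool (thin v K k \<omega>) * (real j * s ^ (j - 1)))"
      using determined_compose[OF determined_thin[of k k v K, OF order_refl], of "\<lambda>b j. of_bool b * (real j * s ^ (j - 1))"] .
  qed
  also have "\<dots> \<le> ex (\<lambda>\<omega>. exp ?\<theta> * real r * ext_gf r s *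
      (of_bool (thin v K k \<omega>) * (real (layer v \<omega> k) * ext_gf r s ^ (layer v \<omega> k - 1))))"
  proof (intro ex_mono)
    fix \<omega>
    show "binex (free v \<omega> k) (hit v \<omega> k) (\<lambda>j. of_bool (thin v K k \<omega>) * (real j * s ^ (j - 1))) \<le>
      exp ?\<theta> * real r * ext_gf r s * (of_bool (thin v K k \<omega>) * (real (layer v \<omega> k) * ext_gf r s ^ (layer v \<omega> k - 1)))"
    proof (cases "thin v K k \<omega>")
      case True
      have z: "1 \<le> layer v \<omega> k" "layer v \<omega> k \<le> K" using True by (auto simp: thin_def)
      have "real (free v \<omega> k) = real n - real (card (ball v \<omega> k))" using card_ball_le[OF v] by (simp add: free_def)
      moreover have "real (card (ball v \<omega> k)) \<le> real (Suc k * K)" using thin_card_ball[OF v True] by linarith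
      ultimately have "m \<le> real (pfree v \<omega> k)" using m free_le_pfree[OF v, of \<omega> k] by linarith
      from size_biased_step[OF v s z m(1) this]
      have "binex (free v \<omega> k) (hit v \<omega> k) (\<lambda>j. real j * s ^ (j - 1)) \<le>
        exp ?\<theta> * (real r * real (layer v \<omega> k) * ext_gf r s ^ layer v \<omega> k)" .
      also have "ext_gf r s ^ layer v \<omega> k = ext_gf r s * ext_gf r s ^ (layer v \<omega> k - 1)"
        using z by (cases "layer v \<omega> k") auto
      finally show ?thesis using True by (simp add: algebra_simps)
    qed (simp add: binex_const)
  qed
  finally show ?thesis unfolding ex_cmult thin_moment_def .
qed

lemma thin_moment_bound:
  assumes v: "v \<in> V" and s: "0 \<le> s" "s \<le> 1" and m: "0 < m" "m + real (Suc k * K) \<le> real n"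
  shows "thin_moment v K k s \<le> (exp (2 * (real r * real K) ^ 2 / m) * real r) ^ k *
    (\<Prod>i<k. (ext_gf r ^^ Suc i) s)"
  using s m(2)
proof (induction k arbitrary: s)
  case 0
  have "thin_moment v K 0 s \<le> ex (\<lambda>_. 1)"
    unfolding thin_moment_def using 0 by (intro ex_mono) (auto simp: layer_0[OF v])
  then show ?case by (simp add: ex_const)
next
  case (Suc k)
  let ?A = "exp (2 * (real r * real K) ^ 2 / m) * real r"
  have le: "real (Suc k * K) \<le> real (Suc (Suc k) * K)" by (intro of_nat_mono mult_right_mono) auto
  have g: "0 \<le> ext_gf r s" "ext_gf r s \<le> 1" using Suc.prems by (auto simp: ext_gf_def)
  have "thin_moment v K (Suc k) s \<le> ?A * ext_gf r s * thin_moment v K k (ext_gf r s)"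
    using Suc.prems le by (intro thin_moment_step v m) auto
  also have "\<dots> \<le> ?A * ext_gf r s * (?A ^ k * (\<Prod>i<k. (ext_gf r ^^ Suc i) (ext_gf r s)))"
    using Suc.prems le g by (intro mult_left_mono Suc.IH) auto
  also have "\<dots> = ?A ^ Suc k * (\<Prod>i<Suc k. (ext_gf r ^^ Suc i) s)"
  proof -
    have "(ext_gf r ^^ Suc (Suc i)) s = (ext_gf r ^^ Suc i) (ext_gf r s)" for i
      by (simp only: funpow_Suc_right o_apply)
    then show ?thesis unfolding prod.lessThan_Suc_shift by (simp del: funpow.simps(2)) simp
  qed
  finally show ?case .
qed

text \<open>On a thin history the weight \<open>z * s ^ (z - 1)\<close> is at least
  \<open>s ^ K\<close>, which is the price for starting at \<open>s\<close>; iterates started at 1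
  would stay at the fixed point 1. The first \<open>I\<close> iterates are bounded by 1 only; from
  then on \<open>ext_gf r b \<le> b\<close> and monotonicity trap them below
  \<open>b\<close>.\<close>

lemma thin_prob:
  assumes v: "v \<in> V" and s: "0 < s" "s \<le> 1" and m: "0 < m" "m + real (Suc t * K) \<le> real n"
    and b: "ext_gf r b \<le> b" "b \<le> 1" "(ext_gf r ^^ I) s \<le> b"
  shows "prb (thin v K t) \<le> exp (real t * (2 * (real r * real K) ^ 2 / m)) * real r ^ t * b ^ (t - I) / s ^ K"
proof -
  let ?\<theta> = "2 * (real r * real K) ^ 2 / m"
  have b0: "0 < b" using b(1) ext_gf_pos[of r b] by linarith
  have pos: "0 < (ext_gf r ^^ i) s \<and> (ext_gf r ^^ i) s \<le> 1" for i
    by (induction i) (use s in \<open>auto simp: ext_gf_def\<close>)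
  have ge: "(ext_gf r ^^ (I + i)) s \<le> b" for i
  proof (induction i)
    case (Suc i)
    show ?case using ext_gf_mono[OF Suc, of r] b(1) by simp
  qed (use b in simp)
  have "(\<Prod>i<t. (ext_gf r ^^ Suc i) s) \<le> (\<Prod>i<t. if i < I then 1 else b)"
  proof (intro prod_mono conjI)
    fix i
    show "(ext_gf r ^^ Suc i) s \<le> (if i < I then 1 else b)"
      using pos[of "Suc i"] ge[of "Suc i - I"] by (auto simp del: funpow.simps)
    show "0 \<le> (ext_gf r ^^ Suc i) s" using pos[of "Suc i"] by simp
  qed
  also have "\<dots> = b ^ card ({..<t} - {..<I})"
  proof -
    have "(\<Prod>i<t. if i < I then 1 else b) = (\<Prod>i\<in>{..<t} - {..<I}. b)"
      by (intro prod.mono_neutral_cong_right) auto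
    then show ?thesis by simp
  qed
  also have "card ({..<t} - {..<I}) = t - I"
  proof -
    have "{..<t} - {..<I} = {I..<t}" by auto
    then show ?thesis by simp
  qed
  finally have pr: "(\<Prod>i<t. (ext_gf r ^^ Suc i) s) \<le> b ^ (t - I)" .
  have "s ^ K * prb (thin v K t) = ex (\<lambda>\<omega>. s ^ K * of_bool (thin v K t \<omega>))" by (simp add: prb_def ex_cmult)
  also have "\<dots> \<le> thin_moment v K t s"
    unfolding thin_moment_def
  proof (intro ex_mono)
    fix \<omega>
    have "s ^ K \<le> real (layer v \<omega> t) * s ^ (layer v \<omega> t - 1)" if "thin v K t \<omega>"
    proof -
      have z: "1 \<le> layer v \<omega> t" "layer v \<omega> t \<le> K" using that by (auto simp: thin_def)
      have "1 * s ^ K \<le> real (layer v \<omega> t) * s ^ (layer v \<omega> t - 1)"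
        using s z by (intro mult_mono power_decreasing) auto
      then show ?thesis by simp
    qed
    then show "s ^ K * of_bool (thin v K t \<omega>) \<le> of_bool (thin v K t \<omega>) * (real (layer v \<omega> t) * s ^ (layer v \<omega> t - 1))"
      by auto
  qed
  also have "\<dots> \<le> (exp ?\<theta> * real r) ^ t * (\<Prod>i<t. (ext_gf r ^^ Suc i) s)"
    using s m by (intro thin_moment_bound v) auto
  also have "\<dots> \<le> (exp ?\<theta> * real r) ^ t * b ^ (t - I)" using pr by (intro mult_left_mono) auto
  also have "\<dots> = exp (real t * ?\<theta>) * real r ^ t * b ^ (t - I)"
    unfolding exp_of_nat_mult power_mult_distrib ..
  finally show ?thesis using s by (simp add: field_simps)
qed

section \<open>Steps that grow or decay too slowly\<close>

definition slow_growth :: "real \<Rightarrow> nat \<Rightarrow> nat \<Rightarrow> nat \<Rightarrow> (nat \<Rightarrow> nat \<Rightarrow> nat) \<Rightarrow> bool" where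
  "slow_growth \<delta> K v k \<omega> \<longleftrightarrow> K < layer v \<omega> k \<and> real (card (ball v \<omega> k)) \<le> \<delta> / (4 * real r) * real n \<and>
     real (layer v \<omega> (Suc k)) < (1 - \<delta>) * real r * real (layer v \<omega> k)"

lemma prb_slow_growth:
  assumes v: "v \<in> V" and \<delta>: "0 < \<delta>" "\<delta> \<le> 1"
  shows "prb (slow_growth \<delta> K v k) \<le> exp (- (\<delta> ^ 2 * real K / 8))"
proof -
  let ?A = "\<lambda>\<omega>. K < layer v \<omega> k \<and> real (card (ball v \<omega> k)) \<le> \<delta> / (4 * real r) * real n"
  have "prb (\<lambda>\<omega>. ?A \<omega> \<and> real (layer v \<omega> (Suc k)) < (1 - \<delta>) * real r * real (layer v \<omega> k)) \<le>
    exp (- (\<delta> ^ 2 * real K / 8)) * prb ?A"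
  proof (rule prb_step[OF v])
    show "determined v k ?A" by (rule determined_balls) auto
    show "determined v k (\<lambda>\<omega> j. real j < (1 - \<delta>) * real r * real (layer v \<omega> k))"
      by (rule determined_balls) auto
    fix \<omega> assume A: "?A \<omega>"
    have "exp (- (\<delta> ^ 2 * real (layer v \<omega> k) / 8)) \<le> exp (- (\<delta> ^ 2 * real K / 8))"
      using A by (auto intro!: mult_left_mono)
    then show "binex (free v \<omega> k) (hit v \<omega> k) (\<lambda>j. of_bool (real j < (1 - \<delta>) * real r * real (layer v \<omega> k)))
      \<le> exp (- (\<delta> ^ 2 * real K / 8))"
      using growth_step[OF v \<delta>, of \<omega> k] A by linarith
  qed
  also have "\<dots> \<le> exp (- (\<delta> ^ 2 * real K / 8)) * 1" by (intro mult_left_mono prb_le_1) auto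
  finally show ?thesis by (simp add: slow_growth_def[abs_def])
qed

text \<open>The floor \<open>g\<close> in the maximum keeps the failure probability small however
  few vertices are left.\<close>

definition slow_decay :: "real \<Rightarrow> real \<Rightarrow> nat \<Rightarrow> nat \<Rightarrow> (nat \<Rightarrow> nat \<Rightarrow> nat) \<Rightarrow> bool" where
  "slow_decay c g v k \<omega> \<longleftrightarrow> real (free v \<omega> k) \<le> (1 - c) * real (pfree v \<omega> k) \<and>
     max ((1 - c / 2) * (real (free v \<omega> k) / real (pfree v \<omega> k)) * real (free v \<omega> k)) g < real (free v \<omega> (Suc k))"

lemma free_Suc: "v \<in> V \<Longrightarrow> free v \<omega> (Suc k) = free v \<omega> k - layer v \<omega> (Suc k)"
  using free_layer[of v \<omega> "Suc k"] by (simp add: pfree_Suc)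

lemma prb_slow_decay:
  assumes v: "v \<in> V" and c: "0 < c" "c \<le> 1"
  shows "prb (slow_decay c g v k) \<le> exp (- (c ^ 2 * g / 32))"
proof -
  let ?A = "\<lambda>\<omega>. real (free v \<omega> k) \<le> (1 - c) * real (pfree v \<omega> k)"
  let ?y = "\<lambda>\<omega>. max ((1 - c / 2) * (real (free v \<omega> k) / real (pfree v \<omega> k)) * real (free v \<omega> k)) g"
  have f: "determined v k (\<lambda>\<omega>. (free v \<omega> k, pfree v \<omega> k))"
    by (cases k) (auto simp: determined_def free_def pfree_def simp del: ball.simps)
  have "prb (\<lambda>\<omega>. ?A \<omega> \<and> ?y \<omega> < real (free v \<omega> k - layer v \<omega> (Suc k))) \<le> exp (- (c ^ 2 * g / 32)) * prb ?A"
  proof (rule prb_step[OF v])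
    show "determined v k ?A" "determined v k (\<lambda>\<omega> j. ?y \<omega> < real (free v \<omega> k - j))"
      using determined_compose[OF f, of "\<lambda>(a, b). real a \<le> (1 - c) * real b"]
        determined_compose[OF f, of "\<lambda>(a, b) j. max ((1 - c / 2) * (real a / real b) * real a) g < real (a - j)"]
      by simp_all
    fix \<omega> assume "?A \<omega>"
    then show "binex (free v \<omega> k) (hit v \<omega> k) (\<lambda>j. of_bool (?y \<omega> < real (free v \<omega> k - j))) \<le> exp (- (c ^ 2 * g / 32))"
      by (intro uncovered_step v c)
  qed
  also have "\<dots> \<le> exp (- (c ^ 2 * g / 32)) * 1" by (intro mult_left_mono prb_le_1) auto
  finally show ?thesis using free_Suc[OF v] by (simp add: slow_decay_def[abs_def])
qed

section \<open>Expansion of small vertex sets\<close>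

definition heads :: "(nat \<Rightarrow> nat \<Rightarrow> nat) \<Rightarrow> nat set \<Rightarrow> nat set" where
  "heads \<omega> A = (\<Union>i\<in>A. \<omega> i ` J)"

text \<open>A violating \<open>A\<close> has fewer than \<open>n / 2000\<close> vertices together
  with its heads: 3000 is 2000 times the expansion factor 3/2.\<close>

definition expanding :: "(nat \<Rightarrow> nat \<Rightarrow> nat) \<Rightarrow> bool" where
  "expanding \<omega> \<longleftrightarrow> (\<forall>A\<subseteq>V. A \<noteq> {} \<longrightarrow> 3000 * card A \<le> n \<longrightarrow> 3 * card A \<le> 2 * card (A \<union> heads \<omega> A))"

lemma prb_heads_subset:
  assumes "A \<subseteq> V" "B \<subseteq> V"
  shows "prb (\<lambda>\<omega>. heads \<omega> A \<subseteq> B) = (real (card B) / real n) ^ (r * card A)"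
proof -
  have "{\<omega> \<in> \<Omega>. heads \<omega> A \<subseteq> B} = PiE V (\<lambda>i. if i \<in> A then PiE J (\<lambda>_. B) else T)"
  proof (intro set_eqI iffI)
    fix \<omega> assume w: "\<omega> \<in> {\<omega> \<in> \<Omega>. heads \<omega> A \<subseteq> B}"
    show "\<omega> \<in> PiE V (\<lambda>i. if i \<in> A then PiE J (\<lambda>_. B) else T)"
    proof (rule PiE_I)
      fix i assume "i \<in> V"
      then have "\<omega> i \<in> T" using w \<Omega>_mem by blast
      moreover have "\<omega> i j \<in> B" if "i \<in> A" "j \<in> J" for j using w that by (auto simp: heads_def)
      ultimately show "\<omega> i \<in> (if i \<in> A then PiE J (\<lambda>_. B) else T)" by (simp add: T_def PiE_iff)
    qed (use w in \<open>auto simp: \<Omega>_def\<close>)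
  next
    fix \<omega> assume w: "\<omega> \<in> PiE V (\<lambda>i. if i \<in> A then PiE J (\<lambda>_. B) else T)"
    have BT: "PiE J (\<lambda>_. B) \<subseteq> T" using assms(2) by (auto simp: T_def PiE_iff)
    have mem: "\<omega> i \<in> (if i \<in> A then PiE J (\<lambda>_. B) else T)" if "i \<in> V" for i using w that by (rule PiE_mem)
    have "\<omega> \<in> \<Omega>"
      unfolding \<Omega>_def
    proof (rule PiE_I)
      fix i assume "i \<in> V" then show "\<omega> i \<in> T" using mem[of i] BT by (auto split: if_splits)
    qed (use w in auto)
    moreover have "\<omega> i j \<in> B" if "i \<in> A" "j \<in> J" for i j
      using mem[of i] assms(1) that by (auto simp: PiE_iff)
    ultimately show "\<omega> \<in> {\<omega> \<in> \<Omega>. heads \<omega> A \<subseteq> B}" by (auto simp: heads_def)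
  qed
  then have "card {\<omega> \<in> \<Omega>. heads \<omega> A \<subseteq> B} = (\<Prod>i\<in>V. if i \<in> A then card B ^ r else n ^ r)"
    by (simp add: card_PiE card_T if_distrib[of card] cong: if_cong)
  then have c: "real (card {\<omega> \<in> \<Omega>. heads \<omega> A \<subseteq> B}) = (\<Prod>i\<in>V. if i \<in> A then real (card B) ^ r else real n ^ r)"
    by (simp add: of_nat_prod if_distrib[of real] cong: if_cong)
  have "prb (\<lambda>\<omega>. heads \<omega> A \<subseteq> B) = real (card {\<omega> \<in> \<Omega>. heads \<omega> A \<subseteq> B}) / real (card \<Omega>)"
    by (simp add: prb_def ex_def sum.If_cases of_bool_def Int_def)
  also have "real (card \<Omega>) = (\<Prod>i\<in>V. real n ^ r)" by (simp add: card_\<Omega>)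
  also have "real (card {\<omega> \<in> \<Omega>. heads \<omega> A \<subseteq> B}) / (\<Prod>i\<in>V. real n ^ r) =
    (\<Prod>i\<in>V. (if i \<in> A then real (card B) ^ r else real n ^ r) / real n ^ r)"
    unfolding c by (rule prod_dividef[symmetric])
  also have "\<dots> = (\<Prod>i\<in>V. if i \<in> A then (real (card B) / real n) ^ r else 1)"
    using n by (intro prod.cong) (auto simp: power_divide)
  also have "\<dots> = (\<Prod>i\<in>A. (real (card B) / real n) ^ r)"
    using assms(1) by (subst prod.If_cases) (auto simp: Int_absorb1)
  finally show ?thesis by (simp add: power_mult)
qed

text \<open>The choice of a set of \<open>b\<close> vertices contributes \<open>exp 1 / x\<close>
  per element, the choice of a subset 2, and the arcs \<open>x powr (4 / 3)\<close>, so the base is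
  \<open>2 * exp 1 * x powr (1 / 3)\<close>. It is at most 1/2 because \<open>x\<close> is below
  \<open>1 / 12 ^ 3\<close>; one factor is kept apart to supply the power of
  \<open>n\<close>.\<close>

lemma expanding_term:
  assumes b: "1 \<le> b" "2000 * b \<le> n"
  defines "x \<equiv> real b / real n"
  shows "real (n choose b) * (2 ^ b * (x powr (4 / 3)) ^ b) \<le> 12 * real n powr (- 1 / 3) * (real b * (1 / 2) ^ b)"
proof -
  have n0: "real n > 0" using n by simp
  have x: "0 < x" "x \<le> 1 / 2000" using b n0 by (auto simp: x_def field_simps)
  define u where "u = 2 * exp 1 * x powr (1 / 3)"
  have e3: "exp 1 \<le> (3::real)" by (rule exp_le)
  have "real (n choose b) \<le> exp (real n * x) / x ^ b" by (rule binomial_le_exp_pow[OF x(1)])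
  also have "exp (real n * x) = exp 1 ^ b" using n0 by (simp add: x_def exp_of_nat_mult[symmetric])
  finally have "real (n choose b) * (2 ^ b * (x powr (4 / 3)) ^ b) \<le> exp 1 ^ b / x ^ b * (2 ^ b * (x powr (4 / 3)) ^ b)"
    by (intro mult_right_mono) auto
  also have "\<dots> = (2 * exp 1 * (x powr (4 / 3) / x)) ^ b" by (simp add: power_mult_distrib power_divide)
  also have "x powr (4 / 3) / x = x powr (1 / 3)"
    using x powr_diff[of x "4 / 3" 1] by simp
  also have "(2 * exp 1 * x powr (1 / 3)) ^ b = u ^ b" by (simp add: u_def)
  also have "u ^ b = u * u ^ (b - 1)" using b by (metis Suc_diff_1 less_eq_Suc_le One_nat_def power_Suc)
  also have "u * u ^ (b - 1) \<le> u * (1 / 2) ^ (b - 1)"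
  proof (intro mult_left_mono power_mono)
    have "x powr (1 / 3) \<le> (1 / 12 ^ 3) powr (1 / 3)" using x by (intro powr_mono2) auto
    also have "(1 / 12 ^ 3 :: real) powr (1 / 3) = 1 / 12"
    proof -
      have "(1 / 12 ^ 3 :: real) = (1 / 12) powr 3" using powr_realpow[of "1 / 12 :: real" 3] by (simp add: power_divide)
      then show ?thesis unfolding \<open>_ = (1 / 12) powr 3\<close> powr_powr by simp
    qed
    finally have "u \<le> 2 * 3 * (1 / 12)" unfolding u_def using e3 by (intro mult_mono) auto
    then show "u \<le> 1 / 2" by simp
  qed (auto simp: u_def)
  also have "u \<le> 6 * (real b * real n powr (- 1 / 3))"
  proof -
    have "x powr (1 / 3) = real b powr (1 / 3) * real n powr (- 1 / 3)"
      using n0 b powr_minus_divide[of "real n" "1 / 3"] by (simp add: x_def powr_divide)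
    also have "real b powr (1 / 3) \<le> real b powr 1" using b by (intro powr_mono) auto
    finally have "x powr (1 / 3) \<le> real b * real n powr (- 1 / 3)" using b by (simp add: mult_right_mono)
    then have "2 * exp 1 * x powr (1 / 3) \<le> (2 * 3) * (real b * real n powr (- 1 / 3))"
      using e3 by (intro mult_mono) auto
    then show ?thesis by (simp add: u_def)
  qed
  then have "u * (1 / 2) ^ (b - 1) \<le> 6 * (real b * real n powr (- 1 / 3)) * (1 / 2) ^ (b - 1)"
    by (intro mult_right_mono) auto
  also have "(1 / 2 :: real) ^ (b - 1) = 2 * (1 / 2) ^ b" using b by (cases b) auto
  finally show ?thesis by (simp add: algebra_simps)
qed

text \<open>The union runs over the enlarged set \<open>B\<close>, not only over \<open>A\<close>: a
  violator has \<open>3 * card A > 2 * card B\<close>, so its at least \<open>2 * card A\<close>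
  arcs into \<open>B\<close> give the exponent \<open>4 / 3 * card B\<close>, which beats the
  exponent \<open>card B\<close> lost in choosing \<open>B\<close>.\<close>

lemma prb_not_expanding: "prb (\<lambda>\<omega>. \<not> expanding \<omega>) \<le> 24 * real n powr (- 1 / 3)"
proof -
  define \<B> where "\<B> = {B \<in> Pow V. 1 \<le> card B \<and> 2000 * card B \<le> n}"
  define \<A> where "\<A> = (\<lambda>B :: nat set. {A \<in> Pow B. 2 * card B < 3 * card A})"
  have fin: "finite \<B>" by (simp add: \<B>_def)
  have finB: "finite B" if "B \<in> \<B>" for B using that by (auto simp: \<B>_def intro: finite_subset[OF _ finite_V])
  have finA: "finite (\<A> B)" if "B \<in> \<B>" for B using finB[OF that] by (simp add: \<A>_def)
  have "prb (\<lambda>\<omega>. \<not> expanding \<omega>) \<le> prb (\<lambda>\<omega>. \<exists>B\<in>\<B>. \<exists>A\<in>\<A> B. heads \<omega> A \<subseteq> B)"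
  proof (rule prb_mono)
    fix \<omega> assume w: "\<omega> \<in> \<Omega>" and "\<not> expanding \<omega>"
    then obtain A where A: "A \<subseteq> V" "A \<noteq> {}" "3000 * card A \<le> n" "2 * card (A \<union> heads \<omega> A) < 3 * card A"
      by (auto simp: expanding_def not_le)
    let ?B = "A \<union> heads \<omega> A"
    have "heads \<omega> A \<subseteq> V" using w A(1) unfolding heads_def \<Omega>_def T_def by (fastforce simp: PiE_iff)
    moreover have "1 \<le> card ?B" using A(2) finite_subset[OF A(1) finite_V] finite_subset[OF \<open>heads \<omega> A \<subseteq> V\<close> finite_V]
      by (simp add: Suc_le_eq card_gt_0_iff)
    ultimately have "?B \<in> \<B>" using A by (auto simp: \<B>_def)
    moreover have "A \<in> \<A> ?B" using A by (auto simp: \<A>_def)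
    ultimately show "\<exists>B\<in>\<B>. \<exists>A\<in>\<A> B. heads \<omega> A \<subseteq> B" by blast
  qed
  also have "\<dots> \<le> (\<Sum>B\<in>\<B>. prb (\<lambda>\<omega>. \<exists>A\<in>\<A> B. heads \<omega> A \<subseteq> B))" by (rule prb_union[OF fin])
  also have "\<dots> \<le> (\<Sum>B\<in>\<B>. 2 ^ card B * ((real (card B) / real n) powr (4 / 3)) ^ card B)"
  proof (rule sum_mono)
    fix B assume B: "B \<in> \<B>"
    define x where "x = real (card B) / real n"
    have x: "0 < x" "x \<le> 1" using B n by (auto simp: \<B>_def x_def)
    have "prb (\<lambda>\<omega>. \<exists>A\<in>\<A> B. heads \<omega> A \<subseteq> B) \<le> (\<Sum>A\<in>\<A> B. prb (\<lambda>\<omega>. heads \<omega> A \<subseteq> B))"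
      by (rule prb_union[OF finA[OF B]])
    also have "\<dots> \<le> (\<Sum>A\<in>\<A> B. (x powr (4 / 3)) ^ card B)"
    proof (rule sum_mono)
      fix A assume A: "A \<in> \<A> B"
      then have "prb (\<lambda>\<omega>. heads \<omega> A \<subseteq> B) = x ^ (r * card A)"
        unfolding x_def using B by (intro prb_heads_subset) (auto simp: \<A>_def \<B>_def)
      also have "\<dots> \<le> x ^ (2 * card A)" using x r by (intro power_decreasing) auto
      also have "\<dots> = x powr (2 * real (card A))" using x by (simp add: powr_realpow[symmetric])
      also have "\<dots> \<le> x powr (4 / 3 * real (card B))"
      proof (intro powr_mono')
        have "2 * card B < 3 * card A" using A unfolding \<A>_def by simp
        then show "4 / 3 * real (card B) \<le> 2 * real (card A)" by linarith
      qed (use x in auto)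
      also have "\<dots> = (x powr (4 / 3)) ^ card B" using x powr_realpow[of "x powr (4 / 3)" "card B"] by (simp add: powr_powr)
      finally show "prb (\<lambda>\<omega>. heads \<omega> A \<subseteq> B) \<le> (x powr (4 / 3)) ^ card B" .
    qed
    also have "\<dots> = real (card (\<A> B)) * (x powr (4 / 3)) ^ card B" by simp
    also have "\<dots> \<le> 2 ^ card B * (x powr (4 / 3)) ^ card B"
    proof (intro mult_right_mono)
      have "card (\<A> B) \<le> card (Pow B)" using finB[OF B] by (intro card_mono) (auto simp: \<A>_def)
      then have "real (card (\<A> B)) \<le> real (2 ^ card B)" using finB[OF B] by (simp only: card_Pow of_nat_le_iff)
      then show "real (card (\<A> B)) \<le> 2 ^ card B" by simp
    qed simp
    finally show "prb (\<lambda>\<omega>. \<exists>A\<in>\<A> B. heads \<omega> A \<subseteq> B) \<le> 2 ^ card B * ((real (card B) / real n) powr (4 / 3)) ^ card B"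
      by (simp add: x_def)
  qed
  also have "\<dots> = (\<Sum>B\<in>Pow V. of_bool (1 \<le> card B \<and> 2000 * card B \<le> n) * (2 ^ card B * ((real (card B) / real n) powr (4 / 3)) ^ card B))"
    unfolding \<B>_def by (intro sum.mono_neutral_cong_left) auto
  also have "\<dots> = (\<Sum>b\<le>n. real (n choose b) * (of_bool (1 \<le> b \<and> 2000 * b \<le> n) * (2 ^ b * ((real b / real n) powr (4 / 3)) ^ b)))"
    using sum_Pow_card[OF finite_V, of "\<lambda>b. of_bool (1 \<le> b \<and> 2000 * b \<le> n) * (2 ^ b * ((real b / real n) powr (4 / 3)) ^ b)"] by simp
  also have "\<dots> \<le> (\<Sum>b\<le>n. 12 * real n powr (- 1 / 3) * (real b * (1 / 2) ^ b))"
  proof (rule sum_mono)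
    fix b
    show "real (n choose b) * (of_bool (1 \<le> b \<and> 2000 * b \<le> n) * (2 ^ b * ((real b / real n) powr (4 / 3)) ^ b)) \<le>
      12 * real n powr (- 1 / 3) * (real b * (1 / 2) ^ b)"
      using expanding_term[of b] by (cases "1 \<le> b \<and> 2000 * b \<le> n") auto
  qed
  also have "\<dots> = 12 * real n powr (- 1 / 3) * (\<Sum>b\<le>n. real b * (1 / 2) ^ b)" by (simp add: sum_distrib_left)
  also have "\<dots> \<le> 12 * real n powr (- 1 / 3) * 2" by (intro mult_left_mono sum_half_powers) auto
  finally show ?thesis by simp
qed

section \<open>From one-step estimates to covering\<close>

lemma card_ball_Suc: "v \<in> V \<Longrightarrow> card (ball v \<omega> (Suc k)) = card (ball v \<omega> k) + layer v \<omega> (Suc k)"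
  using card_ball_sum[of v \<omega> "Suc k"] card_ball_sum[of v \<omega> k] by simp

lemma card_pre_ball: "v \<in> V \<Longrightarrow> card (pre (ball v \<omega>) k) + layer v \<omega> k = card (ball v \<omega> k)"
  using card_pre_ball_le[of v \<omega> k] by (simp add: layer_def)

lemma layer_le_card_ball: "layer v \<omega> k \<le> card (ball v \<omega> k)"
  by (simp add: layer_def)

lemma card_pre_ball_le_mult:
  assumes v: "v \<in> V" and "\<And>i. i < k \<Longrightarrow> layer v \<omega> i \<le> K"
  shows "card (pre (ball v \<omega>) k) \<le> k * K"
proof (cases k)
  case (Suc l)
  have "(\<Sum>i\<le>l. layer v \<omega> i) \<le> (\<Sum>i\<le>l. K)" using assms(2) Suc by (intro sum_mono) auto
  then show ?thesis using card_ball_sum[OF v] Suc by simp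
qed simp

text \<open>As layers grow at least by the factor 3/2, the ball is at most three times its last
  layer plus what was explored before \<open>k\<^sub>0\<close>. When it first passes
  \<open>c * n\<close>, at least half of it is new, so the last layer has size
  \<open>c * n / 6\<close>.\<close>

lemma reach_large_layer:
  fixes c \<kappa> :: real
  assumes v: "v \<in> V" and \<kappa>: "3 / 2 \<le> \<kappa>" and c: "0 < c"
    and k0: "K < layer v \<omega> k\<^sub>0" "\<And>i. i < k\<^sub>0 \<Longrightarrow> layer v \<omega> i \<le> K"
    and grow: "\<And>k. k\<^sub>0 \<le> k \<Longrightarrow> k < k\<^sub>0 + t \<Longrightarrow> K < layer v \<omega> k \<Longrightarrow>
      real (card (ball v \<omega> k)) \<le> c * real n \<Longrightarrow> \<kappa> * real (layer v \<omega> k) \<le> real (layer v \<omega> (Suc k))"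
    and t: "real n \<le> \<kappa> ^ t * real K" and small: "real (k\<^sub>0 * K) \<le> c * real n / 2"
  shows "\<exists>k\<le>k\<^sub>0 + t. c / 6 * real n \<le> real (layer v \<omega> k)"
proof -
  let ?small = "\<lambda>i. real (card (ball v \<omega> (k\<^sub>0 + i))) \<le> c * real n"
  let ?p = "card (pre (ball v \<omega>) k\<^sub>0)"
  have claim: "\<kappa> ^ m * real (layer v \<omega> k\<^sub>0) \<le> real (layer v \<omega> (k\<^sub>0 + m)) \<and>
      real (card (ball v \<omega> (k\<^sub>0 + m))) \<le> real ?p + 3 * real (layer v \<omega> (k\<^sub>0 + m))"
    if "\<forall>i<m. ?small i" "m \<le> t" for m
    using that
  proof (induction m)
    case 0
    then show ?case using card_pre_ball[OF v, of \<omega> k\<^sub>0] by simp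
  next
    case (Suc m)
    then have IH: "\<kappa> ^ m * real (layer v \<omega> k\<^sub>0) \<le> real (layer v \<omega> (k\<^sub>0 + m))"
      "real (card (ball v \<omega> (k\<^sub>0 + m))) \<le> real ?p + 3 * real (layer v \<omega> (k\<^sub>0 + m))" by auto
    have "1 * real (layer v \<omega> k\<^sub>0) \<le> \<kappa> ^ m * real (layer v \<omega> k\<^sub>0)"
      using \<kappa> by (intro mult_right_mono one_le_power) auto
    then have "K < layer v \<omega> (k\<^sub>0 + m)" using IH(1) k0(1) by linarith
    then have g: "\<kappa> * real (layer v \<omega> (k\<^sub>0 + m)) \<le> real (layer v \<omega> (Suc (k\<^sub>0 + m)))"
      using Suc.prems by (intro grow) auto
    have "\<kappa> * (\<kappa> ^ m * real (layer v \<omega> k\<^sub>0)) \<le> \<kappa> * real (layer v \<omega> (k\<^sub>0 + m))"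
      using IH(1) \<kappa> by (intro mult_left_mono) auto
    moreover have "3 / 2 * real (layer v \<omega> (k\<^sub>0 + m)) \<le> \<kappa> * real (layer v \<omega> (k\<^sub>0 + m))"
      using \<kappa> by (intro mult_right_mono) auto
    ultimately show ?case using g IH(2) card_ball_Suc[OF v, of \<omega> "k\<^sub>0 + m"] by simp
  qed
  have "\<exists>m. m \<le> t \<and> \<not> ?small m"
  proof (rule ccontr)
    assume "\<not> (\<exists>m. m \<le> t \<and> \<not> ?small m)"
    then have "\<forall>i<t. ?small i" by auto
    then have "\<kappa> ^ t * real (layer v \<omega> k\<^sub>0) \<le> real (layer v \<omega> (k\<^sub>0 + t))" using claim[of t] by simp
    moreover have "\<kappa> ^ t * real K < \<kappa> ^ t * real (layer v \<omega> k\<^sub>0)" using k0 \<kappa> by simp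
    moreover have "real (layer v \<omega> (k\<^sub>0 + t)) \<le> real n"
      using layer_le_card_ball[of v \<omega> "k\<^sub>0 + t"] card_ball_le[OF v, of \<omega> "k\<^sub>0 + t"] by linarith
    ultimately show False using t by linarith
  qed
  then obtain m where m': "m \<le> t \<and> \<not> ?small m" "\<And>i. i < m \<Longrightarrow> \<not> (i \<le> t \<and> \<not> ?small i)"
    using exists_least_iff[of "\<lambda>m. m \<le> t \<and> \<not> ?small m"] by blast
  then have m: "m \<le> t" "\<not> ?small m" "\<And>i. i < m \<Longrightarrow> ?small i" by force+
  have "?p \<le> k\<^sub>0 * K" by (rule card_pre_ball_le_mult[OF v k0(2)])
  then have "real ?p \<le> real (k\<^sub>0 * K)" by (simp only: of_nat_le_iff)
  then have "c * real n / 2 \<le> 3 * real (layer v \<omega> (k\<^sub>0 + m))"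
    using claim[of m] m small by (simp add: not_le)
  then show ?thesis using m(1) by (intro exI[of _ "k\<^sub>0 + m"]) simp
qed

lemma free_mono: "k \<le> l \<Longrightarrow> v \<in> V \<Longrightarrow> free v \<omega> l \<le> free v \<omega> k"
  unfolding free_def by (intro diff_le_mono2 card_mono ball_mono) auto

text \<open>The survival ratio itself shrinks by \<open>1 - c / 2\<close> in each step. After
  \<open>I\<close> steps it is below the \<open>I\<close>-th power, and \<open>I\<close> further
  steps with such a ratio produce the exponent \<open>I * I\<close>.\<close>

lemma decay_to_threshold:
  fixes c g :: real
  assumes v: "v \<in> V" and c: "0 < c" "c \<le> 1"
    and start: "real (free v \<omega> k) \<le> (1 - c) * real (pfree v \<omega> k)"
    and ok: "\<And>l. k \<le> l \<Longrightarrow> l < k + 2 * I \<Longrightarrow> \<not> slow_decay c g v l \<omega>"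
    and g: "(1 - c / 2) ^ (I * I) * real n \<le> g"
  shows "real (free v \<omega> (k + 2 * I)) \<le> g"
proof (rule ccontr)
  let ?\<beta> = "1 - c / 2"
  have \<beta>: "0 \<le> ?\<beta>" "?\<beta> \<le> 1" using c by auto
  assume "\<not> real (free v \<omega> (k + 2 * I)) \<le> g"
  \<comment> \<open>While the remainder stays above \<open>g\<close>, the bound in
    \<open>slow_decay\<close> can only come from the first entry of the maximum.\<close>
  then have big: "g < real (free v \<omega> (k + m))" if "m \<le> 2 * I" for m
    using free_mono[of "k + m" "k + 2 * I" v \<omega>] v that by linarith
  have ratio: "real (free v \<omega> (k + m)) \<le> (1 - c) * ?\<beta> ^ m * real (pfree v \<omega> (k + m))" if "m \<le> 2 * I" for m
    using that
  proof (induction m)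
    case (Suc m)
    let ?F = "real (free v \<omega> (k + m))" and ?P = "real (pfree v \<omega> (k + m))"
    have IH: "?F \<le> (1 - c) * ?\<beta> ^ m * ?P" using Suc by simp
    have "(1 - c) * ?\<beta> ^ m * ?P \<le> (1 - c) * 1 * ?P"
      using \<beta> c by (intro mult_right_mono mult_left_mono power_le_one) auto
    then have "?F \<le> (1 - c) * ?P" using IH by simp
    then have "real (free v \<omega> (Suc (k + m))) \<le> max (?\<beta> * (?F / ?P) * ?F) g"
      using ok[of "k + m"] Suc.prems by (auto simp: slow_decay_def)
    then have "real (free v \<omega> (Suc (k + m))) \<le> ?\<beta> * (?F / ?P) * ?F" using big[OF Suc.prems] by simp
    also have "\<dots> \<le> ?\<beta> * ((1 - c) * ?\<beta> ^ m) * ?F"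
    proof (intro mult_right_mono mult_left_mono)
      \<comment> \<open>If nothing was left one step earlier, the quotient is 0 by the convention
        for division.\<close>
      show "?F / ?P \<le> (1 - c) * ?\<beta> ^ m"
        using IH c \<beta> by (cases "?P = 0") (auto simp: divide_le_eq)
    qed (use \<beta> in auto)
    also have "\<dots> = (1 - c) * ?\<beta> ^ Suc m * real (pfree v \<omega> (k + Suc m))"
      by (simp only: add_Suc_right pfree_Suc power_Suc mult_ac)
    finally show ?case by simp
  qed (use start in simp)
  have "real (free v \<omega> (k + (I + i))) \<le> (?\<beta> ^ I) ^ i * real n" if "i \<le> I" for i
    using that
  proof (induction i)
    case 0
    have "free v \<omega> (k + I) \<le> n" by (simp add: free_def)
    then show ?case by simp
  next
    case (Suc i)
    have "real (free v \<omega> (k + (I + Suc i))) \<le> (1 - c) * ?\<beta> ^ (I + Suc i) * real (pfree v \<omega> (k + (I + Suc i)))"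
      using ratio[of "I + Suc i"] Suc.prems by simp
    also have "real (pfree v \<omega> (k + (I + Suc i))) = real (free v \<omega> (k + (I + i)))" by (simp add: pfree_Suc)
    also have "(1 - c) * ?\<beta> ^ (I + Suc i) * real (free v \<omega> (k + (I + i))) \<le>
      (1 * ?\<beta> ^ I) * ((?\<beta> ^ I) ^ i * real n)"
      using Suc \<beta> c by (intro mult_mono power_decreasing) auto
    finally show ?case by simp
  qed
  from this[of I] have "real (free v \<omega> (k + 2 * I)) \<le> ?\<beta> ^ (I * I) * real n" by (simp add: mult_2 power_mult)
  then show False using g big[of "2 * I"] by simp
qed

text \<open>Arcs from outside the ball of radius \<open>l + 1\<close> cannot enter the ball of
  radius \<open>l\<close>. So the complement of the larger ball, with its heads, lies in the
  complement of the smaller one, and expansion shrinks the remainder to at most 2/3 per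
  step.\<close>

lemma expanding_finish:
  assumes v: "v \<in> V" and w: "\<omega> \<in> \<Omega>" and e: "expanding \<omega>"
    and g: "3000 * free v \<omega> k \<le> n" "real (free v \<omega> k) < (3 / 2) ^ t"
  shows "V \<subseteq> ball v \<omega> (k + t)"
proof -
  have step: "3 * free v \<omega> (Suc l) \<le> 2 * free v \<omega> l" if l: "3000 * free v \<omega> l \<le> n" for l
  proof -
    define A where "A = V - ball v \<omega> (Suc l)"
    have cA: "card A = free v \<omega> (Suc l)"
      using card_Diff_subset[OF finite_ball[OF v] ball_subset[OF v], of \<omega> "Suc l"] by (simp add: A_def free_def)
    have cB: "card (V - ball v \<omega> l) = free v \<omega> l"
      using card_Diff_subset[OF finite_ball[OF v] ball_subset[OF v], of \<omega> l] by (simp add: free_def)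
    have "heads \<omega> A \<subseteq> V" using w unfolding A_def heads_def \<Omega>_def T_def by (fastforce simp: PiE_iff)
    moreover have "heads \<omega> A \<inter> ball v \<omega> l = {}" by (auto simp: A_def heads_def)
    moreover have "A \<subseteq> V - ball v \<omega> l" by (auto simp: A_def)
    ultimately have sub: "A \<union> heads \<omega> A \<subseteq> V - ball v \<omega> l" by auto
    then have c: "card (A \<union> heads \<omega> A) \<le> free v \<omega> l" unfolding cB[symmetric] by (intro card_mono) auto
    show ?thesis
    proof (cases "A = {}")
      case False
      have "free v \<omega> (Suc l) \<le> free v \<omega> l" using v by (intro free_mono) auto
      then have "3000 * card A \<le> n" using cA l by simp
      moreover have "A \<subseteq> V" by (auto simp: A_def)
      ultimately have "3 * card A \<le> 2 * card (A \<union> heads \<omega> A)" using e False by (simp add: expanding_def)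
      then show ?thesis using c cA by simp
    qed (use cA in simp)
  qed
  have "real (free v \<omega> (k + m)) * (3 / 2) ^ m \<le> real (free v \<omega> k)" for m
  proof (induction m)
    case (Suc m)
    have "free v \<omega> (k + m) \<le> free v \<omega> k" using v by (intro free_mono) auto
    then have "3 * free v \<omega> (Suc (k + m)) \<le> 2 * free v \<omega> (k + m)" using g by (intro step) simp
    then have "real (free v \<omega> (Suc (k + m))) * (3 / 2) \<le> real (free v \<omega> (k + m))" by simp
    then have "real (free v \<omega> (Suc (k + m))) * (3 / 2) * (3 / 2) ^ m \<le> real (free v \<omega> (k + m)) * (3 / 2) ^ m"
      by (rule mult_right_mono) simp
    moreover have "real (free v \<omega> (k + Suc m)) * (3 / 2) ^ Suc m = real (free v \<omega> (Suc (k + m))) * (3 / 2) * (3 / 2) ^ m"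
      by (simp only: add_Suc_right power_Suc mult.assoc)
    ultimately show ?case using Suc by linarith
  qed simp
  from this[of t] have "real (free v \<omega> (k + t)) * (3 / 2) ^ t < 1 * (3 / 2) ^ t" using g by linarith
  then have "real (free v \<omega> (k + t)) < 1" by (subst (asm) mult_less_cancel_right_pos) auto
  then have "n \<le> card (ball v \<omega> (k + t))" by (simp add: free_def)
  then have "ball v \<omega> (k + t) = V" using card_ball_le[OF v, of \<omega> "k + t"]
    by (intro card_subset_eq ball_subset v) auto
  then show ?thesis by simp
qed

text \<open>\<open>\<delta> / (24 * real r)\<close> is one sixth of the density
  \<open>\<delta> / (4 * real r)\<close> up to which growth is controlled: the layer density that
  \<open>reach_large_layer\<close> guarantees.\<close>

definition good :: "real \<Rightarrow> nat \<Rightarrow> real \<Rightarrow> nat \<Rightarrow> (nat \<Rightarrow> nat \<Rightarrow> nat) \<Rightarrow> bool" where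
  "good \<delta> K g H \<omega> \<longleftrightarrow> expanding \<omega> \<and>
     (\<forall>v\<in>V. \<forall>k<H. \<not> slow_growth \<delta> K v k \<omega> \<and> \<not> slow_decay (\<delta> / (24 * real r)) g v k \<omega>)"

lemma prb_not_good:
  assumes \<delta>: "0 < \<delta>" "\<delta> \<le> 1"
  shows "prb (\<lambda>\<omega>. \<not> good \<delta> K g H \<omega>) \<le> 24 * real n powr (- 1 / 3) +
    real n * real H * (exp (- (\<delta> ^ 2 * real K / 8)) + exp (- ((\<delta> / (24 * real r)) ^ 2 * g / 32)))"
proof -
  let ?c = "\<delta> / (24 * real r)"
  have c: "0 < ?c" "?c \<le> 1" using \<delta> r by (auto simp: field_simps)
  let ?bad = "\<lambda>v k \<omega>. slow_growth \<delta> K v k \<omega> \<or> slow_decay ?c g v k \<omega>"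
  let ?e = "exp (- (\<delta> ^ 2 * real K / 8)) + exp (- (?c ^ 2 * g / 32))"
  have "prb (\<lambda>\<omega>. \<not> good \<delta> K g H \<omega>) \<le> prb (\<lambda>\<omega>. \<not> expanding \<omega> \<or> (\<exists>p\<in>V \<times> {..<H}. ?bad (fst p) (snd p) \<omega>))"
    by (rule prb_mono) (auto simp: good_def)
  also have "\<dots> \<le> prb (\<lambda>\<omega>. \<not> expanding \<omega>) + prb (\<lambda>\<omega>. \<exists>p\<in>V \<times> {..<H}. ?bad (fst p) (snd p) \<omega>)"
    by (rule prb_disj)
  also have "prb (\<lambda>\<omega>. \<exists>p\<in>V \<times> {..<H}. ?bad (fst p) (snd p) \<omega>) \<le> (\<Sum>p\<in>V \<times> {..<H}. prb (?bad (fst p) (snd p)))"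
    by (rule prb_union) auto
  also have "\<dots> \<le> (\<Sum>p\<in>V \<times> {..<H}. ?e)"
  proof (rule sum_mono)
    fix p assume "p \<in> V \<times> {..<H}"
    then have v: "fst p \<in> V" by auto
    have "prb (?bad (fst p) (snd p)) \<le> prb (slow_growth \<delta> K (fst p) (snd p)) + prb (slow_decay ?c g (fst p) (snd p))"
      by (rule prb_disj)
    also have "\<dots> \<le> ?e" by (intro add_mono prb_slow_growth prb_slow_decay v \<delta> c)
    finally show "prb (?bad (fst p) (snd p)) \<le> ?e" .
  qed
  also have "\<dots> = real n * real H * ?e" by simp
  finally show ?thesis using prb_not_expanding by linarith
qed

lemma good_covers:
  assumes v: "v \<in> V" and w: "\<omega> \<in> \<Omega>" and G: "good \<delta> K g H \<omega>" and \<delta>: "0 < \<delta>" "\<delta> \<le> 1"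
    and k0: "K < layer v \<omega> k\<^sub>0" "\<And>i. i < k\<^sub>0 \<Longrightarrow> layer v \<omega> i \<le> K"
    and \<kappa>: "3 / 2 \<le> (1 - \<delta>) * real r"
    and t: "real n \<le> ((1 - \<delta>) * real r) ^ t * real K" and small: "real (k\<^sub>0 * K) \<le> \<delta> / (8 * real r) * real n"
    and I: "(1 - \<delta> / (48 * real r)) ^ (I * I) * real n \<le> g" and g: "3000 * g \<le> real n" "g < (3 / 2) ^ u"
    and H: "k\<^sub>0 + t + 2 * I \<le> H"
  shows "V \<subseteq> ball v \<omega> (k\<^sub>0 + t + 2 * I + u)"
proof -
  let ?c = "\<delta> / (4 * real r)" and ?d = "\<delta> / (24 * real r)"
  have rr: "real r \<ge> 2" using r by simp
  have d: "0 < ?d" "?d \<le> 1" using \<delta> rr by (auto simp: field_simps)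
  have "\<exists>k\<le>k\<^sub>0 + t. ?c / 6 * real n \<le> real (layer v \<omega> k)"
  proof (rule reach_large_layer[OF v \<kappa> _ k0 _ t])
    show "0 < ?c" using \<delta> rr by simp
    show "real (k\<^sub>0 * K) \<le> ?c * real n / 2" using small by (simp add: field_simps)
    fix k assume "k < k\<^sub>0 + t" "K < layer v \<omega> k" "real (card (ball v \<omega> k)) \<le> ?c * real n"
    moreover have "\<not> slow_growth \<delta> K v k \<omega>" using G v H \<open>k < k\<^sub>0 + t\<close> by (simp add: good_def)
    ultimately show "(1 - \<delta>) * real r * real (layer v \<omega> k) \<le> real (layer v \<omega> (Suc k))"
      by (auto simp: slow_growth_def not_less)
  qed auto
  then obtain k where k: "k \<le> k\<^sub>0 + t" "?d * real n \<le> real (layer v \<omega> k)" by (auto simp: field_simps)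
  \<comment> \<open>A layer of \<open>?d * n\<close> out of at most \<open>n\<close> vertices starts
    the decay with survival ratio at most \<open>1 - ?d\<close>.\<close>
  have "pfree v \<omega> k \<le> n" by (simp add: pfree_def)
  then have "?d * real (pfree v \<omega> k) \<le> ?d * real n" using d by (intro mult_left_mono) auto
  then have "real (free v \<omega> k) \<le> (1 - ?d) * real (pfree v \<omega> k)"
    using free_layer[OF v, of \<omega> k] k(2) by (simp add: algebra_simps)
  then have "real (free v \<omega> (k + 2 * I)) \<le> g"
  proof (rule decay_to_threshold[OF v d])
    fix l assume "k \<le> l" "l < k + 2 * I"
    then have "l < H" using k(1) H by linarith
    then show "\<not> slow_decay ?d g v l \<omega>" using G v by (simp add: good_def)
  qed (use I in \<open>simp add: field_simps\<close>)
  then have "V \<subseteq> ball v \<omega> (k + 2 * I + u)"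
    using g G by (intro expanding_finish v w) (auto simp: good_def)
  moreover have "ball v \<omega> (k + 2 * I + u) \<subseteq> ball v \<omega> (k\<^sub>0 + t + 2 * I + u)"
    using k(1) by (intro ball_mono) simp
  ultimately show ?thesis by blast
qed

text \<open>An empty layer means that the ball is closed under predecessors.\<close>

lemma dead_stays:
  assumes v: "v \<in> V" and "layer v \<omega> (Suc m) = 0"
  shows "ball v \<omega> j \<subseteq> ball v \<omega> m"
proof -
  have "ball v \<omega> m = ball v \<omega> (Suc m)"
    using card_ball_Suc[OF v, of \<omega> m] assms by (intro card_subset_eq ball_mono) auto
  then have stable: "i \<in> ball v \<omega> m" if "i \<in> V" "\<exists>j\<in>J. \<omega> i j \<in> ball v \<omega> m" for i
    using that by auto
  show ?thesis
  proof (induction j)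
    case 0 then show ?case using ball_mono[of 0 m v \<omega>] by simp
  next
    case (Suc j) then show ?case using stable by auto
  qed
qed

text \<open>The first index at which thinness fails decides: there the layer is too large, or it is
  empty and the exploration has stopped after layers of at most \<open>K\<close> vertices.\<close>

lemma not_thin_cases:
  assumes v: "v \<in> V" and nt: "\<not> thin v K t \<omega>"
  obtains (exceed) k where "k \<le> t" "K < layer v \<omega> k" "\<And>i. i < k \<Longrightarrow> layer v \<omega> i \<le> K"
  | (dead) m where "m < t" "\<And>j. ball v \<omega> j \<subseteq> ball v \<omega> m" "card (ball v \<omega> m) \<le> t * K"
proof -
  let ?P = "\<lambda>i. i \<le> t \<and> \<not> (1 \<le> layer v \<omega> i \<and> layer v \<omega> i \<le> K)"
  define k where "k = (LEAST i. ?P i)"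
  have "\<exists>i. ?P i" using nt by (auto simp: thin_def)
  then have k: "?P k" unfolding k_def by (rule LeastI_ex)
  have lt: "layer v \<omega> i \<le> K" if "i < k" for i
    using not_less_Least[of i ?P] that k unfolding k_def[symmetric] by auto
  show ?thesis
  proof (cases "layer v \<omega> k = 0")
    case True
    then obtain m where m: "k = Suc m" using layer_0[OF v, of \<omega>] by (cases k) auto
    have "card (ball v \<omega> m) \<le> k * K" using card_pre_ball_le_mult[OF v lt, of k] m by simp
    also have "\<dots> \<le> t * K" using k by (intro mult_right_mono) auto
    finally show ?thesis using dead[of m] dead_stays[OF v, of \<omega> m] True m k by auto
  next
    case False
    then show ?thesis using exceed[of k] k lt by auto
  qed
qed

section \<open>Two explorations\<close>

text \<open>Replace the \<open>j\<close>-th head, lying in \<open>A'\<close>, by any vertex outside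
  \<open>A\<close>: neither the old nor the new head meets a set of the history, which is therefore
  unchanged. The old head and the new tuple determine everything, which gives the count.\<close>

lemma hist_set_resample:
  assumes A: "\<And>k. k < t \<Longrightarrow> \<sigma> k \<subseteq> A" and AV: "A \<subseteq> V" "A' \<subseteq> V" "A \<inter> A' = {}" and j: "j \<in> J"
  shows "card {\<tau> \<in> hist_set t \<sigma> i. \<tau> j \<in> A'} * (n - card A) \<le> card A' * card (hist_set t \<sigma> i)"
proof -
  let ?D = "{\<tau> \<in> hist_set t \<sigma> i. \<tau> j \<in> A'}"
  let ?f = "\<lambda>(\<tau>, y). (\<tau> j, \<tau>(j := y :: nat))"
  have fin: "finite A" "finite A'" using AV by (auto intro: finite_subset[OF _ finite_V])
  have "card (?D \<times> (V - A)) \<le> card (A' \<times> hist_set t \<sigma> i)"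
  proof (rule card_inj_on_le[of ?f])
    show "inj_on ?f (?D \<times> (V - A))"
    proof (rule inj_onI, clarify)
      fix \<tau> y \<tau>' y'
      assume e: "\<tau> j = \<tau>' j" "\<tau>(j := y) = \<tau>'(j := y')"
      have "y = y'" using fun_cong[OF e(2), of j] by simp
      moreover have "\<tau> = \<tau>'"
      proof
        fix i show "\<tau> i = \<tau>' i" using fun_cong[OF e(2), of i] e(1) by (cases "i = j") auto
      qed
      ultimately show "\<tau> = \<tau>' \<and> y = y'" by simp
    qed
    show "?f ` (?D \<times> (V - A)) \<subseteq> A' \<times> hist_set t \<sigma> i"
    proof
      fix p assume "p \<in> ?f ` (?D \<times> (V - A))"
      then obtain \<tau> y where p: "p = (\<tau> j, \<tau>(j := y))" and \<tau>: "\<tau> \<in> hist_set t \<sigma> i" "\<tau> j \<in> A'"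
        and y: "y \<in> V" "y \<notin> A" by auto
      have "\<tau>(j := y) \<in> T" using \<tau>(1) y(1) j by (auto simp: hist_set_def T_def PiE_iff extensional_def)
      moreover have "(\<exists>l\<in>J. (\<tau>(j := y)) l \<in> \<sigma> k) \<longleftrightarrow> (\<exists>l\<in>J. \<tau> l \<in> \<sigma> k)" if "k < t" for k
      proof -
        have "y \<notin> \<sigma> k" "\<tau> j \<notin> \<sigma> k" using A[OF that] y \<tau>(2) AV(3) by auto
        then show ?thesis by (auto split: if_splits)
      qed
      ultimately have "\<tau>(j := y) \<in> hist_set t \<sigma> i" using \<tau>(1) unfolding hist_set_def by simp
      then show "p \<in> A' \<times> hist_set t \<sigma> i" using \<tau>(2) by (simp add: p)
    qed
  qed (use fin in simp)
  then show ?thesis using card_Diff_subset[OF fin(1) AV(1)] by (simp add: card_cartesian_product)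
qed

definition hist_class :: "nat \<Rightarrow> nat \<Rightarrow> (nat \<Rightarrow> nat \<Rightarrow> nat) \<Rightarrow> (nat \<Rightarrow> nat \<Rightarrow> nat) set" where
  "hist_class v t \<omega>\<^sub>0 = {\<omega> \<in> \<Omega>. \<forall>i\<le>t. ball v \<omega> i = ball v \<omega>\<^sub>0 i}"

lemma hist_class_eq: "v \<in> V \<Longrightarrow> hist_class v t \<omega>\<^sub>0 = PiE V (hist_set t (ball v \<omega>\<^sub>0))"
  unfolding hist_class_def by (intro history_class) (auto dest: ball_subset)

lemma ball_chain: "\<forall>k<t. ball v \<omega> k \<subseteq> ball v \<omega> (Suc k)"
  using ball_mono[of _ "Suc _" v \<omega>] by auto

lemma hist_set_ball_outside:
  "i \<notin> ball v \<omega> t \<Longrightarrow> hist_set t (ball v \<omega>) i = {\<tau> \<in> T. \<forall>j\<in>J. \<tau> j \<notin> pre (ball v \<omega>) t}"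
  by (rule hist_set_outside[OF ball_chain])

lemma pre_ball_V: "v \<in> V \<Longrightarrow> pre (ball v \<omega>) k \<subseteq> V"
  using pre_ball_subset[of v \<omega> k] ball_subset[of v \<omega> k] by auto

lemma hist_set_ball_lower:
  assumes v: "v \<in> V" and i: "i \<notin> ball v \<omega> t" and b: "card (ball v \<omega> t) \<le> b"
  shows "(n - b) ^ r \<le> card (hist_set t (ball v \<omega>) i)"
  unfolding hist_set_ball_outside[OF i] card_avoid[OF pre_ball_V[OF v]]
  using card_pre_ball_le[OF v, of \<omega> t] b by (intro power_mono diff_le_mono2) auto

text \<open>Vertices outside both explorations are negatively correlated; the others are few.\<close>

lemma pair_vertex:
  assumes v: "v \<in> V" and w: "w \<in> V" and disj: "ball v \<omega> t \<inter> ball w \<omega>' k = {}"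
    and b: "card (ball v \<omega> t) \<le> b" "card (ball w \<omega>' k) \<le> b"
  shows "real (card (hist_set t (ball v \<omega>) i \<inter> hist_set k (ball w \<omega>') i)) *
      (real n ^ r * (if i \<in> ball v \<omega> t \<union> ball w \<omega>' k then (real (n - b) / real n) ^ r else 1)) \<le>
    real (card (hist_set t (ball v \<omega>) i)) * real (card (hist_set k (ball w \<omega>') i))"
proof -
  let ?H = "hist_set t (ball v \<omega>) i" and ?H' = "hist_set k (ball w \<omega>') i"
  have n0: "real n > 0" using n by simp
  have \<rho>: "real n ^ r * (real (n - b) / real n) ^ r = real ((n - b) ^ r)" using n0 by (simp add: power_divide)
  consider "i \<in> ball v \<omega> t" "i \<notin> ball w \<omega>' k" | "i \<notin> ball v \<omega> t" "i \<in> ball w \<omega>' k"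
    | "i \<notin> ball v \<omega> t" "i \<notin> ball w \<omega>' k" using disj by blast
  then show ?thesis
  proof cases
    case 1
    have "card (?H \<inter> ?H') \<le> card ?H" by (intro card_mono) auto
    moreover have "(n - b) ^ r \<le> card ?H'" using hist_set_ball_lower[OF w 1(2) b(2)] .
    ultimately have "real (card (?H \<inter> ?H')) * real ((n - b) ^ r) \<le> real (card ?H) * real (card ?H')"
      by (intro mult_mono) (auto simp del: of_nat_power)
    then show ?thesis using 1 \<rho> by (simp del: of_nat_power)
  next
    case 2
    have "card (?H \<inter> ?H') \<le> card ?H'" by (intro card_mono) auto
    moreover have "(n - b) ^ r \<le> card ?H" using hist_set_ball_lower[OF v 2(1) b(1)] .
    ultimately have "real (card (?H \<inter> ?H')) * real ((n - b) ^ r) \<le> real (card ?H') * real (card ?H)"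
      by (intro mult_mono) (auto simp del: of_nat_power)
    then show ?thesis using 2 \<rho> by (simp add: mult.commute del: of_nat_power)
  next
    case 3
    let ?A = "pre (ball v \<omega>) t" and ?A' = "pre (ball w \<omega>') k"
    have d: "?A \<inter> ?A' = {}" using disj pre_ball_subset[of v \<omega> t] pre_ball_subset[of w \<omega>' k] by auto
    have sub: "?A \<subseteq> V" "?A' \<subseteq> V" using pre_ball_V v w by auto
    then have fin: "finite ?A" "finite ?A'" by (auto intro: finite_subset[OF _ finite_V])
    have "?H \<inter> ?H' = {\<tau> \<in> T. \<forall>j\<in>J. \<tau> j \<notin> ?A \<union> ?A'}"
      unfolding hist_set_ball_outside[OF 3(1)] hist_set_ball_outside[OF 3(2)] by auto
    then have c: "card (?H \<inter> ?H') = (n - (card ?A + card ?A')) ^ r"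
      using card_avoid[of "?A \<union> ?A'"] sub card_Un_disjoint[OF fin d] by simp
    have le: "card ?A + card ?A' \<le> n"
      using card_mono[OF finite_V, of "?A \<union> ?A'"] sub card_Un_disjoint[OF fin d] by simp
    define x y where "x = real (card ?A)" and "y = real (card ?A')"
    have xy: "0 \<le> x" "0 \<le> y" "x + y \<le> real n" using le by (auto simp: x_def y_def simp flip: of_nat_add)
    \<comment> \<open>The product \<open>x * y\<close> dropped here is the negative correlation of
      avoiding two disjoint sets.\<close>
    have "(real n - (x + y)) * real n \<le> (real n - x) * (real n - y)"
      using mult_nonneg_nonneg[OF xy(1,2)] by (simp add: algebra_simps)
    then have "((real n - (x + y)) * real n) ^ r \<le> ((real n - x) * (real n - y)) ^ r"
      using xy by (intro power_mono) auto
    moreover have "real (card (?H \<inter> ?H')) = (real n - (x + y)) ^ r" unfolding c using le by (simp add: x_def y_def of_nat_diff)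
    moreover have "real (card ?H) = (real n - x) ^ r" "real (card ?H') = (real n - y) ^ r"
      unfolding hist_set_ball_outside[OF 3(1)] hist_set_ball_outside[OF 3(2)] card_avoid[OF sub(1)] card_avoid[OF sub(2)]
      using le by (simp_all add: x_def y_def of_nat_diff)
    ultimately show ?thesis using 3 by (simp add: power_mult_distrib)
  qed
qed

text \<open>At most \<open>2 * b\<close> vertices lie in one of the two explorations and each costs
  the factor \<open>(real (n - b) / real n) ^ r\<close> once; all others cost nothing. The factor
  \<open>e\<close> leaves room for a further restriction at a single vertex.\<close>

lemma pair_product:
  assumes v: "v \<in> V" and w: "w \<in> V"
    and b: "card (ball v \<omega> t) \<le> b" "card (ball w \<omega>' k) \<le> b"
    and e: "\<And>i. i \<in> V \<Longrightarrow> 0 \<le> e i"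
    and F: "\<And>i. i \<in> V \<Longrightarrow> real (card (F i)) *
      (real n ^ r * (if i \<in> ball v \<omega> t \<union> ball w \<omega>' k then (real (n - b) / real n) ^ r else 1)) \<le>
      e i * (real (card (hist_set t (ball v \<omega>) i)) * real (card (hist_set k (ball w \<omega>') i)))"
  shows "real (card (PiE V F)) * real (card \<Omega>) * ((real (n - b) / real n) ^ r) ^ (2 * b) \<le>
    (\<Prod>i\<in>V. e i) * (real (card (hist_class v t \<omega>)) * real (card (hist_class w k \<omega>')))"
proof -
  let ?\<rho> = "(real (n - b) / real n) ^ r" and ?U = "ball v \<omega> t \<union> ball w \<omega>' k"
  have \<rho>: "0 \<le> ?\<rho>" "?\<rho> \<le> 1" by (auto intro!: power_le_one simp: divide_le_eq_1)
  have "card ?U \<le> 2 * b" using card_Un_le[of "ball v \<omega> t" "ball w \<omega>' k"] b by simp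
  then have "?\<rho> ^ (2 * b) \<le> ?\<rho> ^ card ?U" using \<rho> by (intro power_decreasing) auto
  also have "\<dots> = (\<Prod>i\<in>V. if i \<in> ?U then ?\<rho> else 1)"
  proof -
    have "V \<inter> {i. i \<in> ?U} = ?U" using ball_subset[OF v, of \<omega> t] ball_subset[OF w, of \<omega>' k] by blast
    then show ?thesis by (simp add: prod.If_cases del: Un_iff)
  qed
  finally have 1: "?\<rho> ^ (2 * b) \<le> (\<Prod>i\<in>V. if i \<in> ?U then ?\<rho> else 1)" .
  have "real (card (PiE V F)) * real (card \<Omega>) * ?\<rho> ^ (2 * b) \<le>
    real (card (PiE V F)) * real (card \<Omega>) * (\<Prod>i\<in>V. if i \<in> ?U then ?\<rho> else 1)"
    using 1 by (intro mult_left_mono) auto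
  also have "\<dots> = (\<Prod>i\<in>V. real (card (F i)) * (real n ^ r * (if i \<in> ?U then ?\<rho> else 1)))"
    by (simp add: card_PiE card_\<Omega> prod.distrib)
  also have "\<dots> \<le> (\<Prod>i\<in>V. e i * (real (card (hist_set t (ball v \<omega>) i)) * real (card (hist_set k (ball w \<omega>') i))))"
    using F \<rho> by (intro prod_mono) auto
  also have "\<dots> = (\<Prod>i\<in>V. e i) * (real (card (hist_class v t \<omega>)) * real (card (hist_class w k \<omega>')))"
    by (simp add: hist_class_eq v w card_PiE prod.distrib)
  finally show ?thesis .
qed

text \<open>The price for treating two disjoint explorations as independent; it is close to 1 as
  long as \<open>b ^ 2\<close> is small against \<open>n\<close>.\<close>

definition pair_const :: "nat \<Rightarrow> real" where
  "pair_const b = 1 / ((real (n - b) / real n) ^ r) ^ (2 * b)"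

lemma pair_const_pos: "b < n \<Longrightarrow> 0 < pair_const b"
  by (simp add: pair_const_def)

lemma pair_const_ge: "b < n \<Longrightarrow> a * ((real (n - b) / real n) ^ r) ^ (2 * b) \<le> c \<Longrightarrow> a \<le> pair_const b * c"
  by (simp add: pair_const_def field_simps)

lemma pair_class_disjoint:
  assumes v: "v \<in> V" and w: "w \<in> V" and disj: "ball v \<omega> t \<inter> ball w \<omega>' k = {}"
    and b: "card (ball v \<omega> t) \<le> b" "card (ball w \<omega>' k) \<le> b" "b < n"
  shows "real (card (hist_class v t \<omega> \<inter> hist_class w k \<omega>')) * real (card \<Omega>) \<le>
    pair_const b * (real (card (hist_class v t \<omega>)) * real (card (hist_class w k \<omega>')))"
proof -
  have eq: "hist_class v t \<omega> \<inter> hist_class w k \<omega>' =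
    PiE V (\<lambda>i. hist_set t (ball v \<omega>) i \<inter> hist_set k (ball w \<omega>') i)"
    by (simp add: hist_class_eq v w PiE_Int)
  show ?thesis unfolding eq
    using pair_product[OF v w b(1,2), of "\<lambda>_. 1" "\<lambda>i. hist_set t (ball v \<omega>) i \<inter> hist_set k (ball w \<omega>') i"]
      pair_vertex[OF v w disj b(1,2)] b(3)
    by (intro pair_const_ge) auto
qed

text \<open>For one fixed arc, resampling its head shows that it points into the other ball with
  conditional probability at most \<open>b / (n - b)\<close>; at most \<open>r * b\<close> arcs come
  into question.\<close>

lemma pair_class_meet:
  assumes v: "v \<in> V" and w: "w \<in> V" and disj: "ball v \<omega> t \<inter> ball w \<omega>' k = {}"
    and b: "card (ball v \<omega> t) \<le> b" "card (ball w \<omega>' k) \<le> b" "b < n"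
  shows "real (card {\<omega>\<^sub>1 \<in> hist_class v t \<omega> \<inter> hist_class w k \<omega>'. \<exists>i\<in>ball v \<omega> t. \<exists>j\<in>J. \<omega>\<^sub>1 i j \<in> ball w \<omega>' k}) * real (card \<Omega>) \<le>
    real r * real b ^ 2 / real (n - b) * pair_const b * (real (card (hist_class v t \<omega>)) * real (card (hist_class w k \<omega>')))"
proof -
  let ?A = "ball v \<omega> t" and ?A' = "ball w \<omega>' k"
  let ?H = "hist_set t (ball v \<omega>)" and ?H' = "hist_set k (ball w \<omega>')"
  let ?R = "real (card (hist_class v t \<omega>)) * real (card (hist_class w k \<omega>'))"
  define F where "F = (\<lambda>i\<^sub>0 j i. if i = i\<^sub>0 then {\<tau> \<in> ?H i \<inter> ?H' i. \<tau> j \<in> ?A'} else ?H i \<inter> ?H' i)"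
  let ?q = "real b / real (n - b)"
  have one: "real (card (PiE V (F i\<^sub>0 j))) * real (card \<Omega>) \<le> pair_const b * (?q * ?R)"
    if i0: "i\<^sub>0 \<in> ?A" and j: "j \<in> J" for i\<^sub>0 j
  proof (rule pair_const_ge[OF b(3)])
    have i0V: "i\<^sub>0 \<in> V" using i0 ball_subset[OF v] by auto
    have i0A': "i\<^sub>0 \<notin> ?A'" using i0 disj by auto
    have "real (card (PiE V (F i\<^sub>0 j))) * real (card \<Omega>) * ((real (n - b) / real n) ^ r) ^ (2 * b) \<le>
      (\<Prod>i\<in>V. if i = i\<^sub>0 then ?q else 1) * ?R"
    proof (rule pair_product[OF v w b(1,2)])
      fix i assume "i \<in> V"
      let ?\<rho> = "if i \<in> ?A \<union> ?A' then (real (n - b) / real n) ^ r else 1"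
      show "real (card (F i\<^sub>0 j i)) * (real n ^ r * ?\<rho>) \<le>
        (if i = i\<^sub>0 then ?q else 1) * (real (card (?H i)) * real (card (?H' i)))"
      proof (cases "i = i\<^sub>0")
        case True
        have "card {\<tau> \<in> ?H i. \<tau> j \<in> ?A'} * (n - card ?A) \<le> card ?A' * card (?H i)"
          using disj j ball_mono[of _ t v \<omega>] by (intro hist_set_resample ball_subset v w) auto
        moreover have "card {\<tau> \<in> ?H i. \<tau> j \<in> ?A'} * (n - b) \<le> card {\<tau> \<in> ?H i. \<tau> j \<in> ?A'} * (n - card ?A)"
          using b by (intro mult_left_mono diff_le_mono2) auto
        moreover have "card ?A' * card (?H i) \<le> b * card (?H i)" using b by (intro mult_right_mono) auto
        ultimately have "card {\<tau> \<in> ?H i. \<tau> j \<in> ?A'} * (n - b) \<le> b * card (?H i)" by linarith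
        moreover have "card (F i\<^sub>0 j i) \<le> card {\<tau> \<in> ?H i. \<tau> j \<in> ?A'}"
          unfolding F_def using True by (intro card_mono) auto
        ultimately have "card (F i\<^sub>0 j i) * (n - b) \<le> b * card (?H i)"
          by (meson le_trans mult_le_mono1)
        then have "real (card (F i\<^sub>0 j i)) * real (n - b) \<le> real b * real (card (?H i))"
          by (simp only: of_nat_mult[symmetric] of_nat_le_iff)
        then have 1: "real (card (F i\<^sub>0 j i)) \<le> ?q * real (card (?H i))"
          using b(3) by (simp add: field_simps)
        have "(n - b) ^ r \<le> card (?H' i)" using hist_set_ball_lower[OF w i0A' b(2)] True by simp
        then have 2: "real (n - b) ^ r \<le> real (card (?H' i))" by (simp only: of_nat_power[symmetric] of_nat_le_iff)
        have "real n ^ r * ?\<rho> = real (n - b) ^ r" using i0 True n by (simp add: power_divide)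
        then show ?thesis using mult_mono[OF 1 2] True by (simp add: mult.assoc)
      next
        case False
        then show ?thesis using pair_vertex[OF v w disj b(1,2), of i] by (simp add: F_def)
      qed
    qed auto
    also have "(\<Prod>i\<in>V. if i = i\<^sub>0 then ?q else 1) = ?q" using i0V by (simp add: prod.delta)
    finally show "real (card (PiE V (F i\<^sub>0 j))) * real (card \<Omega>) * ((real (n - b) / real n) ^ r) ^ (2 * b) \<le> ?q * ?R" .
  qed
  have "{\<omega>\<^sub>1 \<in> hist_class v t \<omega> \<inter> hist_class w k \<omega>'. \<exists>i\<in>?A. \<exists>j\<in>J. \<omega>\<^sub>1 i j \<in> ?A'} \<subseteq>
    (\<Union>p\<in>?A \<times> J. PiE V (F (fst p) (snd p)))"
    unfolding hist_class_eq[OF v] hist_class_eq[OF w] F_def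
    using ball_subset[OF v, of \<omega> t] by (fastforce simp: PiE_iff split: if_splits)
  moreover have finF: "finite (PiE V (F (fst p) (snd p)))" for p by (intro finite_PiE) (auto simp: F_def)
  ultimately have "card {\<omega>\<^sub>1 \<in> hist_class v t \<omega> \<inter> hist_class w k \<omega>'. \<exists>i\<in>?A. \<exists>j\<in>J. \<omega>\<^sub>1 i j \<in> ?A'} \<le>
    card (\<Union>p\<in>?A \<times> J. PiE V (F (fst p) (snd p)))"
    using v by (intro card_mono) auto
  also have "\<dots> \<le> (\<Sum>p\<in>?A \<times> J. card (PiE V (F (fst p) (snd p))))"
    using v by (intro card_UN_le) auto
  finally have "real (card {\<omega>\<^sub>1 \<in> hist_class v t \<omega> \<inter> hist_class w k \<omega>'. \<exists>i\<in>?A. \<exists>j\<in>J. \<omega>\<^sub>1 i j \<in> ?A'}) \<le>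
    (\<Sum>p\<in>?A \<times> J. real (card (PiE V (F (fst p) (snd p)))))" by (simp flip: of_nat_sum)
  then have "real (card {\<omega>\<^sub>1 \<in> hist_class v t \<omega> \<inter> hist_class w k \<omega>'. \<exists>i\<in>?A. \<exists>j\<in>J. \<omega>\<^sub>1 i j \<in> ?A'}) * real (card \<Omega>) \<le>
    (\<Sum>p\<in>?A \<times> J. real (card (PiE V (F (fst p) (snd p))))) * real (card \<Omega>)" by (rule mult_right_mono) simp
  also have "\<dots> = (\<Sum>p\<in>?A \<times> J. real (card (PiE V (F (fst p) (snd p)))) * real (card \<Omega>))"
    by (rule sum_distrib_right)
  also have "\<dots> \<le> (\<Sum>p\<in>?A \<times> J. pair_const b * (?q * ?R))" using one by (intro sum_mono) auto
  also have "\<dots> = real (card ?A) * (real r * (pair_const b * (?q * ?R)))"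
    by (simp add: card_cartesian_product)
  also have "\<dots> \<le> real b * (real r * (pair_const b * (?q * ?R)))"
    using b pair_const_pos[OF b(3)] by (intro mult_right_mono) auto
  finally show ?thesis by (simp add: power2_eq_square algebra_simps)
qed

lemma prb_card: "prb P = real (card {\<omega> \<in> \<Omega>. P \<omega>}) / real (card \<Omega>)"
  by (simp add: prb_def ex_def sum.If_cases of_bool_def Int_def)

text \<open>Events determined by histories are unions of history classes, so bounds for pairs of
  classes add up. Disjointness of the two balls is constant on such a pair, hence
  \<open>class_bound\<close> is asked for disjoint explorations only.\<close>

lemma pair_prob:
  assumes P: "determined v t P" and Q: "determined w k Q" and C: "0 \<le> C"
    and class_bound: "\<And>\<omega> \<omega>'. \<omega> \<in> \<Omega> \<Longrightarrow> \<omega>' \<in> \<Omega> \<Longrightarrow> P \<omega> \<Longrightarrow> Q \<omega>' \<Longrightarrow> ball v \<omega> t \<inter> ball w \<omega>' k = {} \<Longrightarrow>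
      real (card {\<omega>\<^sub>1 \<in> hist_class v t \<omega> \<inter> hist_class w k \<omega>'. E \<omega>\<^sub>1 (ball v \<omega> t) (ball w \<omega>' k)}) * real (card \<Omega>) \<le>
      C * (real (card (hist_class v t \<omega>)) * real (card (hist_class w k \<omega>')))"
  shows "prb (\<lambda>\<omega>. P \<omega> \<and> Q \<omega> \<and> ball v \<omega> t \<inter> ball w \<omega> k = {} \<and> E \<omega> (ball v \<omega> t) (ball w \<omega> k)) \<le> C * prb P * prb Q"
proof -
  define SP where "SP = {\<omega> \<in> \<Omega>. P \<omega>}"
  define SQ where "SQ = {\<omega> \<in> \<Omega>. Q \<omega>}"
  define XP where "XP = hist_class v t ` SP"
  define XQ where "XQ = hist_class w k ` SQ"
  let ?E = "{\<omega> \<in> \<Omega>. P \<omega> \<and> Q \<omega> \<and> ball v \<omega> t \<inter> ball w \<omega> k = {} \<and> E \<omega> (ball v \<omega> t) (ball w \<omega> k)}"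
  have fin: "finite XP" "finite XQ" by (auto simp: XP_def XQ_def SP_def SQ_def)
  have finc: "finite (hist_class u l \<omega>)" for u l \<omega> by (simp add: hist_class_def)
  have self: "\<omega> \<in> hist_class u l \<omega>" if "\<omega> \<in> \<Omega>" for u l \<omega> using that by (simp add: hist_class_def)
  have cell: "real (card (?E \<inter> c \<inter> d)) * real (card \<Omega>) \<le> C * (real (card c) * real (card d))"
    if c: "c \<in> XP" and d: "d \<in> XQ" for c d
  proof (cases "?E \<inter> c \<inter> d = {}")
    case False
    then obtain \<omega>\<^sub>0 where w0: "\<omega>\<^sub>0 \<in> ?E" "\<omega>\<^sub>0 \<in> c" "\<omega>\<^sub>0 \<in> d" by blast
    have c': "c = hist_class v t \<omega>\<^sub>0" using c w0(2) unfolding XP_def hist_class_def by auto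
    have d': "d = hist_class w k \<omega>\<^sub>0" using d w0(3) unfolding XQ_def hist_class_def by auto
    have "?E \<inter> c \<inter> d \<subseteq> {\<omega>\<^sub>1 \<in> hist_class v t \<omega>\<^sub>0 \<inter> hist_class w k \<omega>\<^sub>0. E \<omega>\<^sub>1 (ball v \<omega>\<^sub>0 t) (ball w \<omega>\<^sub>0 k)}"
      unfolding c' d' by (auto simp: hist_class_def)
    then have "card (?E \<inter> c \<inter> d) \<le> card {\<omega>\<^sub>1 \<in> hist_class v t \<omega>\<^sub>0 \<inter> hist_class w k \<omega>\<^sub>0. E \<omega>\<^sub>1 (ball v \<omega>\<^sub>0 t) (ball w \<omega>\<^sub>0 k)}"
      using finc by (intro card_mono) auto
    then have "real (card (?E \<inter> c \<inter> d)) * real (card \<Omega>) \<le>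
      real (card {\<omega>\<^sub>1 \<in> hist_class v t \<omega>\<^sub>0 \<inter> hist_class w k \<omega>\<^sub>0. E \<omega>\<^sub>1 (ball v \<omega>\<^sub>0 t) (ball w \<omega>\<^sub>0 k)}) * real (card \<Omega>)"
      by (intro mult_right_mono) auto
    also have "\<dots> \<le> C * (real (card c) * real (card d))"
      unfolding c' d' using w0(1) by (intro class_bound) auto
    finally show ?thesis .
  next
    case True
    then have "card (?E \<inter> c \<inter> d) = 0" by (simp only: card.empty)
    then show ?thesis using C by (simp del: Int_iff)
  qed
  have part: "(\<Sum>c\<in>XP. real (card c)) = real (card SP)" if det: "determined u l R"
    and "SP = {\<omega> \<in> \<Omega>. R \<omega>}" "XP = hist_class u l ` SP" for u l R SP XP
  proof -
    have "(\<Sum>c\<in>XP. card c) = card (\<Union>XP)"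
    proof (rule card_Union_disjoint[symmetric])
      show "pairwise disjnt XP" unfolding that(3) pairwise_def disjnt_def hist_class_def by auto
      fix c assume "c \<in> XP" then show "finite c" using finc that by auto
    qed
    also have "\<Union>XP = SP"
    proof
      show "\<Union>XP \<subseteq> SP" using det unfolding that(2,3) hist_class_def determined_def by blast
      show "SP \<subseteq> \<Union>XP" using self unfolding that(2,3) by blast
    qed
    finally show ?thesis by (simp flip: of_nat_sum)
  qed
  have "?E \<subseteq> (\<Union>p\<in>XP \<times> XQ. ?E \<inter> fst p \<inter> snd p)"
    using self unfolding XP_def XQ_def SP_def SQ_def by fastforce
  then have "card ?E \<le> card (\<Union>p\<in>XP \<times> XQ. ?E \<inter> fst p \<inter> snd p)"
    using fin by (intro card_mono) auto
  also have "\<dots> \<le> (\<Sum>p\<in>XP \<times> XQ. card (?E \<inter> fst p \<inter> snd p))" using fin by (intro card_UN_le) auto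
  finally have "real (card ?E) * real (card \<Omega>) \<le> real (\<Sum>p\<in>XP \<times> XQ. card (?E \<inter> fst p \<inter> snd p)) * real (card \<Omega>)"
    by (intro mult_right_mono) (auto simp del: of_nat_sum)
  also have "\<dots> = (\<Sum>p\<in>XP \<times> XQ. real (card (?E \<inter> fst p \<inter> snd p)) * real (card \<Omega>))"
    by (simp only: of_nat_sum sum_distrib_right)
  also have "\<dots> \<le> (\<Sum>p\<in>XP \<times> XQ. C * (real (card (fst p)) * real (card (snd p))))"
    by (intro sum_mono cell) auto
  also have "\<dots> = C * ((\<Sum>c\<in>XP. real (card c)) * (\<Sum>d\<in>XQ. real (card d)))"
    unfolding sum_product sum.cartesian_product by (simp add: case_prod_unfold sum_distrib_left[symmetric])
  also have "\<dots> = C * (real (card SP) * real (card SQ))"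
    using part[OF P SP_def XP_def] part[OF Q SQ_def XQ_def] by simp
  finally have "real (card ?E) * real (card \<Omega>) \<le> C * (real (card SP) * real (card SQ))" .
  moreover have "a / N \<le> C * (p / N) * (q / N)" if "a * N \<le> C * (p * q)" "0 < N" for a N p q :: real
    using that by (simp add: field_simps)
  ultimately show ?thesis
    unfolding prb_card SP_def[symmetric] SQ_def[symmetric] using card_\<Omega>_pos by (simp only: of_nat_0_less_iff)
qed

text \<open>Explorations that are not disjoint fall into two cases: \<open>w\<close> lies in the
  ball of \<open>v\<close>, or an arc from that ball enters an earlier, still disjoint ball of
  \<open>w\<close>. In the second case only the size of the smaller ball is known, so
  \<open>prb (P w)\<close> is given up in exchange for the small probability of such an arc. Both
  cases contribute terms linear in \<open>S\<close>.\<close>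

lemma second_moment:
  assumes det: "\<And>v. v \<in> V \<Longrightarrow> determined v t (P v)"
    and small: "\<And>v \<omega>. v \<in> V \<Longrightarrow> P v \<omega> \<Longrightarrow> card (ball v \<omega> t) \<le> b" and b: "b < n"
  defines "S \<equiv> \<Sum>v\<in>V. prb (P v)"
  shows "ex (\<lambda>\<omega>. (\<Sum>v\<in>V. of_bool (P v \<omega>)) ^ 2) \<le>
    pair_const b * S ^ 2 + S * (real b + real n * real t * (real r * real b ^ 2 / real (n - b) * pair_const b))"
proof -
  let ?C = "pair_const b"
  let ?D = "real r * real b ^ 2 / real (n - b) * pair_const b"
  have C: "0 < ?C" using pair_const_pos[OF b] .
  have D: "0 \<le> ?D" using C by simp
  have pair: "prb (\<lambda>\<omega>. P v \<omega> \<and> P w \<omega>) \<le> ?C * prb (P v) * prb (P w) +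
      (prb (\<lambda>\<omega>. P v \<omega> \<and> w \<in> ball v \<omega> t) + real t * (?D * prb (P v)))" if v: "v \<in> V" and w: "w \<in> V" for v w
  proof -
    let ?small = "\<lambda>l \<omega>. card (ball w \<omega> l) \<le> b"
    let ?E1 = "\<lambda>\<omega>. P v \<omega> \<and> P w \<omega> \<and> ball v \<omega> t \<inter> ball w \<omega> t = {} \<and> True"
    let ?E2 = "\<lambda>\<omega>. P v \<omega> \<and> w \<in> ball v \<omega> t"
    let ?E3 = "\<lambda>l \<omega>. P v \<omega> \<and> ?small l \<omega> \<and> ball v \<omega> t \<inter> ball w \<omega> l = {} \<and> (\<exists>i\<in>ball v \<omega> t. \<exists>j\<in>J. \<omega> i j \<in> ball w \<omega> l)"
    have "prb (\<lambda>\<omega>. P v \<omega> \<and> P w \<omega>) \<le> prb (\<lambda>\<omega>. ?E1 \<omega> \<or> (?E2 \<omega> \<or> (\<exists>l\<in>{..<t}. ?E3 l \<omega>)))"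
    proof (rule prb_mono)
      fix \<omega> assume PP: "P v \<omega> \<and> P w \<omega>"
      show "?E1 \<omega> \<or> (?E2 \<omega> \<or> (\<exists>l\<in>{..<t}. ?E3 l \<omega>))"
      proof (cases "ball v \<omega> t \<inter> ball w \<omega> t = {}")
        case False
        \<comment> \<open>One step before the first meeting the balls are still disjoint, so the
          meeting is caused by an arc between them; radius 0 means that \<open>w\<close> itself was
          explored from \<open>v\<close>.\<close>
        define k where "k = (LEAST k. ball v \<omega> t \<inter> ball w \<omega> k \<noteq> {})"
        have k: "ball v \<omega> t \<inter> ball w \<omega> k \<noteq> {}" "k \<le> t"
          unfolding k_def using False by (rule LeastI, rule Least_le)
        show ?thesis
        proof (cases k)
          case 0
          then show ?thesis using k PP by auto
        next
          case (Suc l)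
          then have d: "ball v \<omega> t \<inter> ball w \<omega> l = {}"
            using not_less_Least[of l "\<lambda>k. ball v \<omega> t \<inter> ball w \<omega> k \<noteq> {}"] unfolding k_def[symmetric] by auto
          have "card (ball w \<omega> l) \<le> card (ball w \<omega> t)"
            using Suc k w by (intro card_mono ball_mono) auto
          then have "?small l \<omega>" using small[OF w] PP by force
          moreover have "\<exists>i\<in>ball v \<omega> t. \<exists>j\<in>J. \<omega> i j \<in> ball w \<omega> l" using k(1) d Suc by auto
          ultimately have "?E3 l \<omega>" using PP d by blast
          then show ?thesis using Suc k by auto
        qed
      qed (use PP in simp)
    qed
    also have "\<dots> \<le> prb ?E1 + (prb ?E2 + (\<Sum>l<t. prb (?E3 l)))"
      by (rule order_trans[OF prb_disj] add_left_mono prb_union finite_lessThan)+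
    also have "prb ?E1 \<le> ?C * prb (P v) * prb (P w)"
    proof (rule pair_prob[OF det[OF v] det[OF w]])
      fix \<omega> \<omega>' assume "P v \<omega>" "P w \<omega>'" "ball v \<omega> t \<inter> ball w \<omega>' t = {}"
      then show "real (card {\<omega>\<^sub>1 \<in> hist_class v t \<omega> \<inter> hist_class w t \<omega>'. True}) * real (card \<Omega>) \<le>
        ?C * (real (card (hist_class v t \<omega>)) * real (card (hist_class w t \<omega>')))"
        using pair_class_disjoint[OF v w _ small[OF v] small[OF w] b] by (simp add: Int_def)
    qed (use C in simp)
    also have "(\<Sum>l<t. prb (?E3 l)) \<le> (\<Sum>l<t. ?D * prb (P v))"
    proof (rule sum_mono)
      fix l assume "l \<in> {..<t}"
      have "prb (?E3 l) \<le> ?D * prb (P v) * prb (?small l)"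
      proof (rule pair_prob[where E = "\<lambda>\<omega> A A'. \<exists>i\<in>A. \<exists>j\<in>J. \<omega> i j \<in> A'", OF det[OF v]])
        show "determined w l (?small l)" by (simp add: determined_def)
        fix \<omega> \<omega>' assume "P v \<omega>" "?small l \<omega>'" "ball v \<omega> t \<inter> ball w \<omega>' l = {}"
        then show "real (card {\<omega>\<^sub>1 \<in> hist_class v t \<omega> \<inter> hist_class w l \<omega>'. \<exists>i\<in>ball v \<omega> t. \<exists>j\<in>J. \<omega>\<^sub>1 i j \<in> ball w \<omega>' l}) * real (card \<Omega>) \<le>
          ?D * (real (card (hist_class v t \<omega>)) * real (card (hist_class w l \<omega>')))"
          using small[OF v] b by (intro pair_class_meet[OF v w]) auto
      qed (rule D)
      also have "\<dots> \<le> ?D * prb (P v) * 1" using mult_nonneg_nonneg[OF D prb_nonneg] by (intro mult_left_mono prb_le_1)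
      finally show "prb (?E3 l) \<le> ?D * prb (P v)" by simp
    qed
    also have "(\<Sum>l<t. ?D * prb (P v)) = real t * (?D * prb (P v))" by simp
    finally show ?thesis by simp
  qed
  have "ex (\<lambda>\<omega>. (\<Sum>v\<in>V. of_bool (P v \<omega>)) ^ 2) = (\<Sum>v\<in>V. \<Sum>w\<in>V. prb (\<lambda>\<omega>. P v \<omega> \<and> P w \<omega>))"
    unfolding power2_eq_square sum_product ex_sum prb_def of_bool_conj ..
  also have "\<dots> \<le> (\<Sum>v\<in>V. \<Sum>w\<in>V. ?C * prb (P v) * prb (P w) +
      (prb (\<lambda>\<omega>. P v \<omega> \<and> w \<in> ball v \<omega> t) + real t * (?D * prb (P v))))"
    by (intro sum_mono pair)
  also have "\<dots> = ?C * S ^ 2 + ((\<Sum>v\<in>V. \<Sum>w\<in>V. prb (\<lambda>\<omega>. P v \<omega> \<and> w \<in> ball v \<omega> t)) + real n * real t * ?D * S)"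
  proof -
    have "(\<Sum>v\<in>V. \<Sum>w\<in>V. C * prb (P v) * prb (P w) + (q v w + real t * (D * prb (P v)))) =
      C * S ^ 2 + ((\<Sum>v\<in>V. \<Sum>w\<in>V. q v w) + real n * real t * D * S)" for C D and q :: "nat \<Rightarrow> nat \<Rightarrow> real"
      unfolding S_def power2_eq_square
      by (simp add: sum.distrib sum_distrib_left sum_distrib_right sum_product algebra_simps)
    then show ?thesis .
  qed
  also have "(\<Sum>v\<in>V. \<Sum>w\<in>V. prb (\<lambda>\<omega>. P v \<omega> \<and> w \<in> ball v \<omega> t)) \<le> (\<Sum>v\<in>V. real b * prb (P v))"
  proof (rule sum_mono)
    fix v assume v: "v \<in> V"
    have "(\<Sum>w\<in>V. prb (\<lambda>\<omega>. P v \<omega> \<and> w \<in> ball v \<omega> t)) = ex (\<lambda>\<omega>. \<Sum>w\<in>V. of_bool (P v \<omega> \<and> w \<in> ball v \<omega> t))"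
      unfolding prb_def ex_sum ..
    also have "\<dots> \<le> ex (\<lambda>\<omega>. real b * of_bool (P v \<omega>))"
    proof (rule ex_mono)
      fix \<omega>
      have "(\<Sum>w\<in>V. of_bool (w \<in> ball v \<omega> t)) = real (card (ball v \<omega> t))"
        using ball_subset[OF v, of \<omega> t] by (simp add: sum.If_cases of_bool_def Int_absorb1)
      then show "(\<Sum>w\<in>V. of_bool (P v \<omega> \<and> w \<in> ball v \<omega> t)) \<le> real b * of_bool (P v \<omega>)"
        using small[OF v, of \<omega>] by auto
    qed
    also have "\<dots> = real b * prb (P v)" by (simp add: ex_cmult prb_def)
    finally show "(\<Sum>w\<in>V. prb (\<lambda>\<omega>. P v \<omega> \<and> w \<in> ball v \<omega> t)) \<le> real b * prb (P v)" .
  qed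
  also have "(\<Sum>v\<in>V. real b * prb (P v)) = real b * S" by (simp add: S_def sum_distrib_left)
  finally show ?thesis by (simp add: algebra_simps)
qed

text \<open>If no vertex with \<open>P\<close> avoids \<open>F\<close>, the count \<open>X\<close>
  of \<open>P\<close> equals the count \<open>Y\<close> of \<open>P\<close> together with
  \<open>F\<close>. Then \<open>Y\<close> is at least half the mean, unlikely by Markov, or
  \<open>X\<close> is below half the mean, unlikely by Chebyshev. The halves give the factors 2 and
  4.\<close>

lemma exists_avoiding:
  assumes S: "S = (\<Sum>v\<in>V. prb (P v))" "S > 0"
    and sec: "ex (\<lambda>\<omega>. (\<Sum>v\<in>V. of_bool (P v \<omega>)) ^ 2) \<le> (1 + a) * S ^ 2"
    and F: "\<And>v. v \<in> V \<Longrightarrow> prb (\<lambda>\<omega>. P v \<omega> \<and> F v \<omega>) \<le> \<kappa> * prb (P v)"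
  shows "prb (\<lambda>\<omega>. \<not> (\<exists>v\<in>V. P v \<omega> \<and> \<not> F v \<omega>)) \<le> 4 * a + 2 * \<kappa>"
proof -
  let ?X = "\<lambda>\<omega>. \<Sum>v\<in>V. of_bool (P v \<omega>) :: real" and ?Y = "\<lambda>\<omega>. \<Sum>v\<in>V. of_bool (P v \<omega> \<and> F v \<omega>) :: real"
  have EX: "ex ?X = S" unfolding ex_sum S(1) prb_def ..
  have EY: "ex ?Y \<le> \<kappa> * S" using sum_mono[OF F] unfolding ex_sum S(1) prb_def sum_distrib_left .
  have var: "ex (\<lambda>\<omega>. (?X \<omega> - S) ^ 2) \<le> a * S ^ 2"
  proof -
    have "ex (\<lambda>\<omega>. (?X \<omega> - S) ^ 2) = ex (\<lambda>\<omega>. ?X \<omega> ^ 2 + ((- 2 * S) * ?X \<omega> + S ^ 2))"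
      by (intro ex_cong) (simp add: power2_eq_square algebra_simps)
    also have "\<dots> = ex (\<lambda>\<omega>. ?X \<omega> ^ 2) + ((- 2 * S) * ex ?X + S ^ 2)"
      unfolding ex_add ex_cmult ex_const ..
    finally show ?thesis using sec EX by (simp add: power2_eq_square algebra_simps)
  qed
  have "prb (\<lambda>\<omega>. \<not> (\<exists>v\<in>V. P v \<omega> \<and> \<not> F v \<omega>)) \<le> prb (\<lambda>\<omega>. S ^ 2 / 4 \<le> (?X \<omega> - S) ^ 2 \<or> S / 2 \<le> ?Y \<omega>)"
  proof (rule prb_mono)
    fix \<omega> assume "\<not> (\<exists>v\<in>V. P v \<omega> \<and> \<not> F v \<omega>)"
    then have eq: "?X \<omega> = ?Y \<omega>" by (intro sum.cong) auto
    show "S ^ 2 / 4 \<le> (?X \<omega> - S) ^ 2 \<or> S / 2 \<le> ?Y \<omega>"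
    proof (cases "S / 2 \<le> ?Y \<omega>")
      case False
      then have "S / 2 \<le> S - ?X \<omega>" using eq by simp
      then have "(S / 2) ^ 2 \<le> (S - ?X \<omega>) ^ 2" using S(2) by (intro power_mono) auto
      then show ?thesis by (simp add: power_divide power2_commute)
    qed simp
  qed
  also have "\<dots> \<le> prb (\<lambda>\<omega>. S ^ 2 / 4 \<le> (?X \<omega> - S) ^ 2) + prb (\<lambda>\<omega>. S / 2 \<le> ?Y \<omega>)" by (rule prb_disj)
  also have "prb (\<lambda>\<omega>. S ^ 2 / 4 \<le> (?X \<omega> - S) ^ 2) \<le> ex (\<lambda>\<omega>. (?X \<omega> - S) ^ 2) / (S ^ 2 / 4)"
    using S(2) by (intro markov_ineq) auto
  also have "\<dots> \<le> a * S ^ 2 / (S ^ 2 / 4)" using var S(2) by (intro divide_right_mono) auto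
  also have "prb (\<lambda>\<omega>. S / 2 \<le> ?Y \<omega>) \<le> ex ?Y / (S / 2)"
    using S(2) by (intro markov_ineq) (auto intro: sum_nonneg)
  also have "\<dots> \<le> \<kappa> * S / (S / 2)" using EY S(2) by (intro divide_right_mono) auto
  finally show ?thesis using S(2) by simp
qed

section \<open>Thin explorations that later grow\<close>

text \<open>Expresses \<open>hit\<close> by the numbers \<open>free\<close> and \<open>layer\<close>
  alone, so that lower bounds for one step can be prepared for abstract sizes.\<close>

lemma hit_free_layer:
  assumes "v \<in> V"
  shows "hit v \<omega> k = 1 - (real (free v \<omega> k) / real (free v \<omega> k + layer v \<omega> k)) ^ r"
  using free_layer[OF assms, of \<omega> k] by (simp add: hit_def)

lemma thin_Suc: "thin v K (Suc t) \<omega> \<longleftrightarrow> thin v K t \<omega> \<and> 1 \<le> layer v \<omega> (Suc t) \<and> layer v \<omega> (Suc t) \<le> K"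
  by (auto simp: thin_def le_Suc_eq)

lemma thin_free:
  assumes "v \<in> V" "thin v K t \<omega>" "N + Suc t * K \<le> n"
  shows "N \<le> free v \<omega> t"
  using thin_card_ball[OF assms(1,2)] assms(3) by (simp add: free_def)

text \<open>\<open>z * q ^ z\<close> is almost an eigenfunction of one step even when sizes are cut
  off at \<open>K\<close>, so the moment keeps at least the factor \<open>a\<close> per step. The
  hypothesis \<open>H\<close> is to be supplied by the Poisson limit.\<close>

lemma thin_moment_lower:
  assumes v: "v \<in> V" and q: "0 \<le> q" and a: "0 \<le> a" and K: "1 \<le> K"
    and H: "\<And>z N. 1 \<le> z \<Longrightarrow> z \<le> K \<Longrightarrow> N\<^sub>0 \<le> N \<Longrightarrow> a * (real z * q ^ z) \<le>
      binex N (1 - (real N / real (N + z)) ^ r) (\<lambda>j. of_bool (1 \<le> j \<and> j \<le> K) * (real j * q ^ j))"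
    and size: "N\<^sub>0 + Suc t * K \<le> n"
  shows "a ^ t * q \<le> ex (\<lambda>\<omega>. of_bool (thin v K t \<omega>) * (real (layer v \<omega> t) * q ^ layer v \<omega> t))"
  using size
proof (induction t)
  case 0
  have "q = ex (\<lambda>_. q)" by (simp add: ex_const)
  also have "\<dots> \<le> ex (\<lambda>\<omega>. of_bool (thin v K 0 \<omega>) * (real (layer v \<omega> 0) * q ^ layer v \<omega> 0))"
    using K by (intro ex_mono) (simp add: thin_def layer_0[OF v])
  finally show ?case by simp
next
  case (Suc t)
  let ?g = "\<lambda>j. of_bool (1 \<le> j \<and> j \<le> K) * (real j * q ^ j)"
  have "a ^ Suc t * q \<le> a * ex (\<lambda>\<omega>. of_bool (thin v K t \<omega>) * (real (layer v \<omega> t) * q ^ layer v \<omega> t))"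
    using Suc a by (simp add: mult_left_mono mult.assoc)
  also have "\<dots> = ex (\<lambda>\<omega>. a * (of_bool (thin v K t \<omega>) * (real (layer v \<omega> t) * q ^ layer v \<omega> t)))"
    by (rule ex_cmult[symmetric])
  also have "\<dots> \<le> ex (\<lambda>\<omega>. binex (free v \<omega> t) (hit v \<omega> t) (\<lambda>j. of_bool (thin v K t \<omega>) * ?g j))"
  proof (rule ex_mono)
    fix \<omega>
    show "a * (of_bool (thin v K t \<omega>) * (real (layer v \<omega> t) * q ^ layer v \<omega> t)) \<le>
      binex (free v \<omega> t) (hit v \<omega> t) (\<lambda>j. of_bool (thin v K t \<omega>) * ?g j)"
    proof (cases "thin v K t \<omega>")
      case True
      have z: "1 \<le> layer v \<omega> t" "layer v \<omega> t \<le> K" using True by (auto simp: thin_def)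
      have "N\<^sub>0 \<le> free v \<omega> t" using Suc.prems by (intro thin_free[OF v True]) simp
      from H[OF z this] show ?thesis using True by (simp add: hit_free_layer[OF v])
    qed (simp add: binex_const)
  qed
  also have "\<dots> = ex (\<lambda>\<omega>. of_bool (thin v K t \<omega>) * ?g (layer v \<omega> (Suc t)))"
    using determined_compose[OF determined_thin[of t t v K, OF order_refl], of "\<lambda>b j. of_bool b * ?g j"]
    by (intro tower[OF v, symmetric])
  also have "\<dots> = ex (\<lambda>\<omega>. of_bool (thin v K (Suc t) \<omega>) * (real (layer v \<omega> (Suc t)) * q ^ layer v \<omega> (Suc t)))"
    by (intro ex_cong) (simp add: thin_Suc)
  finally show ?case .
qed

lemma determined_conj:
  assumes "determined v k P" "determined v k Q"
  shows "determined v k (\<lambda>\<omega>. P \<omega> \<and> Q \<omega>)"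
  unfolding determined_def
proof (intro ballI impI)
  fix \<omega> \<omega>' assume "\<omega> \<in> \<Omega>" "\<omega>' \<in> \<Omega>" "\<forall>i\<le>k. ball v \<omega> i = ball v \<omega>' i"
  then have "P \<omega> = P \<omega>'" "Q \<omega> = Q \<omega>'" using assms unfolding determined_def by blast+
  then show "(P \<omega> \<and> Q \<omega>) = (P \<omega>' \<and> Q \<omega>')" by simp
qed

text \<open>Ending at size exactly \<open>K\<close> gives the later growth a start that rarely
  fails, while the means of later layers stay proportional to \<open>K\<close>.\<close>

definition core :: "nat \<Rightarrow> nat \<Rightarrow> nat \<Rightarrow> (nat \<Rightarrow> nat \<Rightarrow> nat) \<Rightarrow> bool" where
  "core v K t \<omega> \<longleftrightarrow> thin v K t \<omega> \<and> layer v \<omega> t = K"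

lemma determined_core: "t \<le> k \<Longrightarrow> determined v k (core v K t)"
  unfolding core_def
  by (intro determined_conj determined_thin determined_compose[OF determined_layer, of t k v "\<lambda>z. z = K"])

text \<open>The moment weight is at most \<open>K\<close>, so the moment bounds the probability of a
  thin history from below; one further step, at the constant cost \<open>c\<close>, brings the layer
  to exactly \<open>K\<close>.\<close>

lemma prb_core_lower:
  assumes v: "v \<in> V" and q: "0 \<le> q" "q \<le> 1" and a: "0 \<le> a" and c: "0 \<le> c" and K: "1 \<le> K"
    and H: "\<And>z N. 1 \<le> z \<Longrightarrow> z \<le> K \<Longrightarrow> N\<^sub>0 \<le> N \<Longrightarrow> a * (real z * q ^ z) \<le>
      binex N (1 - (real N / real (N + z)) ^ r) (\<lambda>j. of_bool (1 \<le> j \<and> j \<le> K) * (real j * q ^ j))"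
    and H': "\<And>z N. 1 \<le> z \<Longrightarrow> z \<le> K \<Longrightarrow> N\<^sub>0 \<le> N \<Longrightarrow>
      c \<le> binex N (1 - (real N / real (N + z)) ^ r) (\<lambda>j. of_bool (j = K))"
    and size: "N\<^sub>0 + Suc t * K \<le> n"
  shows "c * (a ^ t * q / real K) \<le> prb (core v K (Suc t))"
proof -
  have "a ^ t * q \<le> ex (\<lambda>\<omega>. of_bool (thin v K t \<omega>) * (real (layer v \<omega> t) * q ^ layer v \<omega> t))"
    by (rule thin_moment_lower[OF v q(1) a K H size])
  also have "\<dots> \<le> ex (\<lambda>\<omega>. real K * of_bool (thin v K t \<omega>))"
  proof (rule ex_mono)
    fix \<omega>
    have "real (layer v \<omega> t) * q ^ layer v \<omega> t \<le> real K * 1" if "thin v K t \<omega>"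
      using that q by (intro mult_mono power_le_one) (auto simp: thin_def)
    then show "of_bool (thin v K t \<omega>) * (real (layer v \<omega> t) * q ^ layer v \<omega> t) \<le> real K * of_bool (thin v K t \<omega>)"
      by simp
  qed
  also have "\<dots> = real K * prb (thin v K t)" by (simp add: ex_cmult prb_def)
  finally have "a ^ t * q / real K \<le> prb (thin v K t)" using K by (simp add: divide_le_eq mult.commute)
  then have "c * (a ^ t * q / real K) \<le> c * prb (thin v K t)" using c by (rule mult_left_mono)
  also have "\<dots> = ex (\<lambda>\<omega>. c * of_bool (thin v K t \<omega>))" by (simp add: ex_cmult prb_def)
  also have "\<dots> \<le> ex (\<lambda>\<omega>. binex (free v \<omega> t) (hit v \<omega> t) (\<lambda>j. of_bool (thin v K t \<omega>) * of_bool (j = K)))"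
  proof (rule ex_mono)
    fix \<omega>
    show "c * of_bool (thin v K t \<omega>) \<le> binex (free v \<omega> t) (hit v \<omega> t) (\<lambda>j. of_bool (thin v K t \<omega>) * of_bool (j = K))"
    proof (cases "thin v K t \<omega>")
      case True
      have z: "1 \<le> layer v \<omega> t" "layer v \<omega> t \<le> K" using True by (auto simp: thin_def)
      from H'[OF z thin_free[OF v True size]] show ?thesis using True by (simp add: hit_free_layer[OF v])
    qed (simp add: binex_const)
  qed
  also have "\<dots> = ex (\<lambda>\<omega>. of_bool (thin v K t \<omega>) * of_bool (layer v \<omega> (Suc t) = K))"
    using determined_compose[OF determined_thin[of t t v K, OF order_refl], of "\<lambda>b j. of_bool b * of_bool (j = K)"]
    by (intro tower[OF v, symmetric])
  also have "\<dots> = prb (core v K (Suc t))"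
    unfolding prb_def using K by (intro ex_cong) (auto simp: core_def thin_Suc)
  finally show ?thesis .
qed

section \<open>Growth after the thin phase\<close>

definition climbing :: "real \<Rightarrow> nat \<Rightarrow> nat \<Rightarrow> nat \<Rightarrow> nat \<Rightarrow> nat \<Rightarrow> (nat \<Rightarrow> nat \<Rightarrow> nat) \<Rightarrow> bool" where
  "climbing \<kappa> K B v t i \<omega> \<longleftrightarrow> (\<forall>l\<le>i. \<kappa> ^ l * real K \<le> real (layer v \<omega> (t + l)) \<and> layer v \<omega> (t + l) \<le> B)"

text \<open>A failure counts only while the layers have climbed geometrically and stayed below
  \<open>B\<close>: the former makes late failures doubly exponentially unlikely, the latter keeps
  the ball small enough for \<open>growth_step\<close>.\<close>

definition stalls :: "real \<Rightarrow> nat \<Rightarrow> nat \<Rightarrow> nat \<Rightarrow> nat \<Rightarrow> nat \<Rightarrow> (nat \<Rightarrow> nat \<Rightarrow> nat) \<Rightarrow> bool" where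
  "stalls \<kappa> K B v t s \<omega> \<longleftrightarrow> (\<exists>i\<in>{..<s}. climbing \<kappa> K B v t i \<omega> \<and>
     real (layer v \<omega> (Suc (t + i))) < \<kappa> * real (layer v \<omega> (t + i)))"

lemma determined_climbing: "determined v (t + i) (climbing \<kappa> K B v t i)"
proof (rule determined_balls)
  fix \<omega> \<omega>' assume "\<forall>l\<le>t + i. layer v \<omega> l = layer v \<omega>' l"
  then have "\<forall>l\<le>i. layer v \<omega> (t + l) = layer v \<omega>' (t + l)" by auto
  then show "climbing \<kappa> K B v t i \<omega> = climbing \<kappa> K B v t i \<omega>'" by (simp add: climbing_def)
qed

lemma card_ball_climbing:
  assumes v: "v \<in> V" and "core v K t \<omega>" "climbing \<kappa> K B v t i \<omega>"
  shows "card (ball v \<omega> (t + i)) \<le> Suc t * K + i * B"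
  using assms(3)
proof (induction i)
  case 0
  then show ?case using thin_card_ball[OF v] assms(2) by (simp add: core_def)
next
  case (Suc i)
  then have "climbing \<kappa> K B v t i \<omega>" "layer v \<omega> (t + Suc i) \<le> B" unfolding climbing_def by auto
  then show ?case using Suc.IH card_ball_Suc[OF v, of \<omega> "t + i"] by simp
qed

text \<open>Bernoulli gives \<open>\<kappa> ^ i \<ge> 1 + i / 2\<close>, so a geometric series with
  ratio \<open>exp (- (y / 2))\<close> dominates.\<close>

lemma sum_exp_powers:
  fixes \<kappa> y :: real
  assumes \<kappa>: "3 / 2 \<le> \<kappa>" and y: "0 < y"
  shows "(\<Sum>i<s. exp (- (\<kappa> ^ i * y))) \<le> exp (- y) / (1 - exp (- (y / 2)))"
proof -
  let ?x = "exp (- (y / 2))"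
  have x: "0 < ?x" "?x < 1" using y by auto
  have "(\<Sum>i<s. exp (- (\<kappa> ^ i * y))) \<le> (\<Sum>i<s. exp (- y) * ?x ^ i)"
  proof (rule sum_mono)
    fix i
    have "1 + real i * (1 / 2) \<le> (1 + 1 / 2) ^ i" by (rule Bernoulli_inequality) simp
    also have "\<dots> \<le> \<kappa> ^ i" using \<kappa> by (intro power_mono) auto
    finally have "(1 + real i * (1 / 2)) * y \<le> \<kappa> ^ i * y" using y by (intro mult_right_mono) auto
    then have "exp (- (\<kappa> ^ i * y)) \<le> exp (- y + real i * (- (y / 2)))" by (simp add: algebra_simps)
    also have "\<dots> = exp (- y) * ?x ^ i" unfolding exp_add exp_of_nat_mult ..
    finally show "exp (- (\<kappa> ^ i * y)) \<le> exp (- y) * ?x ^ i" .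
  qed
  also have "\<dots> = exp (- y) * ((1 - ?x ^ s) / (1 - ?x))"
    using x by (simp add: sum_distrib_left[symmetric] sum_gp_strict)
  also have "\<dots> \<le> exp (- y) * (1 / (1 - ?x))" using x by (intro mult_left_mono divide_right_mono) auto
  finally show ?thesis by simp
qed

text \<open>The bound is relative to \<open>prb (core v K t)\<close>, thus a conditional
  probability, and its factor depends on \<open>\<delta>\<close> and \<open>K\<close> alone: a large
  constant \<open>K\<close> makes it small for all \<open>n\<close> and all numbers of steps
  \<open>s\<close> within the size limit.\<close>

lemma prb_core_stalls:
  assumes v: "v \<in> V" and \<delta>: "0 < \<delta>" "\<delta> \<le> 1" and \<kappa>: "3 / 2 \<le> (1 - \<delta>) * real r" and K: "1 \<le> K"
    and size: "real (Suc t * K + s * B) \<le> \<delta> / (4 * real r) * real n"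
  shows "prb (\<lambda>\<omega>. core v K t \<omega> \<and> stalls ((1 - \<delta>) * real r) K B v t s \<omega>) \<le>
    exp (- (\<delta> ^ 2 * real K / 8)) / (1 - exp (- (\<delta> ^ 2 * real K / 8 / 2))) * prb (core v K t)"
proof -
  let ?\<kappa> = "(1 - \<delta>) * real r" and ?y = "\<delta> ^ 2 * real K / 8"
  let ?A = "\<lambda>i \<omega>. core v K t \<omega> \<and> climbing ?\<kappa> K B v t i \<omega>"
  let ?Q = "\<lambda>i \<omega> j. real j < ?\<kappa> * real (layer v \<omega> (t + i))"
  have step: "prb (\<lambda>\<omega>. ?A i \<omega> \<and> ?Q i \<omega> (layer v \<omega> (Suc (t + i)))) \<le> exp (- (?\<kappa> ^ i * ?y)) * prb (core v K t)"
    if i: "i < s" for i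
  proof -
    have "prb (\<lambda>\<omega>. ?A i \<omega> \<and> ?Q i \<omega> (layer v \<omega> (Suc (t + i)))) \<le> exp (- (?\<kappa> ^ i * ?y)) * prb (?A i)"
    proof (rule prb_step[OF v])
      show "determined v (t + i) (?A i)"
        by (intro determined_conj determined_core determined_climbing) simp
      show "determined v (t + i) (?Q i)"
        using determined_compose[OF determined_layer[of "t + i" "t + i" v, OF order_refl], of "\<lambda>z j. real j < ?\<kappa> * real z"] .
      fix \<omega> assume A: "?A i \<omega>"
      have z: "?\<kappa> ^ i * real K \<le> real (layer v \<omega> (t + i))" using A by (auto simp: climbing_def)
      have "1 * 1 \<le> ?\<kappa> ^ i * real K" using \<kappa> K by (intro mult_mono one_le_power) auto
      then have z1: "1 \<le> layer v \<omega> (t + i)" using z by simp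
      have "i * B \<le> s * B" using i by (intro mult_right_mono) auto
      then have "card (ball v \<omega> (t + i)) \<le> Suc t * K + s * B"
        using card_ball_climbing[OF v, of K t \<omega> ?\<kappa> B i] A by linarith
      then have "real (card (ball v \<omega> (t + i))) \<le> \<delta> / (4 * real r) * real n" using size by linarith
      from growth_step[OF v \<delta> z1 this]
      have "binex (free v \<omega> (t + i)) (hit v \<omega> (t + i)) (\<lambda>j. of_bool (?Q i \<omega> j)) \<le>
        exp (- (\<delta> ^ 2 * real (layer v \<omega> (t + i)) / 8))" .
      also have "\<dots> \<le> exp (- (?\<kappa> ^ i * ?y))"
        using mult_left_mono[OF z, of "\<delta> ^ 2"] by (simp add: algebra_simps)
      finally show "binex (free v \<omega> (t + i)) (hit v \<omega> (t + i)) (\<lambda>j. of_bool (?Q i \<omega> j)) \<le> exp (- (?\<kappa> ^ i * ?y))" .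
    qed
    also have "\<dots> \<le> exp (- (?\<kappa> ^ i * ?y)) * prb (core v K t)"
      by (intro mult_left_mono prb_mono) auto
    finally show ?thesis .
  qed
  have "prb (\<lambda>\<omega>. core v K t \<omega> \<and> stalls ?\<kappa> K B v t s \<omega>) \<le>
    prb (\<lambda>\<omega>. \<exists>i\<in>{..<s}. ?A i \<omega> \<and> ?Q i \<omega> (layer v \<omega> (Suc (t + i))))"
    by (rule prb_mono) (auto simp: stalls_def)
  also have "\<dots> \<le> (\<Sum>i<s. prb (\<lambda>\<omega>. ?A i \<omega> \<and> ?Q i \<omega> (layer v \<omega> (Suc (t + i)))))"
    by (rule prb_union) simp
  also have "\<dots> \<le> (\<Sum>i<s. exp (- (?\<kappa> ^ i * ?y)) * prb (core v K t))" by (intro sum_mono step) simp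
  also have "\<dots> = (\<Sum>i<s. exp (- (?\<kappa> ^ i * ?y))) * prb (core v K t)" by (rule sum_distrib_right[symmetric])
  also have "\<dots> \<le> exp (- ?y) / (1 - exp (- (?y / 2))) * prb (core v K t)"
    using \<kappa> \<delta> K by (intro mult_right_mono sum_exp_powers prb_nonneg) auto
  finally show ?thesis .
qed

text \<open>This makes a core vertex one of the second kind: passing \<open>B\<close> for the first
  time is what the upper bound turns into covering.\<close>

lemma core_exceeds:
  assumes v: "v \<in> V" and c: "core v K t \<omega>" and ns: "\<not> stalls \<kappa> K B v t s \<omega>"
    and \<kappa>: "0 \<le> \<kappa>" and s: "real B < \<kappa> ^ s * real K"
  obtains k where "k \<le> t + s" "B < layer v \<omega> k" "\<And>i. i < k \<Longrightarrow> layer v \<omega> i \<le> B"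
proof -
  have "\<exists>k. k \<le> t + s \<and> B < layer v \<omega> k"
  proof (rule ccontr)
    assume "\<not> (\<exists>k. k \<le> t + s \<and> B < layer v \<omega> k)"
    then have le: "layer v \<omega> k \<le> B" if "k \<le> t + s" for k using that by force
    have "climbing \<kappa> K B v t i \<omega>" if "i \<le> s" for i
      using that
    proof (induction i)
      case 0 then show ?case using c le[of t] by (simp add: climbing_def core_def)
    next
      case (Suc i)
      then have cl: "climbing \<kappa> K B v t i \<omega>" by simp
      then have "\<kappa> * real (layer v \<omega> (t + i)) \<le> real (layer v \<omega> (Suc (t + i)))"
        using ns Suc.prems by (auto simp: stalls_def not_less)
      moreover have "\<kappa> * (\<kappa> ^ i * real K) \<le> \<kappa> * real (layer v \<omega> (t + i))"
        using cl \<kappa> by (intro mult_left_mono) (auto simp: climbing_def)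
      ultimately have "\<kappa> ^ Suc i * real K \<le> real (layer v \<omega> (t + Suc i))" by simp
      then show ?case using cl le[of "t + Suc i"] Suc.prems by (auto simp: climbing_def le_Suc_eq)
    qed
    from this[of s] have "\<kappa> ^ s * real K \<le> real (layer v \<omega> (t + s))" by (simp add: climbing_def)
    then show False using le[of "t + s"] s by simp
  qed
  then obtain k where k: "k \<le> t + s \<and> B < layer v \<omega> k" "\<And>i. i < k \<Longrightarrow> \<not> (i \<le> t + s \<and> B < layer v \<omega> i)"
    using exists_least_iff[of "\<lambda>k. k \<le> t + s \<and> B < layer v \<omega> k"] by blast
  then have "layer v \<omega> i \<le> B" if "i < k" for i using that k(1) k(2)[OF that] by force
  then show ?thesis using that k(1) by blast
qed

lemma core_layer_mean:
  assumes v: "v \<in> V"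
  shows "ex (\<lambda>\<omega>. of_bool (core v K t \<omega>) * real (layer v \<omega> (t + i))) \<le> real r ^ i * (real K * prb (core v K t))"
proof (induction i)
  case 0
  have "ex (\<lambda>\<omega>. of_bool (core v K t \<omega>) * real (layer v \<omega> t)) = ex (\<lambda>\<omega>. real K * of_bool (core v K t \<omega>))"
    by (intro ex_cong) (auto simp: core_def)
  then show ?case by (simp add: ex_cmult prb_def)
next
  case (Suc i)
  have "ex (\<lambda>\<omega>. of_bool (core v K t \<omega>) * real (layer v \<omega> (Suc (t + i)))) =
    ex (\<lambda>\<omega>. binex (free v \<omega> (t + i)) (hit v \<omega> (t + i)) (\<lambda>j. of_bool (core v K t \<omega>) * real j))"
    using determined_compose[OF determined_core[of t "t + i" v K, OF le_add1], of "\<lambda>b j. of_bool b * real j"]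
    by (intro tower[OF v])
  also have "\<dots> \<le> ex (\<lambda>\<omega>. real r * (of_bool (core v K t \<omega>) * real (layer v \<omega> (t + i))))"
    using mean_upper[OF v, of _ "t + i"] unfolding binex_cmult binex_id by (intro ex_mono) auto
  also have "\<dots> = real r * ex (\<lambda>\<omega>. of_bool (core v K t \<omega>) * real (layer v \<omega> (t + i)))" by (rule ex_cmult)
  also have "\<dots> \<le> real r * (real r ^ i * (real K * prb (core v K t)))" using Suc by (intro mult_left_mono) auto
  finally show ?case by simp
qed

text \<open>Markov's inequality relative to the core, with layers whose means grow at most by
  \<open>r\<close> per step; as \<open>r \<ge> 2\<close>, their geometric sum is at most the next
  power.\<close>

lemma prb_core_large_ball:
  assumes v: "v \<in> V" and y: "0 < y"
  shows "prb (\<lambda>\<omega>. core v K t \<omega> \<and> y \<le> real (card (ball v \<omega> (t + s)))) \<le>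
    (real (Suc t * K) + real K * real r ^ Suc s) / y * prb (core v K t)"
proof -
  let ?f = "\<lambda>\<omega>. of_bool (core v K t \<omega>) * real (card (ball v \<omega> (t + s)))"
  have card: "card (ball v \<omega> (t + s)) = card (ball v \<omega> t) + (\<Sum>i<s. layer v \<omega> (t + Suc i))" for \<omega>
    by (induction s) (simp_all add: card_ball_Suc[OF v] del: ball.simps(2))
  have "ex ?f \<le> ex (\<lambda>\<omega>. real (Suc t * K) * of_bool (core v K t \<omega>) + (\<Sum>i<s. of_bool (core v K t \<omega>) * real (layer v \<omega> (t + Suc i))))"
  proof (rule ex_mono)
    fix \<omega>
    have "real (card (ball v \<omega> t)) \<le> real (Suc t * K)" if "core v K t \<omega>"
      using thin_card_ball[OF v] that unfolding core_def of_nat_le_iff by blast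
    then show "?f \<omega> \<le> real (Suc t * K) * of_bool (core v K t \<omega>) + (\<Sum>i<s. of_bool (core v K t \<omega>) * real (layer v \<omega> (t + Suc i)))"
      unfolding card by (auto simp del: of_nat_mult)
  qed
  also have "\<dots> = real (Suc t * K) * prb (core v K t) + (\<Sum>i<s. ex (\<lambda>\<omega>. of_bool (core v K t \<omega>) * real (layer v \<omega> (t + Suc i))))"
    unfolding ex_add ex_cmult ex_sum prb_def ..
  also have "\<dots> \<le> real (Suc t * K) * prb (core v K t) + (\<Sum>i<s. real r ^ Suc i * (real K * prb (core v K t)))"
    by (intro add_left_mono sum_mono core_layer_mean v)
  also have "\<dots> \<le> real (Suc t * K) * prb (core v K t) + real r ^ Suc s * (real K * prb (core v K t))"
  proof -
    have "(\<Sum>i<s. real r ^ Suc i) \<le> real r ^ Suc s"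
    proof (induction s)
      case (Suc s)
      have "2 * real r ^ Suc s \<le> real r * real r ^ Suc s" using r by (intro mult_right_mono) auto
      then show ?case using Suc by simp
    qed simp
    then have "(\<Sum>i<s. real r ^ Suc i) * (real K * prb (core v K t)) \<le> real r ^ Suc s * (real K * prb (core v K t))"
      by (intro mult_right_mono mult_nonneg_nonneg prb_nonneg) auto
    then show ?thesis by (simp add: sum_distrib_right)
  qed
  also have "\<dots> = (real (Suc t * K) + real K * real r ^ Suc s) * prb (core v K t)" by (simp add: algebra_simps)
  finally have ef: "ex ?f \<le> (real (Suc t * K) + real K * real r ^ Suc s) * prb (core v K t)" .
  have "prb (\<lambda>\<omega>. core v K t \<omega> \<and> y \<le> real (card (ball v \<omega> (t + s)))) \<le> prb (\<lambda>\<omega>. y \<le> ?f \<omega>)"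
    by (rule prb_mono) auto
  also have "\<dots> \<le> ex ?f / y" using y by (intro markov_ineq) auto
  also have "\<dots> \<le> (real (Suc t * K) + real K * real r ^ Suc s) * prb (core v K t) / y"
    using ef y by (intro divide_right_mono) auto
  finally show ?thesis by simp
qed

lemma exists_core:
  assumes \<delta>: "0 < \<delta>" "\<delta> \<le> 1" and \<kappa>: "3 / 2 \<le> (1 - \<delta>) * real r" and K: "1 \<le> K"
    and size: "real (Suc t * K + s * B) \<le> \<delta> / (4 * real r) * real n"
    and y: "0 < y" and b: "Suc t * K \<le> b" "b < n"
    and p: "0 < p" "\<And>v. v \<in> V \<Longrightarrow> p \<le> prb (core v K t)"
  shows "prb (\<lambda>\<omega>. \<not> (\<exists>v\<in>V. core v K t \<omega> \<and>
      \<not> (stalls ((1 - \<delta>) * real r) K B v t s \<omega> \<or> y \<le> real (card (ball v \<omega> (t + s')))))) \<le>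
    4 * (pair_const b - 1 + (real b + real n * real t * (real r * real b ^ 2 / real (n - b) * pair_const b)) / (real n * p)) +
    2 * (exp (- (\<delta> ^ 2 * real K / 8)) / (1 - exp (- (\<delta> ^ 2 * real K / 8 / 2))) +
      (real (Suc t * K) + real K * real r ^ Suc s') / y)"
proof -
  let ?S = "\<Sum>v\<in>V. prb (core v K t)"
  let ?W = "real b + real n * real t * (real r * real b ^ 2 / real (n - b) * pair_const b)"
  have n0: "real n > 0" using n by simp
  have S: "real n * p \<le> ?S" using sum_mono[of V "\<lambda>_. p" "\<lambda>v. prb (core v K t)"] p(2) by simp
  have S0: "0 < ?S" using S p(1) n0 by (smt (verit) mult_pos_pos)
  have W: "0 \<le> ?W" using pair_const_pos[OF b(2)] by simp
  show ?thesis
  proof (rule exists_avoiding[OF refl S0])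
    have "ex (\<lambda>\<omega>. (\<Sum>v\<in>V. of_bool (core v K t \<omega>)) ^ 2) \<le> pair_const b * ?S ^ 2 + ?S * ?W"
    proof (rule second_moment[OF determined_core[OF order_refl] _ b(2)])
      fix v \<omega> assume "v \<in> V" "core v K t \<omega>"
      then show "card (ball v \<omega> t) \<le> b" using thin_card_ball[of v K t \<omega>] b(1) by (simp add: core_def)
    qed
    \<comment> \<open>Terms linear in the mean are divided by its lower bound \<open>n * p\<close>,
      to fit the quadratic form of \<open>exists_avoiding\<close>.\<close>
    also have "?S * ?W \<le> ?W / (real n * p) * ?S ^ 2"
    proof -
      have "real n * p * (?S * ?W) \<le> ?S * (?S * ?W)" using S S0 W by (intro mult_right_mono) auto
      then show ?thesis using n0 p(1) by (simp add: field_simps power2_eq_square)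
    qed
    finally show "ex (\<lambda>\<omega>. (\<Sum>v\<in>V. of_bool (core v K t \<omega>)) ^ 2) \<le> (1 + (pair_const b - 1 + ?W / (real n * p))) * ?S ^ 2"
      by (simp add: algebra_simps)
    fix v assume v: "v \<in> V"
    let ?st = "stalls ((1 - \<delta>) * real r) K B v t s" and ?lb = "\<lambda>\<omega>. y \<le> real (card (ball v \<omega> (t + s')))"
    have "prb (\<lambda>\<omega>. core v K t \<omega> \<and> (?st \<omega> \<or> ?lb \<omega>)) \<le> prb (\<lambda>\<omega>. (core v K t \<omega> \<and> ?st \<omega>) \<or> (core v K t \<omega> \<and> ?lb \<omega>))"
      by (rule prb_mono) auto
    also have "\<dots> \<le> prb (\<lambda>\<omega>. core v K t \<omega> \<and> ?st \<omega>) + prb (\<lambda>\<omega>. core v K t \<omega> \<and> ?lb \<omega>)" by (rule prb_disj)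
    also have "\<dots> \<le> (exp (- (\<delta> ^ 2 * real K / 8)) / (1 - exp (- (\<delta> ^ 2 * real K / 8 / 2))) +
      (real (Suc t * K) + real K * real r ^ Suc s') / y) * prb (core v K t)"
      unfolding distrib_right by (intro add_mono prb_core_stalls prb_core_large_ball v \<delta> \<kappa> K size y)
    finally show "prb (\<lambda>\<omega>. core v K t \<omega> \<and> (?st \<omega> \<or> ?lb \<omega>)) \<le> \<dots>" .
  qed
qed

end

section \<open>The Poisson limit of one exploration step\<close>

text \<open>The value of \<open>hit\<close> with \<open>N\<close> unexplored vertices and a last
  layer of size \<open>z\<close>.\<close>

definition step_prob :: "nat \<Rightarrow> nat \<Rightarrow> nat \<Rightarrow> real" where
  "step_prob r z N = 1 - (real N / real (N + z)) ^ r"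

definition pois :: "real \<Rightarrow> nat \<Rightarrow> real" where
  "pois y j = y ^ j / fact j * exp (- y)"

lemma binomial_ratio_limit: "(\<lambda>N. real (N choose j) / real N ^ j) \<longlonglongrightarrow> 1 / fact j"
proof -
  have "(\<lambda>N. (\<Prod>i<j. (real N - real i) / real N) / fact j) \<longlonglongrightarrow> (\<Prod>i<j. 1) / fact j"
  proof (intro tendsto_divide tendsto_prod tendsto_const)
    fix i show "(\<lambda>N. (real N - real i) / real N) \<longlonglongrightarrow> 1" by real_asymp
  qed simp
  moreover have "real (N choose j) / real N ^ j = (\<Prod>i<j. (real N - real i) / real N) / fact j" for N
  proof -
    have "real (N choose j) = (\<Prod>i<j. real N - real i) / fact j"
      by (simp add: binomial_gbinomial gbinomial_prod_rev lessThan_atLeast0)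
    then show ?thesis by (simp add: prod_dividef)
  qed
  ultimately show ?thesis by simp
qed

lemma step_prob_limits:
  shows "(\<lambda>N. real N * step_prob r z N) \<longlonglongrightarrow> real r * real z"
    and "(\<lambda>N. 1 - step_prob r z N) \<longlonglongrightarrow> 1"
    and "(\<lambda>N. (1 - step_prob r z N) ^ N) \<longlonglongrightarrow> exp (- (real r * real z))"
proof -
  let ?x = "\<lambda>N. real N / real (N + z)"
  have x: "?x \<longlonglongrightarrow> 1" unfolding of_nat_add by real_asymp
  then have "(\<lambda>N. ?x N ^ r) \<longlonglongrightarrow> 1 ^ r" by (rule tendsto_power)
  then show "(\<lambda>N. 1 - step_prob r z N) \<longlonglongrightarrow> 1" by (simp add: step_prob_def)
  have "(\<lambda>N. 1 / (1 + real z / real N) ^ N) \<longlonglongrightarrow> 1 / exp (real z)"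
    by (intro tendsto_divide tendsto_const tendsto_exp_limit_sequentially) simp
  moreover have "\<forall>\<^sub>F N in sequentially. 1 / (1 + real z / real N) ^ N = ?x N ^ N"
    using eventually_gt_at_top[of 0]
  proof eventually_elim
    case (elim N)
    then have "1 + real z / real N = real (N + z) / real N" by (simp add: field_simps)
    then show ?case by (simp add: power_divide)
  qed
  ultimately have "(\<lambda>N. ?x N ^ N) \<longlonglongrightarrow> 1 / exp (real z)" by (rule Lim_transform_eventually)
  then have "(\<lambda>N. (?x N ^ N) ^ r) \<longlonglongrightarrow> (1 / exp (real z)) ^ r" by (rule tendsto_power)
  moreover have "(1 / exp (real z)) ^ r = exp (- (real r * real z))"
    by (simp add: exp_of_nat_mult exp_minus inverse_eq_divide power_divide)
  ultimately show "(\<lambda>N. (1 - step_prob r z N) ^ N) \<longlonglongrightarrow> exp (- (real r * real z))"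
    by (simp add: step_prob_def power_mult[symmetric] mult.commute)
  \<comment> \<open>In this factorisation \<open>N * (1 - ?x N)\<close> tends to \<open>z\<close>,
    and each of the \<open>r\<close> powers tends to 1.\<close>
  have "step_prob r z N = (1 - ?x N) * (\<Sum>i<r. ?x N ^ i)" for N
    using one_diff_power_eq[of "?x N" r] by (simp add: step_prob_def)
  then have eq: "real N * step_prob r z N = (real N * (1 - ?x N)) * (\<Sum>i<r. ?x N ^ i)" for N by simp
  have "(\<lambda>N. real N * (1 - real N / (real N + real z))) \<longlonglongrightarrow> real z"
  proof -
    have "(\<lambda>N. real z * (real N / (real N + real z))) \<longlonglongrightarrow> real z * 1"
      using x by (intro tendsto_mult tendsto_const) simp
    moreover have "\<forall>\<^sub>F N in sequentially. real z * (real N / (real N + real z)) = real N * (1 - real N / (real N + real z))"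
      using eventually_gt_at_top[of 0]
      by eventually_elim (simp add: field_simps)
    ultimately show ?thesis by (auto intro: Lim_transform_eventually)
  qed
  moreover have "(\<lambda>N. \<Sum>i<r. ?x N ^ i) \<longlonglongrightarrow> (\<Sum>i<r. 1 ^ i)"
    by (intro tendsto_sum tendsto_power x)
  ultimately have "(\<lambda>N. (real N * (1 - ?x N)) * (\<Sum>i<r. ?x N ^ i)) \<longlonglongrightarrow> real z * (\<Sum>i<r. 1 ^ i)"
    by (intro tendsto_mult) auto
  then show "(\<lambda>N. real N * step_prob r z N) \<longlonglongrightarrow> real r * real z"
    unfolding eq by (simp add: mult.commute)
qed

lemma binomial_poisson_limit:
  "(\<lambda>N. real (N choose j) * step_prob r z N ^ j * (1 - step_prob r z N) ^ (N - j)) \<longlonglongrightarrow> pois (real r * real z) j"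
proof -
  let ?p = "step_prob r z"
  have "(\<lambda>N. real (N choose j) / real N ^ j * (real N * ?p N) ^ j * ((1 - ?p N) ^ N / (1 - ?p N) ^ j)) \<longlonglongrightarrow>
    1 / fact j * (real r * real z) ^ j * (exp (- (real r * real z)) / 1 ^ j)"
    by (intro tendsto_mult tendsto_divide tendsto_power binomial_ratio_limit step_prob_limits) simp
  moreover have "\<forall>\<^sub>F N in sequentially. real (N choose j) / real N ^ j * (real N * ?p N) ^ j * ((1 - ?p N) ^ N / (1 - ?p N) ^ j) =
    real (N choose j) * ?p N ^ j * (1 - ?p N) ^ (N - j)"
    \<comment> \<open>\<open>N \<ge> 1\<close> keeps \<open>1 - ?p N\<close> nonzero, and
      \<open>N \<ge> j\<close> makes the difference in the exponent exact.\<close>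
    using eventually_ge_at_top[of "max 1 j"]
  proof eventually_elim
    case (elim N)
    then have "1 - ?p N \<noteq> 0" by (simp add: step_prob_def)
    then have "(1 - ?p N) ^ N / (1 - ?p N) ^ j = (1 - ?p N) ^ (N - j)"
      using elim by (subst power_diff) auto
    then show ?case using elim by (simp add: power_mult_distrib)
  qed
  ultimately show ?thesis
    by (auto simp: pois_def intro: Lim_transform_eventually)
qed

text \<open>Truncation leaves a fixed number of terms, so termwise convergence suffices.\<close>

lemma binex_poisson_limit:
  assumes "\<And>j. j > K \<Longrightarrow> g j = 0"
  shows "(\<lambda>N. binex N (step_prob r z N) g) \<longlonglongrightarrow> (\<Sum>j\<le>K. pois (real r * real z) j * g j)"
proof -
  have "(\<lambda>N. \<Sum>j\<le>K. real (N choose j) * step_prob r z N ^ j * (1 - step_prob r z N) ^ (N - j) * g j) \<longlonglongrightarrow>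
    (\<Sum>j\<le>K. pois (real r * real z) j * g j)"
    by (intro tendsto_sum tendsto_mult_right binomial_poisson_limit)
  moreover have "\<forall>\<^sub>F N in sequentially. (\<Sum>j\<le>K. real (N choose j) * step_prob r z N ^ j * (1 - step_prob r z N) ^ (N - j) * g j) =
    binex N (step_prob r z N) g"
    using eventually_ge_at_top[of K]
  proof eventually_elim
    case (elim N)
    then show ?case unfolding binex_def
      by (intro sum.mono_neutral_left) (auto simp: assms)
  qed
  ultimately show ?thesis by (rule Lim_transform_eventually)
qed

text \<open>Chernoff's bound with tilt \<open>1 / \<rho>\<close>; the resulting exponent increases
  with \<open>y\<close>, so the worst case is \<open>y = \<rho> * K\<close>.\<close>

lemma poisson_tail:
  fixes \<rho> y :: real
  assumes \<rho>: "0 < \<rho>" "\<rho> < 1" and y: "0 \<le> y" "y \<le> \<rho> * real K"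
  shows "1 - (\<rho> * exp (1 - \<rho>)) ^ K \<le> (\<Sum>i<K. pois y i)"
proof -
  let ?f = "\<lambda>i. y ^ i / fact i" and ?g = "\<lambda>i. \<rho> ^ K * ((y / \<rho>) ^ i / fact i)"
  have exp_sums: "(\<lambda>i. x ^ i / fact i) sums exp x" for x :: real
    using exp_converges[of x] by (simp add: divide_inverse mult.commute)
  have sf: "summable ?f" using exp_sums[of y] by (rule sums_summable)
  have sg: "summable ?g" by (intro summable_mult sums_summable[OF exp_sums])
  have "exp y - (\<Sum>i<K. ?f i) = (\<Sum>i. ?f (i + K))"
    using suminf_split_initial_segment[OF sf, of K] exp_sums[of y] by (simp add: sums_iff)
  also have "\<dots> \<le> (\<Sum>i. ?g (i + K))"
  proof (rule suminf_le)
    fix i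
    have "?f (i + K) \<le> y ^ (i + K) / fact (i + K) * (1 / \<rho>) ^ i"
    proof -
      have "1 \<le> (1 / \<rho>) ^ i" using \<rho> by (intro one_le_power) simp
      then have "y ^ (i + K) / fact (i + K) * 1 \<le> y ^ (i + K) / fact (i + K) * (1 / \<rho>) ^ i"
        using y by (intro mult_left_mono) auto
      then show ?thesis by simp
    qed
    also have "\<dots> = ?g (i + K)" using \<rho> by (simp add: power_add power_divide field_simps)
    finally show "?f (i + K) \<le> ?g (i + K)" .
  qed (rule summable_ignore_initial_segment, fact)+
  also have "\<dots> \<le> suminf ?g"
    using suminf_split_initial_segment[OF sg, of K] \<rho> y
    by (simp add: sum_nonneg)
  also have "suminf ?g = \<rho> ^ K * exp (y / \<rho>)"
    using sums_mult[OF exp_sums[of "y / \<rho>"], of "\<rho> ^ K"] by (simp add: sums_iff)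
  finally have t: "exp y - (\<Sum>i<K. ?f i) \<le> \<rho> ^ K * exp (y / \<rho>)" .
  have "1 - (\<Sum>i<K. pois y i) = exp (- y) * (exp y - (\<Sum>i<K. ?f i))"
  proof -
    have "(\<Sum>i<K. pois y i) = exp (- y) * (\<Sum>i<K. ?f i)" by (simp add: pois_def sum_distrib_left mult.commute)
    moreover have "exp (- y) * exp y = 1" by (simp flip: exp_add)
    ultimately show ?thesis by (simp add: right_diff_distrib)
  qed
  also have "\<dots> \<le> exp (- y) * (\<rho> ^ K * exp (y / \<rho>))" using t by (intro mult_left_mono) auto
  also have "\<dots> = \<rho> ^ K * exp (y * (1 / \<rho> - 1))" by (simp add: exp_diff exp_minus field_simps)
  also have "\<dots> \<le> \<rho> ^ K * exp (\<rho> * real K * (1 / \<rho> - 1))"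
    using \<rho> y by (intro mult_left_mono iffD2[OF exp_le_cancel_iff] mult_right_mono) auto
  also have "\<rho> * real K * (1 / \<rho> - 1) = real K * (1 - \<rho>)" using \<rho> by (simp add: field_simps)
  also have "\<rho> ^ K * exp (real K * (1 - \<rho>)) = (\<rho> * exp (1 - \<rho>)) ^ K"
    by (simp add: power_mult_distrib exp_of_nat_mult)
  finally show ?thesis by linarith
qed

text \<open>The function \<open>z \<mapsto> z q\<^sup>z\<close> is an eigenfunction of the Poisson step, with eigenvalue \<open>r q\<close>.\<close>

lemma poisson_eigen:
  assumes r: "r \<ge> 2"
  defines "q \<equiv> ext_prob r"
  shows "(\<Sum>j\<le>K. pois (real r * real z) j * (of_bool (1 \<le> j \<and> j \<le> K) * (real j * q ^ j))) =
    real r * q * (real z * q ^ z) * (\<Sum>i<K. pois (real r * q * real z) i)"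
proof (cases K)
  case (Suc m)
  let ?w = "real r * real z"
  have e: "exp (- ?w) = q ^ z * exp (- (q * ?w))"
  proof -
    have "q ^ z = exp (- (real r * (1 - q))) ^ z" using ext_prob_fixed[OF r] by (simp add: q_def ext_gf_def)
    also have "\<dots> = exp (real z * - (real r * (1 - q)))" by (rule exp_of_nat_mult[symmetric])
    finally have "q ^ z * exp (- (q * ?w)) = exp (real z * - (real r * (1 - q)) + - (q * ?w))" by (simp only: exp_add)
    then show ?thesis by (simp add: algebra_simps)
  qed
  have "(\<Sum>j\<le>K. pois ?w j * (of_bool (1 \<le> j \<and> j \<le> K) * (real j * q ^ j))) =
    (\<Sum>j\<le>Suc m. pois ?w j * (real j * q ^ j))"
    unfolding Suc by (intro sum.cong) auto
  also have "\<dots> = (\<Sum>j\<le>m. pois ?w (Suc j) * (real (Suc j) * q ^ Suc j))"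
    by (subst sum.atMost_Suc_shift) simp
  also have "\<dots> = (\<Sum>j\<le>m. (real r * q * (real z * q ^ z)) * pois (q * ?w) j)"
  proof (intro sum.cong refl)
    fix j
    have "pois ?w (Suc j) * real (Suc j) = ?w * (?w ^ j / fact j) * exp (- ?w)"
      by (simp add: pois_def field_simps del: of_nat_Suc)
    then have "pois ?w (Suc j) * (real (Suc j) * q ^ Suc j) = ?w * (?w ^ j / fact j) * exp (- ?w) * q ^ Suc j"
      by (simp only: mult.assoc[symmetric])
    also have "\<dots> = (real r * q * (real z * q ^ z)) * pois (q * ?w) j"
      unfolding e by (simp add: pois_def power_mult_distrib)
    finally show "pois ?w (Suc j) * (real (Suc j) * q ^ Suc j) = (real r * q * (real z * q ^ z)) * pois (q * ?w) j" .
  qed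
  also have "\<dots> = (real r * q * (real z * q ^ z)) * (\<Sum>i<K. pois (q * ?w) i)"
    unfolding Suc lessThan_Suc_atMost sum_distrib_left ..
  finally show ?thesis by (simp add: mult_ac)
qed simp

text \<open>In the eigenfunction identity, truncation removes a tail of a Poisson law with mean at
  most \<open>\<rho> * K\<close>, where \<open>\<rho> < 1\<close>; its probability decays
  geometrically in \<open>K\<close>, uniformly in \<open>z\<close>. So \<open>K\<close> is fixed
  first, and \<open>N\<^sub>0\<close> then comes from finitely many limits.\<close>

lemma truncated_eigen:
  assumes r: "r \<ge> 2" and a: "0 < a" "a < real r * ext_prob r"
  shows "\<forall>\<^sub>F K in sequentially. \<forall>\<^sub>F N\<^sub>0 in sequentially. \<forall>z N. 1 \<le> z \<longrightarrow> z \<le> K \<longrightarrow> N\<^sub>0 \<le> N \<longrightarrow>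
    a * (real z * ext_prob r ^ z) \<le> binex N (step_prob r z N) (\<lambda>j. of_bool (1 \<le> j \<and> j \<le> K) * (real j * ext_prob r ^ j))"
proof -
  let ?q = "ext_prob r"
  define \<rho> where "\<rho> = real r * ?q"
  have q: "0 < ?q" by (rule ext_prob_pos[OF r])
  have \<rho>: "0 < \<rho>" "\<rho> < 1" using mean_ext_less_1[OF r] q r by (auto simp: \<rho>_def)
  have b1: "\<rho> * exp (1 - \<rho>) < 1"
  proof -
    have "ln \<rho> < \<rho> - 1" using ln_le_minus_one[OF \<rho>(1)] ln_eq_minus_one[OF \<rho>(1)] \<rho>(2) by fastforce
    then have "\<rho> < exp (\<rho> - 1)" using \<rho>(1) by (metis exp_less_cancel_iff exp_ln)
    then have "\<rho> * exp (1 - \<rho>) < exp (\<rho> - 1) * exp (1 - \<rho>)" by (intro mult_strict_right_mono) auto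
    then show ?thesis by (simp add: exp_add[symmetric])
  qed
  have "(\<lambda>K. \<rho> * (1 - (\<rho> * exp (1 - \<rho>)) ^ K)) \<longlonglongrightarrow> \<rho> * (1 - 0)"
    using b1 \<rho> by (intro tendsto_intros LIMSEQ_power_zero) auto
  then have "\<forall>\<^sub>F K in sequentially. a < \<rho> * (1 - (\<rho> * exp (1 - \<rho>)) ^ K)"
    using a(2) by (intro order_tendstoD) (auto simp: \<rho>_def)
  then show ?thesis
  proof eventually_elim
    case (elim K)
    let ?g = "\<lambda>j. of_bool (1 \<le> j \<and> j \<le> K) * (real j * ?q ^ j)"
    have "\<forall>\<^sub>F N in sequentially. a * (real z * ?q ^ z) \<le> binex N (step_prob r z N) ?g" if z: "z \<in> {1..K}" for z
    proof -
      have zq: "0 < real z * ?q ^ z" using z q by simp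
      have "a * (real z * ?q ^ z) < \<rho> * (1 - (\<rho> * exp (1 - \<rho>)) ^ K) * (real z * ?q ^ z)"
        using elim zq by (rule mult_strict_right_mono)
      also have "\<dots> \<le> \<rho> * (\<Sum>i<K. pois (\<rho> * real z) i) * (real z * ?q ^ z)"
        using \<rho> z zq by (intro mult_right_mono mult_left_mono poisson_tail) auto
      also have "\<dots> = (\<Sum>j\<le>K. pois (real r * real z) j * ?g j)"
        unfolding poisson_eigen[OF r] by (simp add: \<rho>_def)
      finally have "a * (real z * ?q ^ z) < (\<Sum>j\<le>K. pois (real r * real z) j * ?g j)" .
      with order_tendstoD(1)[OF binex_poisson_limit[of K ?g r z]]
      have "\<forall>\<^sub>F N in sequentially. a * (real z * ?q ^ z) < binex N (step_prob r z N) ?g" by simp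
      then show ?thesis by (rule eventually_mono) simp
    qed
    then have "\<forall>\<^sub>F N in sequentially. \<forall>z\<in>{1..K}. a * (real z * ?q ^ z) \<le> binex N (step_prob r z N) ?g"
      by (intro eventually_ball_finite) auto
    then obtain N\<^sub>1 where N1: "\<And>N z. N\<^sub>1 \<le> N \<Longrightarrow> z \<in> {1..K} \<Longrightarrow> a * (real z * ?q ^ z) \<le> binex N (step_prob r z N) ?g"
      unfolding eventually_sequentially by blast
    show ?case using eventually_ge_at_top[of N\<^sub>1]
      by eventually_elim (use N1 in auto)
  qed
qed

lemma step_point_lower:
  assumes r: "r \<ge> 1" and K: "K \<ge> 1"
  obtains c where "0 < c" "\<forall>\<^sub>F N\<^sub>0 in sequentially. \<forall>z N. 1 \<le> z \<longrightarrow> z \<le> K \<longrightarrow> N\<^sub>0 \<le> N \<longrightarrow>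
    c \<le> binex N (step_prob r z N) (\<lambda>j. of_bool (j = K))"
proof -
  \<comment> \<open>Half of a lower bound for the Poisson weight at \<open>K\<close>, valid since
    \<open>r * z\<close> lies between 1 and \<open>r * K\<close>; the half leaves the strict
    inequality needed to pass from the limit to large \<open>N\<close>.\<close>
  define c where "c = exp (- (real r * real K)) / (2 * fact K)"
  have "\<forall>\<^sub>F N in sequentially. c \<le> binex N (step_prob r z N) (\<lambda>j. of_bool (j = K))" if z: "z \<in> {1..K}" for z
  proof -
    have lim: "(\<Sum>j\<le>K. pois (real r * real z) j * of_bool (j = K)) = pois (real r * real z) K"
      by (subst sum.mono_neutral_cong_right[of "{..K}" "{K}"]) auto
    have "1 * 1 \<le> real r * real z" using r z by (intro mult_mono) auto
    then have "1 * exp (- (real r * real K)) / (2 * fact K) < (real r * real z) ^ K * exp (- (real r * real z)) / fact K"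
      using z by (intro frac_less2 mult_mono one_le_power) (auto intro!: mult_left_mono)
    then have "c < pois (real r * real z) K" by (simp add: c_def pois_def)
    with order_tendstoD(1)[OF binex_poisson_limit[of K "\<lambda>j. of_bool (j = K)" r z]] lim
    have "\<forall>\<^sub>F N in sequentially. c < binex N (step_prob r z N) (\<lambda>j. of_bool (j = K))" by simp
    then show ?thesis by (rule eventually_mono) simp
  qed
  then have "\<forall>\<^sub>F N in sequentially. \<forall>z\<in>{1..K}. c \<le> binex N (step_prob r z N) (\<lambda>j. of_bool (j = K))"
    by (intro eventually_ball_finite) auto
  then obtain N\<^sub>1 where N1: "\<And>N z. N\<^sub>1 \<le> N \<Longrightarrow> z \<in> {1..K} \<Longrightarrow> c \<le> binex N (step_prob r z N) (\<lambda>j. of_bool (j = K))"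
    unfolding eventually_sequentially by blast
  have "\<forall>\<^sub>F N\<^sub>0 in sequentially. \<forall>z N. 1 \<le> z \<longrightarrow> z \<le> K \<longrightarrow> N\<^sub>0 \<le> N \<longrightarrow>
    c \<le> binex N (step_prob r z N) (\<lambda>j. of_bool (j = K))"
    using eventually_ge_at_top[of N\<^sub>1] by eventually_elim (use N1 in auto)
  moreover have "0 < c" by (simp add: c_def)
  ultimately show ?thesis using that by blast
qed

section \<open>The event behind the upper bound\<close>

context rout
begin

text \<open>The last clause speaks of the first layer above \<open>K\<close>, because up to that
  moment few vertices have been explored and growth can be guaranteed from there.\<close>

definition upper_event :: "nat \<Rightarrow> nat \<Rightarrow> nat \<Rightarrow> (nat \<Rightarrow> nat \<Rightarrow> nat) \<Rightarrow> bool" where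
  "upper_event K t A \<omega> \<longleftrightarrow> expanding \<omega> \<and> (\<forall>v\<in>V. \<not> thin v K t \<omega> \<and>
     (\<forall>k\<le>t. K < layer v \<omega> k \<longrightarrow> (\<forall>i<k. layer v \<omega> i \<le> K) \<longrightarrow> V \<subseteq> ball v \<omega> A))"

lemma prb_not_upper_event:
  assumes \<delta>: "0 < \<delta>" "\<delta> \<le> 1" and \<kappa>: "3 / 2 \<le> (1 - \<delta>) * real r"
    and h: "real n \<le> ((1 - \<delta>) * real r) ^ h * real K" and small: "real (t * K) \<le> \<delta> / (8 * real r) * real n"
    and I: "(1 - \<delta> / (48 * real r)) ^ (I * I) * real n \<le> g" and g: "3000 * g \<le> real n" "g < (3 / 2) ^ u"
    and p: "\<And>v. v \<in> V \<Longrightarrow> prb (thin v K t) \<le> p"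
  shows "prb (\<lambda>\<omega>. \<not> upper_event K t (t + h + 2 * I + u) \<omega>) \<le> 24 * real n powr (- 1 / 3) +
    real n * real (t + h + 2 * I) * (exp (- (\<delta> ^ 2 * real K / 8)) + exp (- ((\<delta> / (24 * real r)) ^ 2 * g / 32))) +
    real n * p"
proof -
  let ?A = "t + h + 2 * I + u" and ?H = "t + h + 2 * I"
  have "prb (\<lambda>\<omega>. \<not> upper_event K t ?A \<omega>) \<le> prb (\<lambda>\<omega>. \<not> good \<delta> K g ?H \<omega> \<or> (\<exists>v\<in>V. thin v K t \<omega>))"
  proof (rule prb_mono, rule ccontr)
    fix \<omega> assume w: "\<omega> \<in> \<Omega>" and nu: "\<not> upper_event K t ?A \<omega>" and "\<not> (\<not> good \<delta> K g ?H \<omega> \<or> (\<exists>v\<in>V. thin v K t \<omega>))"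
    then have G: "good \<delta> K g ?H \<omega>" and nt: "\<And>v. v \<in> V \<Longrightarrow> \<not> thin v K t \<omega>" by auto
    have "V \<subseteq> ball v \<omega> ?A" if v: "v \<in> V" and k: "k \<le> t" "K < layer v \<omega> k" "\<forall>i<k. layer v \<omega> i \<le> K" for v k
    proof -
      have "k * K \<le> t * K" using k by (intro mult_right_mono) auto
      then have "real (k * K) \<le> \<delta> / (8 * real r) * real n" using small by linarith
      then have "V \<subseteq> ball v \<omega> (k + h + 2 * I + u)"
        using k by (intro good_covers[OF v w G \<delta> k(2) _ \<kappa> h _ I g]) auto
      moreover have "ball v \<omega> (k + h + 2 * I + u) \<subseteq> ball v \<omega> ?A" using k by (intro ball_mono) simp
      ultimately show ?thesis by blast
    qed
    then show False using nu nt G by (auto simp: upper_event_def good_def)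
  qed
  also have "\<dots> \<le> prb (\<lambda>\<omega>. \<not> good \<delta> K g ?H \<omega>) + prb (\<lambda>\<omega>. \<exists>v\<in>V. thin v K t \<omega>)" by (rule prb_disj)
  also have "prb (\<lambda>\<omega>. \<exists>v\<in>V. thin v K t \<omega>) \<le> (\<Sum>v\<in>V. prb (thin v K t))" by (rule prb_union) simp
  also have "\<dots> \<le> (\<Sum>v\<in>V. p)" by (intro sum_mono p)
  also have "\<dots> = real n * p" by simp
  finally show ?thesis using prb_not_good[OF \<delta>, of K g ?H] by linarith
qed

end

section \<open>Asymptotics\<close>

text \<open>\<open>b\<close> is a little above \<open>ext_prob r\<close>: \<open>real r * b\<close>
  is \<open>r\<close> to the power \<open>- 1 / (eta_const r + \<epsilon> / 2)\<close>, so over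
  \<open>eta_const r + \<epsilon>\<close> times \<open>log r n\<close> steps its power is smaller
  than \<open>1 / n\<close> by a power of \<open>n\<close>.\<close>

lemma ext_params:
  assumes r: "r \<ge> 2" and \<epsilon>: "0 < \<epsilon>"
  defines "b \<equiv> exp (- ln (real r) / (eta_const r + \<epsilon> / 2)) / real r"
  shows "ext_prob r < b" "b < 1" "ext_gf r b \<le> b" "real r * b = exp (- ln (real r) / (eta_const r + \<epsilon> / 2))" "real r * b < 1"
proof -
  have eta: "eta_const r > 0" by (rule eta_pos_ln(1)[OF r])
  have lr: "ln (real r) > 0" and rr: "real r > 0" using r by auto
  show rb: "real r * b = exp (- ln (real r) / (eta_const r + \<epsilon> / 2))" using rr by (simp add: b_def)
  show rb1: "real r * b < 1" unfolding rb using lr eta \<epsilon> by simp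
  have b0: "0 < b" using rr by (simp add: b_def)
  have "b \<le> real r * b" using r b0 by simp
  then show b1: "b < 1" using rb1 by linarith
  have "ln (real r) / (eta_const r + \<epsilon> / 2) < ln (real r) / eta_const r"
    using lr eta \<epsilon> by (intro divide_strict_left_mono mult_pos_pos) auto
  then have "ln (real r * ext_prob r) < ln (real r * b)"
    unfolding rb eta_pos_ln(2)[OF r] by simp
  then have "real r * ext_prob r < real r * b" using rr b0 ext_prob_pos[OF r] by simp
  then show qb: "ext_prob r < b" using rr by simp
  show "ext_gf r b \<le> b" using ext_gf_less[OF r qb b1] by simp
qed

text \<open>The slower growth at rate \<open>(1 - \<delta>) * r\<close> is made up for by
  \<open>1 + \<epsilon>\<close> times as many steps; \<open>\<delta> \<le> 1 / 4\<close> keeps the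
  rate at least 3/2 even for \<open>r = 2\<close>.\<close>

lemma growth_rate_param:
  assumes r: "r \<ge> 2" and \<epsilon>: "0 < \<epsilon>"
  obtains \<delta> where "0 < \<delta>" "\<delta> \<le> 1 / 4" "3 / 2 \<le> (1 - \<delta>) * real r" "ln (real r) \<le> (1 + \<epsilon>) * ln ((1 - \<delta>) * real r)"
proof -
  have lr: "ln (real r) > 0" and rr: "real r \<ge> 2" using r by auto
  \<comment> \<open>\<open>r\<close> to the power \<open>- \<epsilon> / (1 + \<epsilon>)\<close>:
    the value of \<open>1 - \<delta>\<close> that turns the required inequality into an
    equality.\<close>
  define e where "e = exp (- (\<epsilon> / (1 + \<epsilon>) * ln (real r)))"
  define \<delta> where "\<delta> = min (1 / 4) (1 - e)"
  have e: "0 < e" "e < 1" using lr \<epsilon> by (auto simp: e_def)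
  have \<delta>: "0 < \<delta>" "\<delta> \<le> 1 / 4" "e \<le> 1 - \<delta>" using e unfolding \<delta>_def by linarith+
  have "(3 / 4) * 2 \<le> (1 - \<delta>) * real r" using \<delta> rr by (intro mult_mono) auto
  moreover have "ln (real r) \<le> (1 + \<epsilon>) * ln ((1 - \<delta>) * real r)"
  proof -
    have "ln e \<le> ln (1 - \<delta>)" using \<delta> e by (intro ln_mono) auto
    then have "- (\<epsilon> / (1 + \<epsilon>) * ln (real r)) + ln (real r) \<le> ln ((1 - \<delta>) * real r)"
      using \<delta> rr by (simp add: e_def ln_mult)
    then have "(1 + \<epsilon>) * (- (\<epsilon> / (1 + \<epsilon>) * ln (real r)) + ln (real r)) \<le> (1 + \<epsilon>) * ln ((1 - \<delta>) * real r)"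
      using \<epsilon> by (intro mult_left_mono) auto
    moreover have "(1 + \<epsilon>) * (- (\<epsilon> / (1 + \<epsilon>) * ln (real r)) + ln (real r)) = ln (real r)"
      using \<epsilon> by (simp add: field_simps)
    ultimately show ?thesis by simp
  qed
  ultimately show ?thesis using that \<delta> by simp
qed

lemma power_nat_ge:
  fixes x y :: real
  assumes "1 \<le> x" "y \<le> real k"
  shows "exp (y * ln x) \<le> x ^ k"
proof -
  have "exp (y * ln x) \<le> exp (real k * ln x)" using assms by (intro iffD2[OF exp_le_cancel_iff] mult_right_mono) auto
  also have "\<dots> = x ^ k" using assms by (simp add: exp_of_nat_mult)
  finally show ?thesis .
qed

lemma power_nat_le:
  fixes x y :: real
  assumes "0 < x" "x \<le> 1" "y \<le> real k"
  shows "x ^ k \<le> exp (y * ln x)"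
proof -
  have "exp (real k * ln x) \<le> exp (y * ln x)" using assms by (intro iffD2[OF exp_le_cancel_iff] mult_right_mono_neg) auto
  moreover have "exp (real k * ln x) = x ^ k" using assms by (simp add: exp_of_nat_mult)
  ultimately show ?thesis by simp
qed

lemma nat_ceiling_bounds:
  fixes x :: real
  assumes "0 \<le> x"
  shows "x \<le> real (nat \<lceil>x\<rceil>)" "real (nat \<lceil>x\<rceil>) \<le> x + 1"
  using assms by linarith+

lemma ln_powr_eq: "n > 0 \<Longrightarrow> exp (a * ln (real n)) = real n powr a"
  by (simp add: powr_def)

text \<open>The summands of \<open>A\<close> are the times for leaving the thin phase, growing to
  linear size, letting the survival ratio collapse, and absorbing the rest. For the third,
  \<open>\<epsilon> * L n\<close> is ample, since only its square must exceed a multiple of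
  \<open>ln n\<close>; for the fourth it determines \<open>\<zeta>\<close>.\<close>

lemma upper_whp:
  fixes r :: nat and \<epsilon> :: real
  assumes r: "r \<ge> 2" and \<epsilon>: "0 < \<epsilon>"
  defines "L \<equiv> \<lambda>n :: nat. log (real r) (real n)"
  defines "t \<equiv> \<lambda>n. nat \<lceil>(eta_const r + \<epsilon>) * L n\<rceil>"
  defines "A \<equiv> \<lambda>n. t n + nat \<lceil>(1 + \<epsilon>) * L n\<rceil> + 2 * nat \<lceil>\<epsilon> * L n\<rceil> + nat \<lceil>\<epsilon> * L n\<rceil>"
  obtains \<delta> C where "0 < \<delta>" "\<delta> \<le> 1 / 4" "3 / 2 \<le> (1 - \<delta>) * real r" "0 < C"
    "(\<lambda>n. rout.prb n r (\<lambda>\<omega>. \<not> rout.upper_event n r (nat \<lceil>C * ln (real n)\<rceil>) (t n) (A n) \<omega>)) \<longlonglongrightarrow> 0"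
proof -
  define \<eta> where "\<eta> = eta_const r"
  have eta: "\<eta> > 0" using eta_pos_ln(1)[OF r] by (simp add: \<eta>_def)
  define lr where "lr = ln (real r)"
  have lr: "lr > 0" and rr: "real r \<ge> 2" using r by (auto simp: lr_def)
  have L: "L n = ln (real n) / lr" for n by (simp add: L_def log_def lr_def)
  obtain \<delta> where \<delta>: "0 < \<delta>" "\<delta> \<le> 1 / 4" "3 / 2 \<le> (1 - \<delta>) * real r"
    and \<delta>ln: "ln (real r) \<le> (1 + \<epsilon>) * ln ((1 - \<delta>) * real r)"
    using growth_rate_param[OF r \<epsilon>] .
  \<comment> \<open>With \<open>K n \<ge> C * ln n\<close> a growth step fails with probability at
    most \<open>n\<close> to the power -4, which survives the union over vertices and steps.\<close>
  define C where "C = 32 / \<delta> ^ 2"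
  have C: "C > 0" using \<delta> by (simp add: C_def)
  define b where "b = exp (- lr / (\<eta> + \<epsilon> / 2)) / real r"
  note bp = ext_params[OF r \<epsilon>, folded \<eta>_def lr_def, folded b_def]
  \<comment> \<open>A thin history has probability of order \<open>n\<close> to the power
    \<open>- w\<close>, before the price \<open>s ^ K n\<close> is paid.\<close>
  define w where "w = (\<eta> + \<epsilon>) / (\<eta> + \<epsilon> / 2)"
  have w: "w > 1" using eta \<epsilon> by (simp add: w_def)
  \<comment> \<open>The first entry keeps that price below half of the excess of \<open>w\<close>
    over 1, up to a constant factor; the second keeps \<open>s = exp (- \<sigma>)\<close> above
    \<open>ext_prob r\<close>, where the iterates decrease.\<close>
  define \<sigma> where "\<sigma> = min ((w - 1) / (2 * C)) (- ln (ext_prob r) / 2)"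
  have lnq: "ln (ext_prob r) < 0" using ext_prob_pos[OF r] ext_prob_less_1[OF r] by simp
  have \<sigma>: "0 < \<sigma>" "\<sigma> * C \<le> (w - 1) / 2" "ln (ext_prob r) < - \<sigma>"
  proof -
    show "0 < \<sigma>" using w C lnq by (simp add: \<sigma>_def)
    have "\<sigma> * C \<le> (w - 1) / (2 * C) * C" using C by (intro mult_right_mono) (auto simp: \<sigma>_def)
    then show "\<sigma> * C \<le> (w - 1) / 2" using C by simp
    have "\<sigma> \<le> - ln (ext_prob r) / 2" by (simp add: \<sigma>_def)
    then show "ln (ext_prob r) < - \<sigma>" using lnq by linarith
  qed
  define s where "s = exp (- \<sigma>)"
  have s: "ext_prob r < s" "s < 1" "0 < s"
    using \<sigma> ext_prob_pos[OF r] by (auto simp: s_def) (metis exp_less_cancel_iff exp_ln)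
  obtain I\<^sub>0 where I0: "(ext_gf r ^^ I\<^sub>0) s < ext_prob r + (b - ext_prob r)"
    using ext_gf_iterates[OF r s(1,2), of "b - ext_prob r"] bp(1) by auto
  then have I0: "(ext_gf r ^^ I\<^sub>0) s \<le> b" by simp
  \<comment> \<open>The second entry makes \<open>(3 / 2) ^ I n\<close> exceed \<open>n\<close> to
    the power \<open>\<zeta>\<close>, as \<open>expanding_finish\<close> requires; the first keeps
    that power eventually below \<open>n / 3000\<close>.\<close>
  define \<zeta> where "\<zeta> = min (1 / 2) (\<epsilon> * ln (3 / 2) / lr / 2)"
  have \<zeta>: "0 < \<zeta>" "\<zeta> \<le> 1 / 2" "\<zeta> \<le> \<epsilon> * ln (3 / 2) / lr / 2" using \<epsilon> lr by (auto simp: \<zeta>_def)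
  define K where "K = (\<lambda>n :: nat. nat \<lceil>C * ln (real n)\<rceil>)"
  define h where "h = (\<lambda>n. nat \<lceil>(1 + \<epsilon>) * L n\<rceil>)"
  define I where "I = (\<lambda>n. nat \<lceil>\<epsilon> * L n\<rceil>)"
  define g where "g = (\<lambda>n :: nat. real n powr \<zeta>)"
  define c where "c = (\<delta> / (24 * real r)) ^ 2 / 32"
  have c: "c > 0" using \<delta> rr by (simp add: c_def)
  define \<beta> where "\<beta> = 1 - \<delta> / (48 * real r)"
  have \<beta>: "0 < \<beta>" "\<beta> < 1" using \<delta> rr by (auto simp: \<beta>_def field_simps)
  define lb where "lb = - ln \<beta>"
  have lb: "lb > 0" using \<beta> by (simp add: lb_def)
  define Q where "Q = exp 1 * exp \<sigma> / b ^ I\<^sub>0"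
  define bnd where "bnd = (\<lambda>n :: nat. 24 * real n powr (- 1 / 3) +
    real n * real n * (real n powr (- 4) + exp (- (c * real n powr \<zeta>))) + Q * real n powr ((1 - w) / 2))"
  have bnd0: "bnd \<longlonglongrightarrow> 0"
  proof -
    have "(\<lambda>n :: nat. 24 * real n powr (- 1 / 3)) \<longlonglongrightarrow> 0" by real_asymp
    moreover have "(\<lambda>n :: nat. real n * real n * (real n powr (- 4) + exp (- (c * real n powr \<zeta>)))) \<longlonglongrightarrow> 0"
      using c \<zeta>(1) by real_asymp
    moreover have "(\<lambda>n :: nat. Q * real n powr ((1 - w) / 2)) \<longlonglongrightarrow> Q * 0"
      using w by (intro tendsto_mult tendsto_const tendsto_neg_powr filterlim_real_sequentially) auto
    ultimately have "bnd \<longlonglongrightarrow> 0 + 0 + Q * 0" unfolding bnd_def by (intro tendsto_add)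
    then show ?thesis by simp
  qed
  \<comment> \<open>\<open>C1 * ln n + 5\<close> bounds the number of steps in the union bounds,
    roundings included.\<close>
  define C1 where "C1 = (\<eta> + 1 + 4 * \<epsilon>) / lr"
  have C1: "C1 > 0" using eta \<epsilon> lr by (simp add: C1_def)
  have ev: "\<forall>\<^sub>F n in sequentially. n \<ge> 3 \<and> C * ln (real n) \<ge> 1 \<and>
    (C1 * ln (real n) + 5) * (C * ln (real n) + 1) \<le> \<delta> / (8 * real r) * real n \<and>
    (C1 * ln (real n) + 5) * (2 * (real r * (C * ln (real n) + 1)) ^ 2 / (real n / 2)) \<le> 1 \<and>
    real n / 2 + (C1 * ln (real n) + 5) * (C * ln (real n) + 1) \<le> real n \<and>
    C1 * ln (real n) + 5 \<le> real n \<and>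
    ln (real n) \<le> (\<epsilon> * (ln (real n) / lr)) ^ 2 * lb \<and> 3000 * real n powr \<zeta> \<le> real n"
  proof (intro eventually_conj)
    show "\<forall>\<^sub>F n in sequentially. 3 \<le> (n :: nat)" by (rule eventually_ge_at_top)
    show "\<forall>\<^sub>F n :: nat in sequentially. 1 \<le> C * ln (real n)" using C by real_asymp
    have d8: "\<delta> / (8 * real r) > 0" using \<delta> rr by simp
    show "\<forall>\<^sub>F n :: nat in sequentially. (C1 * ln (real n) + 5) * (C * ln (real n) + 1) \<le> \<delta> / (8 * real r) * real n"
      using C C1 d8 by real_asymp
    show "\<forall>\<^sub>F n :: nat in sequentially. (C1 * ln (real n) + 5) * (2 * (real r * (C * ln (real n) + 1)) ^ 2 / (real n / 2)) \<le> 1"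
    proof -
      have "(\<lambda>n :: nat. (C1 * ln (real n) + 5) * (2 * (real r * (C * ln (real n) + 1)) ^ 2 / (real n / 2))) \<longlonglongrightarrow> 0"
        using C C1 rr by real_asymp
      then have "\<forall>\<^sub>F n :: nat in sequentially. (C1 * ln (real n) + 5) * (2 * (real r * (C * ln (real n) + 1)) ^ 2 / (real n / 2)) < 1"
        by (rule order_tendstoD) simp
      then show ?thesis by (rule eventually_mono) simp
    qed
    show "\<forall>\<^sub>F n :: nat in sequentially. real n / 2 + (C1 * ln (real n) + 5) * (C * ln (real n) + 1) \<le> real n"
      using C C1 by real_asymp
    show "\<forall>\<^sub>F n :: nat in sequentially. C1 * ln (real n) + 5 \<le> real n" using C1 by real_asymp
    show "\<forall>\<^sub>F n :: nat in sequentially. ln (real n) \<le> (\<epsilon> * (ln (real n) / lr)) ^ 2 * lb" using \<epsilon> lr lb by real_asymp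
    have "1 - \<zeta> > 0" using \<zeta> by simp
    then have "\<forall>\<^sub>F n :: nat in sequentially. 3000 \<le> real n powr (1 - \<zeta>)" by real_asymp
    then show "\<forall>\<^sub>F n :: nat in sequentially. 3000 * real n powr \<zeta> \<le> real n"
      using eventually_gt_at_top[of 0]
    proof eventually_elim
      case (elim n)
      then have "3000 * real n powr \<zeta> \<le> real n powr (1 - \<zeta>) * real n powr \<zeta>" by (intro mult_right_mono) auto
      then show ?case using elim by (simp add: powr_add[symmetric])
    qed
  qed
  have "\<forall>\<^sub>F n in sequentially. rout.prb n r (\<lambda>\<omega>. \<not> rout.upper_event n r (K n) (t n) (A n) \<omega>) \<le> bnd n"
    using ev
  proof eventually_elim
    case (elim n)
    then have n3: "n \<ge> 3" by simp
    interpret rout n r using n3 r by unfold_locales auto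
    let ?l = "ln (real n)"
    have l0: "?l > 0" using n3 by simp
    have Ln: "L n = ?l / lr" "L n \<ge> 0" using L l0 lr by auto
    have tn: "(\<eta> + \<epsilon>) * L n \<le> real (t n)" "real (t n) \<le> (\<eta> + \<epsilon>) * L n + 1"
      using nat_ceiling_bounds[of "(\<eta> + \<epsilon>) * L n"] eta \<epsilon> Ln(2) by (simp_all add: t_def \<eta>_def)
    have hn: "(1 + \<epsilon>) * L n \<le> real (h n)" "real (h n) \<le> (1 + \<epsilon>) * L n + 1"
      using nat_ceiling_bounds[of "(1 + \<epsilon>) * L n"] \<epsilon> Ln(2) by (simp_all add: h_def)
    have In: "\<epsilon> * L n \<le> real (I n)" "real (I n) \<le> \<epsilon> * L n + 1"
      using nat_ceiling_bounds[of "\<epsilon> * L n"] \<epsilon> Ln(2) by (simp_all add: I_def)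
    have Kn: "C * ?l \<le> real (K n)" "real (K n) \<le> C * ?l + 1"
      using nat_ceiling_bounds[of "C * ?l"] C l0 by (simp_all add: K_def)
    have sum_le: "(\<eta> + \<epsilon>) * L n + (1 + \<epsilon>) * L n + 2 * (\<epsilon> * L n) \<le> C1 * ?l"
      unfolding C1_def Ln using lr by (simp add: field_simps)
    have pos: "0 \<le> (\<eta> + \<epsilon>) * L n" "0 \<le> (1 + \<epsilon>) * L n" "0 \<le> \<epsilon> * L n"
      using eta \<epsilon> Ln(2) by (auto intro!: mult_nonneg_nonneg)
    have H: "real (t n + h n + 2 * I n) \<le> C1 * ?l + 5" using tn hn In sum_le by simp
    have tC: "real (t n) \<le> C1 * ?l + 4" using tn sum_le pos by simp
    have K1: "1 \<le> K n" using elim Kn by linarith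
    have tK: "real (Suc (t n) * K n) \<le> (C1 * ?l + 5) * (C * ?l + 1)"
      unfolding of_nat_mult using tC Kn C C1 l0 by (intro mult_mono) auto
    have A: "A n = t n + h n + 2 * I n + I n" by (simp add: A_def h_def I_def)
    define p where "p = Q * real n powr ((1 - w) / 2) / real n"
    have thin: "prb (thin v (K n) (t n)) \<le> p" if v: "v \<in> V" for v
    proof -
      let ?m = "real n / 2"
      have s1: "s \<le> 1" using s by simp
      have "prb (thin v (K n) (t n)) \<le> exp (real (t n) * (2 * (real r * real (K n)) ^ 2 / ?m)) * real r ^ t n * b ^ (t n - I\<^sub>0) / s ^ K n"
        using elim tK n3 bp I0 by (intro thin_prob[OF v s(3) s1]) auto
      also have "\<dots> \<le> exp 1 * (exp (- w * ?l) / b ^ I\<^sub>0) * (exp \<sigma> * exp (\<sigma> * C * ?l))"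
      proof -
        have "real (t n) * (2 * (real r * real (K n)) ^ 2 / ?m) \<le> (C1 * ?l + 5) * (2 * (real r * (C * ?l + 1)) ^ 2 / ?m)"
          using tC Kn C C1 l0 n3 by (intro mult_mono divide_right_mono power_mono mult_left_mono) auto
        also have "\<dots> \<le> 1" using elim by blast
        finally have 1: "exp (real (t n) * (2 * (real r * real (K n)) ^ 2 / ?m)) \<le> exp 1"
          by (simp only: exp_le_cancel_iff)
        have b0: "0 < b" using bp(1) ext_prob_pos[OF r] by simp
        \<comment> \<open>For \<open>t n\<close> below \<open>I\<^sub>0\<close> the truncated
          exponent is 0, and the right side is at least 1.\<close>
        have "b ^ (t n - I\<^sub>0) \<le> b ^ t n / b ^ I\<^sub>0"
        proof (cases "I\<^sub>0 \<le> t n")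
          case True
          then show ?thesis using b0 by (simp add: power_diff)
        next
          case False
          then have "b ^ I\<^sub>0 \<le> b ^ t n" using b0 bp(2) by (intro power_decreasing) auto
          then show ?thesis using b0 False by (simp add: le_divide_eq)
        qed
        then have "real r ^ t n * b ^ (t n - I\<^sub>0) \<le> real r ^ t n * (b ^ t n / b ^ I\<^sub>0)" by (intro mult_left_mono) auto
        also have "\<dots> = (real r * b) ^ t n / b ^ I\<^sub>0" by (simp add: power_mult_distrib)
        also have "\<dots> \<le> exp ((\<eta> + \<epsilon>) * L n * ln (real r * b)) / b ^ I\<^sub>0"
          using tn(1) bp(5) b0 rr by (intro divide_right_mono power_nat_le) auto
        also have "(\<eta> + \<epsilon>) * L n * ln (real r * b) = - w * ?l"
          unfolding bp(4) Ln(1) w_def using lr by simp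
        finally have 2: "real r ^ t n * b ^ (t n - I\<^sub>0) \<le> exp (- w * ?l) / b ^ I\<^sub>0" .
        have "1 / s ^ K n = exp (\<sigma> * real (K n))" by (simp add: s_def exp_of_nat2_mult[symmetric] exp_minus inverse_eq_divide power_divide)
        also have "\<dots> \<le> exp (\<sigma> + \<sigma> * C * ?l)" using mult_left_mono[OF Kn(2), of \<sigma>] \<sigma>(1) by (simp add: algebra_simps)
        finally have 3: "1 / s ^ K n \<le> exp \<sigma> * exp (\<sigma> * C * ?l)" by (simp add: exp_add)
        have "exp (real (t n) * (2 * (real r * real (K n)) ^ 2 / ?m)) * (real r ^ t n * b ^ (t n - I\<^sub>0)) * (1 / s ^ K n) \<le>
          exp 1 * (exp (- w * ?l) / b ^ I\<^sub>0) * (exp \<sigma> * exp (\<sigma> * C * ?l))"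
          using 1 2 3 b0 s by (intro mult_mono) auto
        then show ?thesis by (simp add: mult.assoc)
      qed
      also have "\<dots> = Q * (exp (- w * ?l) * exp (\<sigma> * C * ?l))" by (simp add: Q_def)
      also have "\<dots> \<le> Q * (real n powr ((1 - w) / 2) / real n)"
      proof (intro mult_left_mono)
        have "exp (- w * ?l) * exp (\<sigma> * C * ?l) = exp ((\<sigma> * C - w) * ?l)" by (simp add: exp_add[symmetric] algebra_simps)
        also have "\<dots> \<le> exp (((1 - w) / 2 - 1) * ?l)"
        proof -
          have "\<sigma> * C - w \<le> (1 - w) / 2 - 1" using \<sigma>(2) by (simp add: field_simps)
          then show ?thesis using l0 by (intro iffD2[OF exp_le_cancel_iff] mult_right_mono) auto
        qed
        also have "\<dots> = real n powr ((1 - w) / 2 - 1)" using n3 by (intro ln_powr_eq) simp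
        also have "\<dots> = real n powr ((1 - w) / 2) / real n" using n3 by (simp add: powr_diff)
        finally show "exp (- w * ?l) * exp (\<sigma> * C * ?l) \<le> real n powr ((1 - w) / 2) / real n" .
        show "0 \<le> Q" using bp(1) ext_prob_pos[OF r] by (simp add: Q_def)
      qed
      finally show ?thesis by (simp add: p_def)
    qed
    have "prb (\<lambda>\<omega>. \<not> upper_event (K n) (t n) (t n + h n + 2 * I n + I n) \<omega>) \<le> 24 * real n powr (- 1 / 3) +
      real n * real (t n + h n + 2 * I n) * (exp (- (\<delta> ^ 2 * real (K n) / 8)) + exp (- ((\<delta> / (24 * real r)) ^ 2 * g n / 32))) + real n * p"
    proof (rule prb_not_upper_event)
      show "0 < \<delta>" "\<delta> \<le> 1" "3 / 2 \<le> (1 - \<delta>) * real r" using \<delta> by auto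
      show "real n \<le> ((1 - \<delta>) * real r) ^ h n * real (K n)"
      proof -
        have "?l = lr * L n" using Ln lr by simp
        also have "\<dots> \<le> ((1 + \<epsilon>) * ln ((1 - \<delta>) * real r)) * L n"
          using \<delta>ln Ln by (intro mult_right_mono) (auto simp: lr_def)
        finally have "exp ?l \<le> exp ((1 + \<epsilon>) * L n * ln ((1 - \<delta>) * real r))" by (simp add: mult_ac)
        also have "\<dots> \<le> ((1 - \<delta>) * real r) ^ h n" using hn \<delta> by (intro power_nat_ge) auto
        finally have "real n * 1 \<le> ((1 - \<delta>) * real r) ^ h n * real (K n)"
          using n3 K1 \<delta> by (intro mult_mono) auto
        then show ?thesis by simp
      qed
      show "real (t n * K n) \<le> \<delta> / (8 * real r) * real n"
      proof -
        have "real (t n * K n) \<le> real (Suc (t n) * K n)" by (intro of_nat_mono mult_right_mono) auto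
        then show ?thesis using tK elim by linarith
      qed
      show "(1 - \<delta> / (48 * real r)) ^ (I n * I n) * real n \<le> g n"
      proof -
        have "(\<epsilon> * L n) ^ 2 \<le> real (I n) ^ 2" using In pos by (intro power_mono)
        then have "(\<epsilon> * L n) ^ 2 \<le> real (I n * I n)" by (simp add: power2_eq_square)
        then have "\<beta> ^ (I n * I n) \<le> exp ((\<epsilon> * L n) ^ 2 * ln \<beta>)" using \<beta> by (intro power_nat_le) auto
        also have "\<dots> \<le> exp (- ?l)" using elim Ln by (simp add: lb_def)
        finally have "\<beta> ^ (I n * I n) * real n \<le> exp (- ?l) * real n" by (rule mult_right_mono) simp
        also have "exp (- ?l) * real n = 1" using n3 by (simp add: exp_minus)
        also have "1 \<le> g n" unfolding g_def using n3 \<zeta> by (intro ge_one_powr_ge_zero) auto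
        finally show ?thesis by (simp add: \<beta>_def)
      qed
      show "3000 * g n \<le> real n" using elim by (simp add: g_def)
      show "g n < (3 / 2) ^ I n"
      proof -
        have "\<zeta> * ?l \<le> \<epsilon> * ln (3 / 2) / lr / 2 * ?l" using \<zeta> l0 by (intro mult_right_mono) auto
        also have "\<dots> < \<epsilon> * L n * ln (3 / 2)" using Ln lr l0 \<epsilon> by (simp add: field_simps)
        finally have "exp (\<zeta> * ?l) < exp (\<epsilon> * L n * ln (3 / 2))" by simp
        also have "\<dots> \<le> (3 / 2) ^ I n" using In by (intro power_nat_ge) auto
        finally show ?thesis unfolding g_def using n3 by (simp add: powr_def)
      qed
    qed (rule thin)
    also have "\<dots> \<le> bnd n"
    proof -
      have 1: "real (t n + h n + 2 * I n) \<le> real n" using H elim by linarith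
      have "4 * ?l \<le> \<delta> ^ 2 * real (K n) / 8"
      proof -
        have "4 * ?l = \<delta> ^ 2 * (C * ?l) / 8" using \<delta> by (simp add: C_def)
        also have "\<dots> \<le> \<delta> ^ 2 * real (K n) / 8" using Kn by (intro divide_right_mono mult_left_mono) auto
        finally show ?thesis .
      qed
      then have "exp (- (\<delta> ^ 2 * real (K n) / 8)) \<le> exp (- 4 * ?l)" by simp
      also have "\<dots> = real n powr (- 4)" using n3 by (intro ln_powr_eq) simp
      finally have 2: "exp (- (\<delta> ^ 2 * real (K n) / 8)) \<le> real n powr (- 4)" .
      have 3: "exp (- ((\<delta> / (24 * real r)) ^ 2 * g n / 32)) = exp (- (c * real n powr \<zeta>))" by (simp add: c_def g_def)
      have "real n * real (t n + h n + 2 * I n) * (exp (- (\<delta> ^ 2 * real (K n) / 8)) + exp (- ((\<delta> / (24 * real r)) ^ 2 * g n / 32))) \<le>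
        real n * real n * (real n powr (- 4) + exp (- (c * real n powr \<zeta>)))"
        using 1 2 unfolding 3 by (intro mult_mono mult_left_mono add_mono) auto
      moreover have "real n * p = Q * real n powr ((1 - w) / 2)" using n3 by (simp add: p_def)
      ultimately show ?thesis by (simp add: bnd_def)
    qed
    finally show "prb (\<lambda>\<omega>. \<not> upper_event (K n) (t n) (A n) \<omega>) \<le> bnd n" unfolding A .
  qed
  then have "(\<lambda>n. rout.prb n r (\<lambda>\<omega>. \<not> rout.upper_event n r (K n) (t n) (A n) \<omega>)) \<longlonglongrightarrow> 0"
  proof (rule tendsto_sandwich[OF _ _ tendsto_const bnd0, rotated])
    show "\<forall>\<^sub>F n in sequentially. 0 \<le> rout.prb n r (\<lambda>\<omega>. \<not> rout.upper_event n r (K n) (t n) (A n) \<omega>)"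
      using eventually_ge_at_top[of 1]
      by eventually_elim (use r in \<open>auto intro!: rout.prb_nonneg simp: rout_def\<close>)
  qed
  then show ?thesis using that \<delta> C unfolding K_def by blast
qed

section \<open>The event that determines both diameters\<close>

context rout
begin

text \<open>The number 3000 is that of \<open>expanding\<close>: a nonempty set closed under arcs
  has more than \<open>n / 3000\<close> vertices, hence is larger than any of the balls called small
  here.\<close>

definition main_event :: "nat \<Rightarrow> nat \<Rightarrow> (nat \<Rightarrow> nat \<Rightarrow> nat) \<Rightarrow> bool" where
  "main_event A D \<omega> \<longleftrightarrow> expanding \<omega> \<and>
     (\<forall>v\<in>V. V \<subseteq> ball v \<omega> A \<or>
       (\<exists>m\<le>A. (\<forall>j. ball v \<omega> j \<subseteq> ball v \<omega> m) \<and> 3000 * card (ball v \<omega> m) < n)) \<and>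
     (\<exists>v\<in>V. V \<subseteq> ball v \<omega> A \<and> 3000 * card (ball v \<omega> D) < n)"

text \<open>Two thresholds meet: the constant \<open>K\<close> of the core and the logarithmic
  \<open>B\<close> of the upper bound. A core vertex that does not stall passes \<open>B\<close> by
  time \<open>t\<close>, so its ball of radius \<open>A\<close> is everything although its ball of
  radius \<open>D\<close> is small.\<close>

lemma main_eventI:
  assumes u: "upper_event B t A \<omega>" and tA: "t \<le> A" "3000 * (t * B) < n"
    and v: "v \<in> V" "core v K \<tau> \<omega>" "\<not> stalls \<kappa> K B v \<tau> s \<omega>" "real (card (ball v \<omega> D)) < y"
    and \<kappa>: "0 \<le> \<kappa>" "real B < \<kappa> ^ s * real K" and s: "\<tau> + s \<le> t" and y: "3000 * y \<le> real n"
  shows "main_event A D \<omega>"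
  unfolding main_event_def
proof (intro conjI ballI)
  show "expanding \<omega>" using u by (simp add: upper_event_def)
  fix w assume w: "w \<in> V"
  have nt: "\<not> thin w B t \<omega>" using u w by (simp add: upper_event_def)
  show "V \<subseteq> ball w \<omega> A \<or> (\<exists>m\<le>A. (\<forall>j. ball w \<omega> j \<subseteq> ball w \<omega> m) \<and> 3000 * card (ball w \<omega> m) < n)"
  proof (rule not_thin_cases[OF w nt])
    fix k assume "k \<le> t" "B < layer w \<omega> k" "\<And>i. i < k \<Longrightarrow> layer w \<omega> i \<le> B"
    then show ?thesis using u w by (auto simp: upper_event_def)
  next
    fix m assume m: "m < t" "\<And>j. ball w \<omega> j \<subseteq> ball w \<omega> m" "card (ball w \<omega> m) \<le> t * B"
    then have "3000 * card (ball w \<omega> m) < n" using tA by linarith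
    then show ?thesis using m tA by (intro disjI2 exI[of _ m]) auto
  qed
next
  obtain k where k: "k \<le> \<tau> + s" "B < layer v \<omega> k" "\<And>i. i < k \<Longrightarrow> layer v \<omega> i \<le> B"
    by (rule core_exceeds[OF v(1-3) \<kappa>], blast)
  moreover have "k \<le> t" using k(1) s by simp
  ultimately have "V \<subseteq> ball v \<omega> A" using u v(1) unfolding upper_event_def by blast
  moreover have "3000 * card (ball v \<omega> D) < n" using v(4) y by linarith
  ultimately show "\<exists>v\<in>V. V \<subseteq> ball v \<omega> A \<and> 3000 * card (ball v \<omega> D) < n" using v(1) by blast
qed

lemma pair_const_upper:
  assumes "2 * real r * real b ^ 2 < real n" "b < n"
  shows "pair_const b \<le> 1 / (1 - 2 * real r * real b ^ 2 / real n)"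
proof -
  have n0: "real n > 0" using n by simp
  have x: "real (n - b) / real n = 1 + (- (real b / real n))" using assms(2) n0 by (simp add: of_nat_diff field_simps)
  have "1 + real (r * (2 * b)) * (- (real b / real n)) \<le> (1 + (- (real b / real n))) ^ (r * (2 * b))"
    using assms(2) n0 by (intro Bernoulli_inequality) (simp add: field_simps)
  then have "1 - 2 * real r * real b ^ 2 / real n \<le> ((real (n - b) / real n) ^ r) ^ (2 * b)"
    unfolding x power_mult by (simp add: power2_eq_square mult_ac)
  moreover have "0 < 1 - 2 * real r * real b ^ 2 / real n" using assms(1) n0 by (simp add: field_simps)
  ultimately show ?thesis unfolding pair_const_def by (intro divide_left_mono mult_pos_pos) auto
qed

end

lemma growth_constant_small:
  fixes d :: real
  assumes "0 < d" "0 < e"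
  shows "\<forall>\<^sub>F K in sequentially. exp (- (d * real K / 8)) / (1 - exp (- (d * real K / 8 / 2))) < e"
proof -
  have "(\<lambda>K :: nat. exp (- (d * real K / 8)) / (1 - exp (- (d * real K / 8 / 2)))) \<longlonglongrightarrow> 0"
    using assms(1) by real_asymp
  then show ?thesis using assms(2) by (rule order_tendstoD)
qed

text \<open>The counterpart of \<open>ext_params\<close> from below: over
  \<open>eta_const r - \<epsilon>\<close> times \<open>log r n\<close> steps, the power of
  \<open>a\<close> exceeds \<open>1 / n\<close> by a power of \<open>n\<close>.\<close>

lemma low_params:
  assumes r: "r \<ge> 2" and \<epsilon>: "0 < \<epsilon>" "\<epsilon> < eta_const r"
  defines "a \<equiv> exp (- ln (real r) / (eta_const r - \<epsilon> / 2))"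
  shows "0 < a" "a < real r * ext_prob r"
proof -
  have eta: "eta_const r > 0" by (rule eta_pos_ln(1)[OF r])
  have lr: "ln (real r) > 0" using r by auto
  show "0 < a" by (simp add: a_def)
  have "ln (real r) / eta_const r < ln (real r) / (eta_const r - \<epsilon> / 2)"
    using lr eta \<epsilon> by (intro divide_strict_left_mono mult_pos_pos) auto
  then have "a < exp (ln (real r * ext_prob r))" unfolding a_def eta_pos_ln(2)[OF r] by simp
  then show "a < real r * ext_prob r" using r ext_prob_pos[OF r] by simp
qed

text \<open>\<open>K\<close> is fixed before \<open>n\<close>: large enough that growth from
  \<open>K\<close> rarely stalls and that truncation leaves the eigenvalue above \<open>a\<close>.
  Only then do the Poisson limits for sizes up to \<open>K\<close> give a common
  \<open>N\<^sub>0\<close>. The ball at radius \<open>\<tau> n + s' n\<close> has mean of order at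
  most \<open>n powr (1 - \<epsilon>)\<close> given the core, and the larger power
  \<open>1 - \<epsilon> / 2\<close> leaves room for Markov.\<close>

lemma lower_whp:
  fixes r :: nat and \<epsilon> \<delta> C \<epsilon>' :: real
  assumes r: "r \<ge> 2" and \<epsilon>: "0 < \<epsilon>" "\<epsilon> < eta_const r" "\<epsilon> < 1"
    and \<delta>: "0 < \<delta>" "\<delta> \<le> 1 / 4" "3 / 2 \<le> (1 - \<delta>) * real r" and C: "0 < C" and e': "0 < \<epsilon>'"
  defines "L \<equiv> \<lambda>n :: nat. log (real r) (real n)"
  defines "B \<equiv> \<lambda>n :: nat. nat \<lceil>C * ln (real n)\<rceil>"
  defines "\<tau> \<equiv> \<lambda>n. Suc (nat \<lfloor>(eta_const r - \<epsilon>) * L n\<rfloor>)"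
  defines "s \<equiv> \<lambda>n. nat \<lceil>\<epsilon> * L n\<rceil>"
  defines "s' \<equiv> \<lambda>n. nat \<lfloor>(1 - \<epsilon>) * L n\<rfloor>"
  obtains K where "1 \<le> K" "\<forall>\<^sub>F n in sequentially. rout.prb n r (\<lambda>\<omega>. \<not> (\<exists>v\<in>rout.V n. rout.core n r v K (\<tau> n) \<omega> \<and>
      \<not> (rout.stalls n r ((1 - \<delta>) * real r) K (B n) v (\<tau> n) (s n) \<omega> \<or>
        real n powr (1 - \<epsilon> / 2) \<le> real (card (rout.ball n r v \<omega> (\<tau> n + s' n)))))) \<le> \<epsilon>'"
proof -
  define \<eta> where "\<eta> = eta_const r"
  have eta: "\<eta> > 0" "\<epsilon> < \<eta>" using eta_pos_ln(1)[OF r] \<epsilon> by (auto simp: \<eta>_def)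
  define lr where "lr = ln (real r)"
  have lr: "lr > 0" and rr: "real r \<ge> 2" using r by (auto simp: lr_def)
  have L: "L n = ln (real n) / lr" for n by (simp add: L_def log_def lr_def)
  let ?q = "ext_prob r"
  have q: "0 < ?q" "?q < 1" using ext_prob_pos[OF r] ext_prob_less_1[OF r] by auto
  define a where "a = exp (- lr / (\<eta> - \<epsilon> / 2))"
  have a: "0 < a" "a < real r * ?q" using low_params[OF r \<epsilon>(1,2)] by (auto simp: a_def lr_def \<eta>_def)
  have a1: "a \<le> 1" using a(2) mean_ext_less_1[OF r] by simp
  define e where "e = (\<lambda>K :: nat. exp (- (\<delta> ^ 2 * real K / 8)) / (1 - exp (- (\<delta> ^ 2 * real K / 8 / 2))))"
  have "\<forall>\<^sub>F K in sequentially. e K < \<epsilon>' / 4" unfolding e_def using \<delta> e' by (intro growth_constant_small) auto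
  then have ev1: "\<forall>\<^sub>F K in sequentially. 1 \<le> K \<and> e K < \<epsilon>' / 4 \<and> (\<forall>\<^sub>F N\<^sub>0 in sequentially. \<forall>z N. 1 \<le> z \<longrightarrow> z \<le> K \<longrightarrow> N\<^sub>0 \<le> N \<longrightarrow>
    a * (real z * ?q ^ z) \<le> binex N (step_prob r z N) (\<lambda>j. of_bool (1 \<le> j \<and> j \<le> K) * (real j * ?q ^ j)))"
    using truncated_eigen[OF r a] by (intro eventually_conj eventually_ge_at_top)
  then obtain K where K: "1 \<le> K" "e K < \<epsilon>' / 4" and evH: "\<forall>\<^sub>F N\<^sub>0 in sequentially. \<forall>z N. 1 \<le> z \<longrightarrow> z \<le> K \<longrightarrow> N\<^sub>0 \<le> N \<longrightarrow>
    a * (real z * ?q ^ z) \<le> binex N (step_prob r z N) (\<lambda>j. of_bool (1 \<le> j \<and> j \<le> K) * (real j * ?q ^ j))"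
    using eventually_happens'[OF sequentially_bot ev1] by blast
  obtain c where c: "0 < c" and evH': "\<forall>\<^sub>F N\<^sub>0 in sequentially. \<forall>z N. 1 \<le> z \<longrightarrow> z \<le> K \<longrightarrow> N\<^sub>0 \<le> N \<longrightarrow>
    c \<le> binex N (step_prob r z N) (\<lambda>j. of_bool (j = K))"
    using step_point_lower[of r K] r K(1) by auto
  obtain N\<^sub>0 where H: "\<And>z N. 1 \<le> z \<Longrightarrow> z \<le> K \<Longrightarrow> N\<^sub>0 \<le> N \<Longrightarrow>
      a * (real z * ?q ^ z) \<le> binex N (step_prob r z N) (\<lambda>j. of_bool (1 \<le> j \<and> j \<le> K) * (real j * ?q ^ j))"
    and H': "\<And>z N. 1 \<le> z \<Longrightarrow> z \<le> K \<Longrightarrow> N\<^sub>0 \<le> N \<Longrightarrow> c \<le> binex N (step_prob r z N) (\<lambda>j. of_bool (j = K))"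
    using eventually_happens'[OF sequentially_bot eventually_conj[OF evH evH']] by blast
  \<comment> \<open>\<open>a ^ t\<close> is at least \<open>n\<close> to the power
    \<open>- \<theta>\<close>, and \<open>\<theta> < 1\<close> makes the expected number of core
    vertices at least a constant times a positive power of \<open>n\<close>.\<close>
  define \<theta> where "\<theta> = (\<eta> - \<epsilon>) / (\<eta> - \<epsilon> / 2)"
  have \<theta>: "\<theta> < 1" using eta \<epsilon> by (simp add: \<theta>_def)
  define c1 where "c1 = c * ?q / real K"
  have c1: "c1 > 0" using c q K by (simp add: c1_def)
  \<comment> \<open>\<open>M * ln n\<close> bounds the number \<open>b\<close> of vertices in a core
    exploration; the summand 2 absorbs the added steps, as \<open>ln n \<ge> 1\<close>.\<close>
  define M where "M = (\<eta> / lr + 2) * real K"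
  have M: "M > 0" using eta lr K by (simp add: M_def add_pos_pos)
  \<comment> \<open>In turn: the deviation of \<open>pair_const\<close> from 1, the pairs whose
    explorations meet relative to the mean, and the Markov bound for a large ball.\<close>
  define g1 where "g1 = (\<lambda>n :: nat. 1 / (1 - 2 * real r * (M * ln (real n)) ^ 2 / real n) - 1)"
  define g2 where "g2 = (\<lambda>n :: nat. (M * ln (real n) + 4 * real r * (M * ln (real n)) ^ 3) / (c1 * real n powr (1 - \<theta>)))"
  define g3 where "g3 = (\<lambda>n :: nat. (M * ln (real n) + real K * real r * real n powr (1 - \<epsilon>)) / real n powr (1 - \<epsilon> / 2))"
  have g1: "g1 \<longlonglongrightarrow> 0" unfolding g1_def using M rr by real_asymp
  have g2: "g2 \<longlonglongrightarrow> 0"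
  proof -
    define w where "w = 1 - \<theta>"
    have "w > 0" using \<theta> by (simp add: w_def)
    then have "(\<lambda>n :: nat. (M * ln (real n) + 4 * real r * (M * ln (real n)) ^ 3) / (c1 * real n powr w)) \<longlonglongrightarrow> 0"
      using M c1 rr by real_asymp
    then show ?thesis by (simp add: g2_def w_def)
  qed
  have g3: "g3 \<longlonglongrightarrow> 0"
  proof -
    have "0 < 1 - \<epsilon> / 2" using \<epsilon> by simp
    then have "(\<lambda>n :: nat. M * ln (real n) / real n powr (1 - \<epsilon> / 2)) \<longlonglongrightarrow> 0" using M by real_asymp
    moreover have "(\<lambda>n :: nat. real K * real r * real n powr (- (\<epsilon> / 2))) \<longlonglongrightarrow> real K * real r * 0"
      using \<epsilon> by (intro tendsto_mult tendsto_const tendsto_neg_powr filterlim_real_sequentially) auto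
    ultimately have "(\<lambda>n :: nat. M * ln (real n) / real n powr (1 - \<epsilon> / 2) + real K * real r * real n powr (- (\<epsilon> / 2))) \<longlonglongrightarrow> 0 + real K * real r * 0"
      by (rule tendsto_add)
    moreover have "g3 n = M * ln (real n) / real n powr (1 - \<epsilon> / 2) + real K * real r * real n powr (- (\<epsilon> / 2))" for n
      unfolding g3_def add_divide_distrib times_divide_eq_right[symmetric] powr_diff[symmetric] by (simp add: field_simps)
    then have "g3 = (\<lambda>n. M * ln (real n) / real n powr (1 - \<epsilon> / 2) + real K * real r * real n powr (- (\<epsilon> / 2)))"
      by blast
    ultimately show ?thesis by simp
  qed
  have "(\<lambda>n. 4 * (g1 n + g2 n) + 2 * (e K + g3 n)) \<longlonglongrightarrow> 4 * (0 + 0) + 2 * (e K + 0)"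
    by (intro tendsto_intros g1 g2 g3)
  then have ev0: "\<forall>\<^sub>F n in sequentially. 4 * (g1 n + g2 n) + 2 * (e K + g3 n) < \<epsilon>'"
    by (rule order_tendstoD(2)) (use K e' in simp)
  have ev: "\<forall>\<^sub>F n in sequentially. 4 * (g1 n + g2 n) + 2 * (e K + g3 n) < \<epsilon>' \<and> n \<ge> 3 \<and>
    M * ln (real n) + (\<epsilon> * (ln (real n) / lr) + 1) * (C * ln (real n) + 1) \<le> \<delta> / (4 * real r) * real n \<and>
    real N\<^sub>0 + M * ln (real n) \<le> real n \<and> 2 * (M * ln (real n)) < real n \<and> 4 * real r * (M * ln (real n)) ^ 2 < real n"
  proof (intro eventually_conj ev0)
    show "\<forall>\<^sub>F n in sequentially. 3 \<le> (n :: nat)" by (rule eventually_ge_at_top)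
    have d4: "\<delta> / (4 * real r) > 0" using \<delta> rr by simp
    show "\<forall>\<^sub>F n :: nat in sequentially. M * ln (real n) + (\<epsilon> * (ln (real n) / lr) + 1) * (C * ln (real n) + 1) \<le> \<delta> / (4 * real r) * real n"
      using d4 M \<epsilon>(1) lr C by real_asymp
    show "\<forall>\<^sub>F n :: nat in sequentially. real N\<^sub>0 + M * ln (real n) \<le> real n" using M by real_asymp
    show "\<forall>\<^sub>F n :: nat in sequentially. 2 * (M * ln (real n)) < real n" using M by real_asymp
    show "\<forall>\<^sub>F n :: nat in sequentially. 4 * real r * (M * ln (real n)) ^ 2 < real n" using M rr by real_asymp
  qed
  have "\<forall>\<^sub>F n in sequentially. rout.prb n r (\<lambda>\<omega>. \<not> (\<exists>v\<in>rout.V n. rout.core n r v K (\<tau> n) \<omega> \<and>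
      \<not> (rout.stalls n r ((1 - \<delta>) * real r) K (B n) v (\<tau> n) (s n) \<omega> \<or>
        real n powr (1 - \<epsilon> / 2) \<le> real (card (rout.ball n r v \<omega> (\<tau> n + s' n)))))) \<le> \<epsilon>'"
    using ev
  proof eventually_elim
    case (elim n)
    then have n3: "n \<ge> 3" by simp
    interpret rout n r using n3 r by unfold_locales auto
    let ?l = "ln (real n)"
    have n0: "real n > 0" using n3 by simp
    have l1: "?l \<ge> 1"
    proof -
      have "exp 1 \<le> (3 :: real)" by (rule exp_le)
      then have "exp 1 \<le> real n" using n3 by linarith
      then show ?thesis using ln_ge_iff[OF n0, of 1] by simp
    qed
    have Ln: "L n = ?l / lr" "L n \<ge> 0" using L l1 lr by auto
    \<comment> \<open>\<open>\<tau> n\<close> is one step longer than \<open>t\<close>: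
      \<open>prb_core_lower\<close> uses the extra step to set the size to \<open>K\<close>.\<close>
    define t where "t = nat \<lfloor>(\<eta> - \<epsilon>) * L n\<rfloor>"
    have \<tau>: "\<tau> n = Suc t" by (simp add: \<tau>_def t_def \<eta>_def)
    have "0 \<le> (\<eta> - \<epsilon>) * L n" using eta Ln(2) by (intro mult_nonneg_nonneg) auto
    then have t: "real t \<le> (\<eta> - \<epsilon>) * L n" unfolding t_def by linarith
    define b where "b = Suc (\<tau> n) * K"
    have b: "real b \<le> M * ?l"
    proof -
      have "(\<eta> - \<epsilon>) * L n \<le> \<eta> * L n" using \<epsilon> Ln(2) by (intro mult_right_mono) auto
      then have "real t + 2 \<le> \<eta> * L n + 2 * ?l" using t l1 by linarith
      also have "\<dots> = (\<eta> / lr + 2) * ?l" unfolding Ln(1) by (simp add: algebra_simps)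
      finally have "(real t + 2) * real K \<le> (\<eta> / lr + 2) * ?l * real K" by (rule mult_right_mono) simp
      then show ?thesis by (simp add: b_def \<tau> M_def algebra_simps)
    qed
    have \<tau>b: "real (\<tau> n) \<le> M * ?l"
    proof -
      have "\<tau> n * 1 \<le> b" unfolding b_def using K by (intro mult_le_mono) auto
      then show ?thesis using b by linarith
    qed
    have Ml: "0 \<le> M * ?l" using M l1 by simp
    have bn: "b < n" "2 * b < n" using b elim by linarith+
    have sB: "real (s n * B n) \<le> (\<epsilon> * (?l / lr) + 1) * (C * ?l + 1)"
    proof -
      have 0: "0 \<le> \<epsilon> * L n" "0 \<le> C * ?l" using \<epsilon>(1) C Ln(2) l1 by (auto intro!: mult_nonneg_nonneg)
      have "real (s n) \<le> \<epsilon> * L n + 1" "real (B n) \<le> C * ?l + 1"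
        unfolding s_def B_def by (rule nat_ceiling_bounds(2), rule 0)+
      then have "real (s n) * real (B n) \<le> (\<epsilon> * L n + 1) * (C * ?l + 1)" using 0 by (intro mult_mono) auto
      then show ?thesis unfolding Ln(1) by simp
    qed
    define p where "p = c * (a ^ t * ?q / real K)"
    have p: "0 < p" using c a q K by (simp add: p_def)
    have np: "c1 * real n powr (1 - \<theta>) \<le> real n * p"
    proof -
      have "exp (- (\<theta> * ?l)) \<le> a ^ t"
      proof -
        have "real t * (lr / (\<eta> - \<epsilon> / 2)) \<le> (\<eta> - \<epsilon>) * L n * (lr / (\<eta> - \<epsilon> / 2))"
          using t lr eta \<epsilon>(1) by (intro mult_right_mono) auto
        also have "\<dots> = \<theta> * ?l" unfolding Ln(1) \<theta>_def using lr by simp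
        finally have "exp (- (\<theta> * ?l)) \<le> exp (real t * (- lr / (\<eta> - \<epsilon> / 2)))" by simp
        also have "\<dots> = a ^ t" unfolding a_def by (rule exp_of_nat_mult)
        finally show ?thesis .
      qed
      then have "c1 * (real n * exp (- (\<theta> * ?l))) \<le> c1 * (real n * a ^ t)" using c1 by (intro mult_left_mono) auto
      moreover have "real n * exp (- (\<theta> * ?l)) = real n powr (1 - \<theta>)"
        using n0 ln_powr_eq[of n "- \<theta>"] by (simp add: powr_diff powr_minus divide_inverse)
      moreover have "c1 * (real n * a ^ t) = real n * p" by (simp add: c1_def p_def)
      ultimately show ?thesis by simp
    qed
    have core: "p \<le> prb (core v K (\<tau> n))" if v: "v \<in> V" for v
      unfolding \<tau> p_def
    proof (rule prb_core_lower[OF v])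
      show "N\<^sub>0 + Suc t * K \<le> n"
      proof -
        have "Suc t * K \<le> b" unfolding b_def \<tau> by (intro mult_right_mono) auto
        then have "real (Suc t * K) \<le> M * ?l" using b by linarith
        then have "real (N\<^sub>0 + Suc t * K) \<le> real N\<^sub>0 + M * ?l" unfolding of_nat_add by linarith
        then show ?thesis using elim by linarith
      qed
    qed (use H H' q a c K in \<open>auto simp: step_prob_def\<close>)
    have y: "0 < real n powr (1 - \<epsilon> / 2)" using n0 by simp
    have "prb (\<lambda>\<omega>. \<not> (\<exists>v\<in>V. core v K (\<tau> n) \<omega> \<and>
      \<not> (stalls ((1 - \<delta>) * real r) K (B n) v (\<tau> n) (s n) \<omega> \<or> real n powr (1 - \<epsilon> / 2) \<le> real (card (ball v \<omega> (\<tau> n + s' n)))))) \<le>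
      4 * (pair_const b - 1 + (real b + real n * real (\<tau> n) * (real r * real b ^ 2 / real (n - b) * pair_const b)) / (real n * p)) +
      2 * (exp (- (\<delta> ^ 2 * real K / 8)) / (1 - exp (- (\<delta> ^ 2 * real K / 8 / 2))) +
      (real (Suc (\<tau> n) * K) + real K * real r ^ Suc (s' n)) / real n powr (1 - \<epsilon> / 2))"
    proof (rule exists_core[OF _ _ \<delta>(3) K(1) _ y _ bn(1) p core])
      show "real (Suc (\<tau> n) * K + s n * B n) \<le> \<delta> / (4 * real r) * real n"
        using sB b elim unfolding of_nat_add b_def[symmetric] by linarith
    qed (use \<delta> in \<open>auto simp: b_def\<close>)
    also have "\<dots> \<le> 4 * (g1 n + g2 n) + 2 * (e K + g3 n)"
    proof -
      have b2: "real b ^ 2 \<le> (M * ?l) ^ 2" using b by (intro power_mono) auto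
      have "2 * real r * real b ^ 2 \<le> 2 * real r * (M * ?l) ^ 2" using b2 by (intro mult_left_mono) auto
      then have x: "2 * real r * real b ^ 2 \<le> 2 * real r * (M * ?l) ^ 2" "2 * (2 * real r * (M * ?l) ^ 2) < real n"
        using elim by auto
      moreover have x0: "0 \<le> 2 * real r * (M * ?l) ^ 2" by simp
      ultimately have xn: "2 * real r * real b ^ 2 < real n" "2 * real r * (M * ?l) ^ 2 < real n" by linarith+
      have pc: "pair_const b \<le> 1 / (1 - 2 * real r * real b ^ 2 / real n)" by (rule pair_const_upper[OF xn(1) bn(1)])
      also have "\<dots> \<le> 1 / (1 - 2 * real r * (M * ?l) ^ 2 / real n)"
      proof (intro divide_left_mono mult_pos_pos)
        show "1 - 2 * real r * (M * ?l) ^ 2 / real n \<le> 1 - 2 * real r * real b ^ 2 / real n"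
          using x(1) by (intro diff_left_mono divide_right_mono) auto
        show "0 < 1 - 2 * real r * (M * ?l) ^ 2 / real n" "0 < 1 - 2 * real r * real b ^ 2 / real n"
          using xn n0 by (simp_all add: field_simps)
      qed simp
      finally have G1: "pair_const b - 1 \<le> g1 n" by (simp add: g1_def)
      have "1 / (1 - 2 * real r * (M * ?l) ^ 2 / real n) \<le> 1 / (1 / 2)"
      proof (intro divide_left_mono mult_pos_pos)
        show "1 / 2 \<le> 1 - 2 * real r * (M * ?l) ^ 2 / real n" using x(2) n0 by (simp add: field_simps)
        then show "0 < 1 - 2 * real r * (M * ?l) ^ 2 / real n" by linarith
      qed simp_all
      then have pc2: "pair_const b \<le> 2" using G1 by (simp add: g1_def)
      have pcp: "0 < pair_const b" by (rule pair_const_pos[OF bn(1)])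
      have W: "real b + real n * real (\<tau> n) * (real r * real b ^ 2 / real (n - b) * pair_const b) \<le> M * ?l + 4 * real r * (M * ?l) ^ 3"
      proof -
        have nb: "real n / real (n - b) \<le> 2" using bn by (simp add: field_simps of_nat_diff)
        have "real n * real (\<tau> n) * (real r * real b ^ 2 / real (n - b) * pair_const b) =
          real (\<tau> n) * (real r * real b ^ 2) * (real n / real (n - b) * pair_const b)" by simp
        also have "\<dots> \<le> (M * ?l) * (real r * (M * ?l) ^ 2) * (2 * 2)"
          using \<tau>b b2 nb pc2 pcp M l1 by (intro mult_mono mult_nonneg_nonneg) auto
        also have "\<dots> = 4 * real r * (M * ?l) ^ 3" by (simp add: power2_eq_square power3_eq_cube)
        finally show ?thesis by (rule add_mono[OF b])
      qed
      have c1n: "0 < c1 * real n powr (1 - \<theta>)" using c1 n0 by simp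
      have G2: "(real b + real n * real (\<tau> n) * (real r * real b ^ 2 / real (n - b) * pair_const b)) / (real n * p) \<le> g2 n"
        unfolding g2_def
      proof (rule frac_le[OF _ W c1n np])
        show "0 \<le> M * ?l + 4 * real r * (M * ?l) ^ 3"
          by (intro add_nonneg_nonneg mult_nonneg_nonneg zero_le_power Ml) auto
      qed
      have G3: "(real (Suc (\<tau> n) * K) + real K * real r ^ Suc (s' n)) / real n powr (1 - \<epsilon> / 2) \<le> g3 n"
      proof -
        have "real r ^ s' n \<le> real n powr (1 - \<epsilon>)"
        proof -
          have "0 \<le> (1 - \<epsilon>) * L n" using \<epsilon> Ln(2) by (intro mult_nonneg_nonneg) auto
          then have "real (s' n) \<le> (1 - \<epsilon>) * L n" unfolding s'_def by linarith
          then have "real (s' n) * lr \<le> (1 - \<epsilon>) * L n * lr" using lr by (intro mult_right_mono) auto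
          then have "real (s' n) * lr \<le> (1 - \<epsilon>) * ?l" using Ln(1) lr by simp
          then have "exp (real (s' n) * lr) \<le> exp ((1 - \<epsilon>) * ?l)" by simp
          also have "exp (real (s' n) * lr) = real r ^ s' n" using rr by (simp add: exp_of_nat_mult lr_def)
          also have "exp ((1 - \<epsilon>) * ?l) = real n powr (1 - \<epsilon>)" using n3 by (intro ln_powr_eq) simp
          finally show ?thesis .
        qed
        then have "real K * real r * real r ^ s' n \<le> real K * real r * real n powr (1 - \<epsilon>)" by (intro mult_left_mono) auto
        then have "real (Suc (\<tau> n) * K) + real K * real r ^ Suc (s' n) \<le> M * ?l + real K * real r * real n powr (1 - \<epsilon>)"
          using b unfolding b_def by (simp add: mult.assoc)
        then show ?thesis unfolding g3_def by (intro divide_right_mono) auto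
      qed
      show ?thesis unfolding e_def by (intro add_mono mult_left_mono G1 G2 G3 order_refl) simp_all
    qed
    finally show ?case using elim by linarith
  qed
  then show ?thesis using that K by blast
qed

lemma main_whp:
  fixes r :: nat and \<epsilon> \<epsilon>' :: real
  assumes r: "r \<ge> 2" and \<epsilon>: "0 < \<epsilon>" and e': "0 < \<epsilon>'"
  shows "\<forall>\<^sub>F n in sequentially. \<exists>A D. real A \<le> (1 + eta_const r + \<epsilon>) * log (real r) (real n) \<and>
    (1 + eta_const r - \<epsilon>) * log (real r) (real n) \<le> real D \<and>
    rout.prb n r (\<lambda>\<omega>. \<not> rout.main_event n r A D \<omega>) \<le> \<epsilon>'"
proof -
  define \<eta> where "\<eta> = eta_const r"
  have eta: "\<eta> > 0" using eta_pos_ln(1)[OF r] by (simp add: \<eta>_def)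
  \<comment> \<open>The radius \<open>A\<close> exceeds \<open>1 + \<eta>\<close> by five multiples
    of \<open>x\<close>, and the roundings take one more.\<close>
  define x where "x = min (\<epsilon> / 7) (min (\<eta> / 2) (1 / 2))"
  have x: "0 < x" "7 * x \<le> \<epsilon>" "x < \<eta>" "x < 1" using \<epsilon> eta by (auto simp: x_def)
  define L where "L = (\<lambda>n :: nat. log (real r) (real n))"
  define lr where "lr = ln (real r)"
  have lr: "lr > 0" and rr: "real r \<ge> 2" using r by (auto simp: lr_def)
  have L: "L n = ln (real n) / lr" for n by (simp add: L_def log_def lr_def)
  define t where "t = (\<lambda>n. nat \<lceil>(\<eta> + x) * L n\<rceil>)"
  define A where "A = (\<lambda>n. t n + nat \<lceil>(1 + x) * L n\<rceil> + 2 * nat \<lceil>x * L n\<rceil> + nat \<lceil>x * L n\<rceil>)"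
  obtain \<delta> C where \<delta>: "0 < \<delta>" "\<delta> \<le> 1 / 4" "3 / 2 \<le> (1 - \<delta>) * real r" and C: "0 < C"
    and up: "(\<lambda>n. rout.prb n r (\<lambda>\<omega>. \<not> rout.upper_event n r (nat \<lceil>C * ln (real n)\<rceil>) (t n) (A n) \<omega>)) \<longlonglongrightarrow> 0"
    using upper_whp[OF r x(1)] unfolding t_def A_def L_def \<eta>_def by blast
  define B where "B = (\<lambda>n :: nat. nat \<lceil>C * ln (real n)\<rceil>)"
  \<comment> \<open>The coefficients of the lower radius then add up to
    \<open>(\<eta> - y) + (1 - y) = 1 + \<eta> - x\<close>, while the core and its climb together
    end before time \<open>t n\<close>.\<close>
  define y where "y = x / 2"
  have y: "0 < y" "y < eta_const r" "y < 1" using x by (auto simp: y_def \<eta>_def)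
  define \<tau> where "\<tau> = (\<lambda>n. Suc (nat \<lfloor>(\<eta> - y) * L n\<rfloor>))"
  define s where "s = (\<lambda>n. nat \<lceil>y * L n\<rceil>)"
  define s' where "s' = (\<lambda>n. nat \<lfloor>(1 - y) * L n\<rfloor>)"
  obtain K where K: "1 \<le> K" and low: "\<forall>\<^sub>F n in sequentially. rout.prb n r (\<lambda>\<omega>. \<not> (\<exists>v\<in>rout.V n. rout.core n r v K (\<tau> n) \<omega> \<and>
      \<not> (rout.stalls n r ((1 - \<delta>) * real r) K (B n) v (\<tau> n) (s n) \<omega> \<or>
        real n powr (1 - y / 2) \<le> real (card (rout.ball n r v \<omega> (\<tau> n + s' n)))))) \<le> \<epsilon>' / 2"
    using lower_whp[OF r y \<delta> C half_gt_zero[OF e']] unfolding B_def \<tau>_def s_def s'_def L_def \<eta>_def by blast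
  have up': "\<forall>\<^sub>F n in sequentially. rout.prb n r (\<lambda>\<omega>. \<not> rout.upper_event n r (B n) (t n) (A n) \<omega>) < \<epsilon>' / 2"
    unfolding B_def using up e' by (intro order_tendstoD) auto
  have ev: "\<forall>\<^sub>F n :: nat in sequentially. n \<ge> 3 \<and> 5 \<le> x * (ln (real n) / lr) \<and>
      3000 * (((\<eta> + x) * (ln (real n) / lr) + 1) * (C * ln (real n) + 1)) < real n \<and>
      C * ln (real n) + 1 < exp (y * (ln (real n) / lr) * ln (3 / 2)) \<and> 3000 * real n powr (1 - y / 2) \<le> real n"
  proof (intro eventually_conj)
    show "\<forall>\<^sub>F n in sequentially. 3 \<le> (n :: nat)" by (rule eventually_ge_at_top)
    show "\<forall>\<^sub>F n :: nat in sequentially. 5 \<le> x * (ln (real n) / lr)" using x(1) lr by real_asymp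
    have ex: "\<eta> + x > 0" using eta x by simp
    show "\<forall>\<^sub>F n :: nat in sequentially. 3000 * (((\<eta> + x) * (ln (real n) / lr) + 1) * (C * ln (real n) + 1)) < real n"
      using ex lr C by real_asymp
    define z where "z = y / lr * ln (3 / 2)"
    have z: "z > 0" using y lr by (simp add: z_def)
    have "\<forall>\<^sub>F n :: nat in sequentially. C * ln (real n) + 1 < exp (z * ln (real n))" using C z by real_asymp
    then show "\<forall>\<^sub>F n :: nat in sequentially. C * ln (real n) + 1 < exp (y * (ln (real n) / lr) * ln (3 / 2))"
      by (simp add: z_def mult_ac)
    have "y / 2 > 0" using y by simp
    then have "\<forall>\<^sub>F n :: nat in sequentially. 3000 \<le> real n powr (y / 2)" by real_asymp
    then show "\<forall>\<^sub>F n :: nat in sequentially. 3000 * real n powr (1 - y / 2) \<le> real n"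
      using eventually_gt_at_top[of 0]
    proof eventually_elim
      case (elim n)
      then have "3000 * real n powr (1 - y / 2) \<le> real n powr (y / 2) * real n powr (1 - y / 2)" by (intro mult_right_mono) auto
      then show ?case using elim by (simp add: powr_add[symmetric])
    qed
  qed
  show ?thesis
    using ev up' low
  proof eventually_elim
    case (elim n)
    then have n3: "n \<ge> 3" by simp
    interpret rout n r using n3 r by unfold_locales auto
    have Ln: "L n = ln (real n) / lr" "L n \<ge> 0" using L n3 lr by auto
    have e5: "5 \<le> x * L n" using elim Ln by simp
    have pos: "0 \<le> (\<eta> + x) * L n" "0 \<le> (1 + x) * L n" "0 \<le> x * L n" "0 \<le> (\<eta> - y) * L n" "0 \<le> y * L n" "0 \<le> (1 - y) * L n" "0 \<le> C * ln (real n)"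
      using eta x y Ln(2) C n3 by (auto intro!: mult_nonneg_nonneg simp: \<eta>_def)
    have tn: "(\<eta> + x) * L n \<le> real (t n)" "real (t n) \<le> (\<eta> + x) * L n + 1"
      using nat_ceiling_bounds[OF pos(1)] by (simp_all add: t_def)
    have An: "real (A n) \<le> (1 + \<eta> + \<epsilon>) * L n"
    proof -
      have "real (A n) \<le> ((\<eta> + x) * L n + 1) + ((1 + x) * L n + 1) + 2 * (x * L n + 1) + (x * L n + 1)"
        unfolding A_def of_nat_add of_nat_mult of_nat_numeral using tn(2) nat_ceiling_bounds(2)[OF pos(2)] nat_ceiling_bounds(2)[OF pos(3)]
        by (intro add_mono mult_left_mono) auto
      also have "\<dots> = (1 + \<eta> + 5 * x) * L n + 5" by (simp add: algebra_simps)
      also have "\<dots> \<le> (1 + \<eta> + 5 * x) * L n + x * L n" using e5 by simp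
      also have "\<dots> = (1 + \<eta> + 6 * x) * L n" by (simp add: algebra_simps)
      also have "\<dots> \<le> (1 + \<eta> + \<epsilon>) * L n" using x Ln(2) by (intro mult_right_mono) auto
      finally show ?thesis .
    qed
    have \<tau>n: "(\<eta> - y) * L n \<le> real (\<tau> n)" "real (\<tau> n) \<le> (\<eta> - y) * L n + 1"
      using pos(4) unfolding \<tau>_def by linarith+
    have sn: "y * L n \<le> real (s n)" "real (s n) \<le> y * L n + 1"
      using nat_ceiling_bounds[OF pos(5)] by (simp_all add: s_def)
    have s'n: "(1 - y) * L n - 1 \<le> real (s' n)" using pos(6) unfolding s'_def by linarith
    have Dn: "(1 + \<eta> - \<epsilon>) * L n \<le> real (\<tau> n + s' n)"
    proof -
      have "(1 + \<eta> - \<epsilon>) * L n \<le> (1 + \<eta> - 2 * x) * L n" using x Ln(2) by (intro mult_right_mono) auto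
      also have "\<dots> = (\<eta> - y) * L n + (1 - y) * L n - x * L n" by (simp add: y_def algebra_simps)
      also have "\<dots> \<le> (\<eta> - y) * L n + (1 - y) * L n - 1" using e5 by simp
      finally show ?thesis using \<tau>n(1) s'n by simp
    qed
    have \<tau>s: "\<tau> n + s n \<le> t n"
    proof -
      have "real (\<tau> n + s n) \<le> \<eta> * L n + 2" using \<tau>n sn by (simp add: algebra_simps)
      also have "\<dots> \<le> (\<eta> + x) * L n" using e5 by (simp add: algebra_simps)
      finally show ?thesis using tn(1) by linarith
    qed
    have Bn: "real (B n) \<le> C * ln (real n) + 1" using nat_ceiling_bounds[OF pos(7)] by (simp add: B_def)
    have tB: "3000 * (t n * B n) < n"
    proof -
      have "real (t n) * real (B n) \<le> ((\<eta> + x) * L n + 1) * (C * ln (real n) + 1)"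
        using tn(2) Bn pos by (intro mult_mono) auto
      moreover have "3000 * (((\<eta> + x) * L n + 1) * (C * ln (real n) + 1)) < real n"
        using elim unfolding Ln(1) by blast
      ultimately have "3000 * (real (t n) * real (B n)) < real n" by linarith
      then have "real (3000 * (t n * B n)) < real n" by simp
      then show ?thesis by (simp only: of_nat_less_iff)
    qed
    have \<kappa>: "real (B n) < ((1 - \<delta>) * real r) ^ s n * real K"
    proof -
      have "exp (y * L n * ln (3 / 2)) \<le> (3 / 2) ^ s n" using sn by (intro power_nat_ge) auto
      also have "\<dots> \<le> ((1 - \<delta>) * real r) ^ s n" using \<delta> by (intro power_mono) auto
      finally have "C * ln (real n) + 1 < ((1 - \<delta>) * real r) ^ s n" using elim Ln by simp
      also have "\<dots> = ((1 - \<delta>) * real r) ^ s n * 1" by simp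
      also have "\<dots> \<le> ((1 - \<delta>) * real r) ^ s n * real K" using K \<delta> by (intro mult_left_mono) auto
      finally show ?thesis using Bn by linarith
    qed
    let ?low = "\<lambda>\<omega>. \<exists>v\<in>V. core v K (\<tau> n) \<omega> \<and> \<not> (stalls ((1 - \<delta>) * real r) K (B n) v (\<tau> n) (s n) \<omega> \<or>
        real n powr (1 - y / 2) \<le> real (card (ball v \<omega> (\<tau> n + s' n))))"
    have "prb (\<lambda>\<omega>. \<not> main_event (A n) (\<tau> n + s' n) \<omega>) \<le> prb (\<lambda>\<omega>. \<not> upper_event (B n) (t n) (A n) \<omega> \<or> \<not> ?low \<omega>)"
    proof (rule prb_mono, rule ccontr)
      fix \<omega> assume nm: "\<not> main_event (A n) (\<tau> n + s' n) \<omega>" and "\<not> (\<not> upper_event (B n) (t n) (A n) \<omega> \<or> \<not> ?low \<omega>)"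
      then have u: "upper_event (B n) (t n) (A n) \<omega>" and "?low \<omega>" by blast+
      then obtain v where v: "v \<in> V" "core v K (\<tau> n) \<omega>" "\<not> stalls ((1 - \<delta>) * real r) K (B n) v (\<tau> n) (s n) \<omega>"
        "real (card (ball v \<omega> (\<tau> n + s' n))) < real n powr (1 - y / 2)" by (auto simp: not_le)
      have "main_event (A n) (\<tau> n + s' n) \<omega>"
      proof (rule main_eventI[OF u _ tB v _ \<kappa> \<tau>s])
        show "t n \<le> A n" by (simp add: A_def)
        show "0 \<le> (1 - \<delta>) * real r" using \<delta> by simp
        show "3000 * real n powr (1 - y / 2) \<le> real n" using elim by blast
      qed
      then show False using nm by blast
    qed
    also have "\<dots> \<le> prb (\<lambda>\<omega>. \<not> upper_event (B n) (t n) (A n) \<omega>) + prb (\<lambda>\<omega>. \<not> ?low \<omega>)" by (rule prb_disj)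
    also have "\<dots> \<le> \<epsilon>'" using elim by linarith
    finally have "prb (\<lambda>\<omega>. \<not> main_event (A n) (\<tau> n + s' n) \<omega>) \<le> \<epsilon>'" .
    then show ?case using An Dn unfolding L_def \<eta>_def by blast
  qed
qed

section \<open>Distances, diameters and components\<close>

lemma (in wf_digraph) apath_of_awalk:
  assumes "awalk u p v"
  shows "\<exists>q. apath u q v \<and> length q \<le> length p"
  using assms
proof (induction rule: awalk_to_apath_induct)
  case (path p)
  then show ?case by (auto simp: apath_def)
next
  case (decomp p q r s)
  then have "p = q @ r @ s" using awalk_cyc_decomp_has_prop[of u p v] by auto
  then show ?case using decomp.IH by auto
qed

text \<open>Cutting cycles out of a walk gives a path that is no longer. The infimum is attained
  because \<open>enat\<close> is well ordered, and a finite bound excludes the empty set of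
  paths.\<close>

lemma (in wf_digraph) digraph_dist_le_iff:
  "digraph_dist G u v \<le> enat k \<longleftrightarrow> (\<exists>p. awalk u p v \<and> length p \<le> k)"
proof
  assume le: "digraph_dist G u v \<le> enat k"
  let ?S = "(\<lambda>p. enat (length p)) ` {p. apath u p v}"
  have d: "digraph_dist G u v = Inf ?S" by (simp add: digraph_dist_def)
  have "?S \<noteq> {}"
  proof
    assume "?S = {}"
    then have "digraph_dist G u v = \<infinity>" unfolding d by (simp only: Inf_enat_def simp_thms if_True)
    then show False using le by simp
  qed
  then have "Inf ?S \<in> ?S" by (metis ex_in_conv wellorder_InfI)
  then obtain p where "apath u p v" "Inf ?S = enat (length p)" by auto
  then show "\<exists>p. awalk u p v \<and> length p \<le> k" using le d by (auto simp: apath_def)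
next
  assume "\<exists>p. awalk u p v \<and> length p \<le> k"
  then obtain q where q: "apath u q v" "length q \<le> k" using apath_of_awalk order_trans by blast
  have "digraph_dist G u v \<le> enat (length q)" unfolding digraph_dist_def using q(1) by (intro INF_lower) auto
  also have "\<dots> \<le> enat k" using q(2) by simp
  finally show "digraph_dist G u v \<le> enat k" .
qed

text \<open>Everything is expressed by comparisons of a distance with a number, which balls decide.
  The pair \<open>u\<close>, \<open>v\<close> makes the set under \<open>Max\<close> nonempty and
  gives the lower bound.\<close>

lemma digraph_diam_bounds:
  assumes fin: "finite (verts G)"
    and le: "\<And>u v k. u \<in> verts G \<Longrightarrow> v \<in> verts G \<Longrightarrow> digraph_dist G u v \<le> enat k \<Longrightarrow> digraph_dist G u v \<le> enat A"
    and uv: "u \<in> verts G" "v \<in> verts G" "digraph_dist G u v \<le> enat A" "\<not> digraph_dist G u v \<le> enat D"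
  shows "D < digraph_diam G" "digraph_diam G \<le> A"
proof -
  let ?X = "{the_enat (digraph_dist G u v) | u v. u \<in> verts G \<and> v \<in> verts G \<and> digraph_dist G u v < \<infinity>}"
  have "?X \<subseteq> (\<lambda>(u, v). the_enat (digraph_dist G u v)) ` (verts G \<times> verts G)" by auto
  then have finX: "finite ?X" by (rule finite_subset) (use fin in simp)
  obtain d where d: "digraph_dist G u v = enat d" using uv(3) by (cases "digraph_dist G u v") auto
  then have dX: "d \<in> ?X" using uv by force
  have "d \<le> digraph_diam G" unfolding digraph_diam_def using finX dX by (rule Max_ge)
  then show "D < digraph_diam G" using uv(4) d by simp
  have "x \<le> A" if xX: "x \<in> ?X" for x
  proof -
    obtain u v where x: "x = the_enat (digraph_dist G u v)" "u \<in> verts G" "v \<in> verts G" "digraph_dist G u v < \<infinity>"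
      using xX by blast
    then obtain k where k: "digraph_dist G u v = enat k" by (cases "digraph_dist G u v") auto
    then show ?thesis using le[OF x(2,3), of k] x(1) by simp
  qed
  then show "digraph_diam G \<le> A" unfolding digraph_diam_def using finX dX by (subst Max_le_iff) auto
qed

context rout
begin

lemma fin_digraph_out:
  assumes "\<And>i j. i \<in> V \<Longrightarrow> j \<in> J \<Longrightarrow> f (i, j) \<in> V"
  shows "fin_digraph (out_digraph n r f)"
  using assms by unfold_locales (auto simp: out_digraph_def V_def J_def)

text \<open>A sample point gives arbitrary values outside the index pairs, whereas elements of
  \<open>\<Omega>\<close> are undefined there, so agreement is asked on arcs only. The induction
  removes the first arc of the walk, which is the last one found by the exploration.\<close>

lemma awalk_iff_ball:
  assumes f: "\<And>i j. i \<in> V \<Longrightarrow> j \<in> J \<Longrightarrow> f (i, j) = \<omega> i j"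
    and V: "\<And>i j. i \<in> V \<Longrightarrow> j \<in> J \<Longrightarrow> \<omega> i j \<in> V" and v: "v \<in> V"
  shows "(\<exists>p. pre_digraph.awalk (out_digraph n r f) u p v \<and> length p \<le> k) \<longleftrightarrow> u \<in> ball v \<omega> k"
proof -
  let ?D = "out_digraph n r f"
  have D: "verts ?D = V" "arcs ?D = V \<times> J" "tail ?D = fst" "head ?D = f"
    by (auto simp: out_digraph_def V_def J_def)
  interpret fin_digraph ?D by (rule fin_digraph_out) (simp add: f V)
  show ?thesis
  proof (induction k arbitrary: u)
    case 0
    then show ?case using v by (auto simp: awalk_Nil_iff D)
  next
    case (Suc k)
    show ?case
    proof
      assume "\<exists>p. awalk u p v \<and> length p \<le> Suc k"
      then obtain p where p: "awalk u p v" "length p \<le> Suc k" by blast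
      show "u \<in> ball v \<omega> (Suc k)"
      proof (cases p)
        case Nil
        then have "u = v" using p(1) by (simp add: awalk_Nil_iff)
        then show ?thesis using ball_mono[of 0 "Suc k" v \<omega>] by (simp del: ball.simps(2))
      next
        case (Cons e q)
        then have e: "e \<in> V \<times> J" "u = fst e" "awalk (f e) q v" "length q \<le> k"
          using p by (auto simp: awalk_Cons_iff D)
        then have "f e \<in> ball v \<omega> k" using Suc by blast
        then show ?thesis using e f by (cases e) auto
      qed
    next
      assume "u \<in> ball v \<omega> (Suc k)"
      then consider "u \<in> ball v \<omega> k" | j where "u \<in> V" "j \<in> J" "\<omega> u j \<in> ball v \<omega> k" by auto
      then show "\<exists>p. awalk u p v \<and> length p \<le> Suc k"
      proof cases
        case 1
        then obtain p where "awalk u p v" "length p \<le> k" using Suc by blast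
        then show ?thesis using le_SucI by blast
      next
        case 2
        then obtain p where "awalk (\<omega> u j) p v" "length p \<le> k" using Suc by blast
        then have "awalk u ((u, j) # p) v \<and> length ((u, j) # p) \<le> Suc k"
          using 2 f by (simp add: awalk_Cons_iff D)
        then show ?thesis by blast
      qed
    qed
  qed
qed

text \<open>A set closed under arcs keeps every walk that starts in it, so distances inside it do
  not change.\<close>

lemma awalk_induced_iff:
  assumes f: "\<And>i j. i \<in> V \<Longrightarrow> j \<in> J \<Longrightarrow> f (i, j) \<in> V"
    and S: "S \<subseteq> V" "\<And>i j. i \<in> S \<Longrightarrow> j \<in> J \<Longrightarrow> f (i, j) \<in> S" and u: "u \<in> S"
  shows "pre_digraph.awalk (out_digraph n r f \<restriction> S) u p v \<longleftrightarrow> pre_digraph.awalk (out_digraph n r f) u p v"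
proof -
  let ?D = "out_digraph n r f"
  have D: "verts ?D = V" "arcs ?D = V \<times> J" "tail ?D = fst" "head ?D = f"
    by (auto simp: out_digraph_def V_def J_def)
  interpret fin_digraph ?D by (rule fin_digraph_out) (rule f)
  interpret H: wf_digraph "?D \<restriction> S" by (rule wellformed_induce_subgraph)
  show ?thesis using u
  proof (induction p arbitrary: u)
    case Nil
    then show ?case using S(1) by (auto simp: awalk_Nil_iff H.awalk_Nil_iff D)
  next
    case (Cons e p)
    have fe: "f e \<in> S" if "e \<in> V \<times> J" "u = fst e"
    proof -
      have "f (fst e, snd e) \<in> S" using that Cons.prems by (intro S(2)) auto
      then show ?thesis by simp
    qed
    have "H.awalk u (e # p) v \<longleftrightarrow> e \<in> V \<times> J \<and> f e \<in> S \<and> u = fst e \<and> H.awalk (f e) p v"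
      using Cons.prems by (auto simp: H.awalk_Cons_iff D)
    also have "\<dots> \<longleftrightarrow> e \<in> V \<times> J \<and> u = fst e \<and> awalk (f e) p v"
      using fe Cons.IH by blast
    also have "\<dots> \<longleftrightarrow> awalk u (e # p) v" by (simp add: awalk_Cons_iff D)
    finally show ?case .
  qed
qed

text \<open>\<open>S\<close>, the set of vertices reached from everywhere, is the largest component
  and is closed under arcs. Distances inside it are those of the whole digraph, so the same far pair
  and the same bound \<open>A\<close> serve both diameters.\<close>

lemma main_event_diam:
  assumes w: "\<omega> \<in> \<Omega>" and f: "\<And>i j. i \<in> V \<Longrightarrow> j \<in> J \<Longrightarrow> f (i, j) = \<omega> i j" and m: "main_event A D \<omega>"
  shows "D < digraph_diam (out_digraph n r f)" "digraph_diam (out_digraph n r f) \<le> A"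
    "D < digraph_diam (largest_scc (out_digraph n r f))" "digraph_diam (largest_scc (out_digraph n r f)) \<le> A"
proof -
  let ?D = "out_digraph n r f"
  have \<omega>V: "\<omega> i j \<in> V" if "i \<in> V" "j \<in> J" for i j
    using \<Omega>_mem[OF w that(1)] that(2) by (auto simp: T_def PiE_iff)
  have fV: "f (i, j) \<in> V" if "i \<in> V" "j \<in> J" for i j using \<omega>V f that by simp
  have D: "verts ?D = V" "arcs ?D = V \<times> J" "tail ?D = fst" "head ?D = f"
    by (auto simp: out_digraph_def V_def J_def)
  interpret fin_digraph ?D using fV by (rule fin_digraph_out)
  have ab: "(\<exists>p. awalk u p v \<and> length p \<le> k) \<longleftrightarrow> u \<in> ball v \<omega> k" if "v \<in> V" for u v k
    by (intro awalk_iff_ball f \<omega>V that)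
  have distD: "digraph_dist ?D u v \<le> enat k \<longleftrightarrow> u \<in> ball v \<omega> k" if "v \<in> V" for u v k
    unfolding digraph_dist_le_iff by (rule ab[OF that])
  have reach: "u \<rightarrow>\<^sup>*\<^bsub>?D\<^esub> v \<longleftrightarrow> (\<exists>k. u \<in> ball v \<omega> k)" if "v \<in> V" for u v
    unfolding reachable_awalk using ab[OF that, of u] by blast
  define S where "S = {v \<in> V. V \<subseteq> ball v \<omega> A}"
  have SV: "S \<subseteq> V" by (auto simp: S_def)
  have dead: "\<exists>m\<le>A. (\<forall>j. ball v \<omega> j \<subseteq> ball v \<omega> m) \<and> 3000 * card (ball v \<omega> m) < n" if "v \<in> V" "v \<notin> S" for v
    using m that by (auto simp: main_event_def S_def)
  \<comment> \<open>Covering at any radius implies covering at radius \<open>A\<close>: otherwise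
    all balls would lie in a small one.\<close>
  have SI: "v \<in> S" if v: "v \<in> V" "V \<subseteq> ball v \<omega> k" for v k
  proof (rule ccontr)
    assume "v \<notin> S"
    then obtain m where "ball v \<omega> k \<subseteq> ball v \<omega> m" "3000 * card (ball v \<omega> m) < n" using dead v by blast
    moreover have "n \<le> card (ball v \<omega> m)"
      using card_mono[OF finite_ball[OF v(1)], of V \<omega> m] v(2) calculation(1) by simp
    ultimately show False by simp
  qed
  have closed: "\<omega> i j \<in> S" if i: "i \<in> S" and j: "j \<in> J" for i j
  proof -
    have iV: "i \<in> V" using i SV by auto
    note x = \<omega>V[OF iV j]
    have "ball i \<omega> k \<subseteq> ball (\<omega> i j) \<omega> (Suc k)" for k
      using iV j ball_mono[of 0 _ "\<omega> i j" \<omega>] by (induction k) auto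
    then have "V \<subseteq> ball (\<omega> i j) \<omega> (Suc A)" using i unfolding S_def by blast
    then show ?thesis by (rule SI[OF x])
  qed
  obtain v\<^sub>0 where v0: "v\<^sub>0 \<in> S" "3000 * card (ball v\<^sub>0 \<omega> D) < n" using m by (auto simp: main_event_def S_def)
  \<comment> \<open>For a closed set \<open>S \<union> heads \<omega> S = S\<close>, which
    \<open>expanding\<close> forbids for nonempty sets of at most \<open>n / 3000\<close>
    vertices.\<close>
  have bigS: "n < 3000 * card S"
  proof (rule ccontr)
    assume "\<not> n < 3000 * card S"
    then have "3000 * card S \<le> n" by simp
    moreover have "S \<noteq> {}" using v0 by blast
    moreover have "expanding \<omega>" using m by (simp add: main_event_def)
    ultimately have "3 * card S \<le> 2 * card (S \<union> heads \<omega> S)"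
      unfolding expanding_def using SV by blast
    moreover have "heads \<omega> S \<subseteq> S" unfolding heads_def using closed by blast
    then have "S \<union> heads \<omega> S = S" by blast
    moreover have "0 < card S" using v0 finite_subset[OF SV finite_V] by (auto simp: card_gt_0_iff)
    ultimately show False by simp
  qed
  have "\<not> S \<subseteq> ball v\<^sub>0 \<omega> D"
  proof
    assume "S \<subseteq> ball v\<^sub>0 \<omega> D"
    then have "card S \<le> card (ball v\<^sub>0 \<omega> D)" using v0 SV by (intro card_mono) auto
    then show False using bigS v0(2) by linarith
  qed
  then obtain u\<^sub>0 where u0: "u\<^sub>0 \<in> S" "u\<^sub>0 \<notin> ball v\<^sub>0 \<omega> D" by blast
  have inA: "u \<in> ball v \<omega> A" if uV: "u \<in> V" and vV: "v \<in> V" and uk: "u \<in> ball v \<omega> k" for u v k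
  proof (cases "v \<in> S")
    case False
    then obtain m where "m \<le> A" "ball v \<omega> k \<subseteq> ball v \<omega> m" using dead vV by blast
    then show ?thesis using uk ball_mono[of m A v \<omega>] by blast
  next
    case True
    then show ?thesis using uV by (auto simp: S_def)
  qed
  have uv0: "u\<^sub>0 \<in> V" "v\<^sub>0 \<in> V" "u\<^sub>0 \<in> ball v\<^sub>0 \<omega> A" using u0 v0 SV by (auto simp: S_def)
  show "D < digraph_diam ?D" "digraph_diam ?D \<le> A"
    using uv0 u0 inA distD by (intro digraph_diam_bounds[of ?D A u\<^sub>0 v\<^sub>0 D]; simp add: D)+
  have SS: "S \<in> sccs_verts"
    unfolding in_sccs_verts_conv_reachable
  proof (intro conjI ballI allI impI)
    show "S \<noteq> {}" using v0 by auto
    fix u assume u: "u \<in> S"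
    show "u \<rightarrow>\<^sup>*\<^bsub>?D\<^esub> v" if "v \<in> S" for v using u that SV reach[of v u] by (auto simp: S_def)
    fix v assume v: "v \<notin> S"
    show "\<not> u \<rightarrow>\<^sup>*\<^bsub>?D\<^esub> v \<or> \<not> v \<rightarrow>\<^sup>*\<^bsub>?D\<^esub> u"
    proof (rule ccontr)
      assume "\<not> (\<not> u \<rightarrow>\<^sup>*\<^bsub>?D\<^esub> v \<or> \<not> v \<rightarrow>\<^sup>*\<^bsub>?D\<^esub> u)"
      then have uv: "u \<rightarrow>\<^sup>*\<^bsub>?D\<^esub> v" by blast
      then have vV: "v \<in> V" using reachable_in_verts(2) D by metis
      then obtain m where m: "\<And>j. ball v \<omega> j \<subseteq> ball v \<omega> m" "3000 * card (ball v \<omega> m) < n" using dead v by blast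
      have "V \<subseteq> ball v \<omega> m"
      proof
        fix x assume x: "x \<in> V"
        have "x \<rightarrow>\<^sup>*\<^bsub>?D\<^esub> u" using x u SV reach[of u x] by (auto simp: S_def)
        then have "x \<rightarrow>\<^sup>*\<^bsub>?D\<^esub> v" using uv by (rule reachable_trans)
        then show "x \<in> ball v \<omega> m" using reach[OF vV, of x] m(1) by blast
      qed
      then show False using SI[OF vV] v by blast
    qed
  qed
  have L: "largest_scc ?D = ?D \<restriction> S"
  proof -
    have in_sccs: "?D \<restriction> S \<in> sccs" using SS by (auto simp: sccs_conv_sccs_verts)
    \<comment> \<open>Another component is disjoint from \<open>S\<close>, so it lies in the small
      ball of any of its vertices. The inequality is strict, and no tie arises.\<close>
    have "card (verts H') < card S" if H': "H' \<in> sccs" "H' \<noteq> ?D \<restriction> S" for H'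
    proof -
      obtain S' where S': "S' \<in> sccs_verts" "H' = ?D \<restriction> S'" using H'(1) by (auto simp: sccs_conv_sccs_verts)
      have "S' \<noteq> S" using S'(2) H'(2) by auto
      then have disj: "S' \<inter> S = {}" using sccs_verts_disjoint[OF S'(1) SS] by blast
      obtain x where x: "x \<in> S'" using S'(1) by (auto simp: in_sccs_verts_conv_reachable)
      have xV: "x \<in> V" using sccs_verts_subsets[OF S'(1)] x D by auto
      have "x \<notin> S" using x disj by auto
      then obtain m where m: "\<And>j. ball x \<omega> j \<subseteq> ball x \<omega> m" "3000 * card (ball x \<omega> m) < n" using dead xV by blast
      have "S' \<subseteq> ball x \<omega> m"
      proof
        fix y assume "y \<in> S'"
        then have "y \<rightarrow>\<^sup>*\<^bsub>?D\<^esub> x" using x S'(1) by (simp add: in_sccs_verts_conv_reachable)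
        then show "y \<in> ball x \<omega> m" using reach[OF xV, of y] m(1) by blast
      qed
      then have "card S' \<le> card (ball x \<omega> m)" using xV by (intro card_mono) auto
      then show ?thesis using m(2) bigS S'(2) by simp
    qed
    then have "?D \<restriction> S \<in> sccs \<and> (\<forall>H'\<in>sccs. card (verts H') < card (verts (?D \<restriction> S)) \<or>
      (card (verts H') = card (verts (?D \<restriction> S)) \<and> Min (verts (?D \<restriction> S)) \<le> Min (verts H')))"
      using in_sccs by (metis induce_subgraph_verts order_refl)
    moreover have "verts ?D \<noteq> {}" using uv0 D by auto
    ultimately show ?thesis
      unfolding largest_scc_def using largest_scc_ex1[OF fin_digraph_axioms] by (intro the1_equality) auto
  qed
  interpret H: wf_digraph "?D \<restriction> S" by (rule wellformed_induce_subgraph)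
  have distH: "digraph_dist (?D \<restriction> S) u v \<le> enat k \<longleftrightarrow> u \<in> ball v \<omega> k" if "u \<in> S" "v \<in> S" for u v k
  proof -
    have "v \<in> V" using that SV by auto
    moreover have "H.awalk u p v \<longleftrightarrow> awalk u p v" for p
    proof (rule awalk_induced_iff)
      fix i j assume "i \<in> S" "j \<in> J"
      then show "f (i, j) \<in> S" using closed f SV by auto
    qed (use fV SV that in auto)
    ultimately show ?thesis unfolding H.digraph_dist_le_iff using ab[of v u k] by simp
  qed
  have finS: "finite S" using SV by (auto intro: finite_subset)
  have inS: "u \<in> ball v \<omega> A" if "u \<in> S" "v \<in> S" "u \<in> ball v \<omega> k" for u v k
    using inA[of u v k] that SV by blast
  show "D < digraph_diam (largest_scc ?D)" "digraph_diam (largest_scc ?D) \<le> A"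
    unfolding L using uv0 u0 v0 inS distH finS
    by (intro digraph_diam_bounds[of "?D \<restriction> S" A u\<^sub>0 v\<^sub>0 D]; auto)+
qed

end

section \<open>Transfer to the given probability spaces\<close>

context rout
begin

text \<open>\<open>W\<close> reads off the arcs as an element of \<open>\<Omega>\<close>. By
  independence and uniformity each \<open>\<omega>\<close> is taken with probability
  \<open>1 / card \<Omega>\<close>, and every event about \<open>W\<close> is a finite disjoint
  union of such cylinders.\<close>

lemma measure_eq_prb:
  assumes M: "prob_space M"
    and ind: "prob_space.indep_vars M (\<lambda>_. count_space {1..n}) X ({1..n} \<times> {1..r})"
    and uni: "\<And>i j. i \<in> {1..n} \<Longrightarrow> j \<in> {1..r} \<Longrightarrow>
      distr M (count_space {1..n}) (X (i, j)) = uniform_count_measure {1..n}"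
  defines "W \<equiv> \<lambda>w. \<lambda>i\<in>V. \<lambda>j\<in>J. X (i, j) w"
  shows "{w \<in> space M. P (W w)} \<in> sets M" "measure M {w \<in> space M. P (W w)} = prb P"
    "\<And>w. w \<in> space M \<Longrightarrow> W w \<in> \<Omega>"
proof -
  interpret prob_space M by fact
  have rv: "X p \<in> M \<rightarrow>\<^sub>M count_space {1..n}" if "p \<in> V \<times> J" for p
    using ind that unfolding indep_vars_def V_def J_def by blast
  have XV: "X (i, j) w \<in> V" if "i \<in> V" "j \<in> J" "w \<in> space M" for i j w
    using measurable_space[OF rv[of "(i, j)"]] that by (auto simp: V_def)
  show W\<Omega>: "W w \<in> \<Omega>" if "w \<in> space M" for w
    using XV that by (auto simp: W_def \<Omega>_def T_def)
  have VJ: "V \<times> J \<noteq> {}" "finite (V \<times> J)" using n r by (auto simp: V_def J_def)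
  let ?A = "\<lambda>\<omega>. \<Inter>p\<in>V \<times> J. X p -` {\<omega> (fst p) (snd p)} \<inter> space M"
  have memV: "\<omega> i j \<in> V" if "\<omega> \<in> \<Omega>" "i \<in> V" "j \<in> J" for \<omega> i j
    using \<Omega>_mem[OF that(1,2)] that(3) by (auto simp: T_def PiE_iff)
  have A: "{w \<in> space M. W w = \<omega>} = ?A \<omega>" if w: "\<omega> \<in> \<Omega>" for \<omega>
  proof (intro set_eqI iffI)
    fix x assume "x \<in> {w \<in> space M. W w = \<omega>}"
    then show "x \<in> ?A \<omega>" using VJ by (auto simp: W_def)
  next
    fix x assume x: "x \<in> ?A \<omega>"
    then have xs: "x \<in> space M" using VJ(1) by blast
    have "W x = \<omega>"
    proof (rule PiE_ext[of _ V "\<lambda>_. T"])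
      show "W x \<in> PiE V (\<lambda>_. T)" "\<omega> \<in> PiE V (\<lambda>_. T)" using W\<Omega>[OF xs] w by (auto simp: \<Omega>_def)
      fix i assume i: "i \<in> V"
      show "W x i = \<omega> i"
      proof (rule PiE_ext[of _ J "\<lambda>_. V"])
        show "W x i \<in> PiE J (\<lambda>_. V)" "\<omega> i \<in> PiE J (\<lambda>_. V)"
          using \<Omega>_mem[OF W\<Omega>[OF xs] i] \<Omega>_mem[OF w i] by (auto simp: T_def)
        fix j assume j: "j \<in> J"
        then have "(i, j) \<in> V \<times> J" using i by simp
        then have "x \<in> X (i, j) -` {\<omega> i j} \<inter> space M" using x by fastforce
        then show "W x i j = \<omega> i j" using i j by (simp add: W_def)
      qed
    qed
    then show "x \<in> {w \<in> space M. W w = \<omega>}" using xs by simp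
  qed
  have sets1: "X p -` {\<omega> (fst p) (snd p)} \<inter> space M \<in> sets M" if "\<omega> \<in> \<Omega>" "p \<in> V \<times> J" for \<omega> p
    using that memV[of \<omega> "fst p" "snd p"] by (intro measurable_sets[OF rv]) (auto simp: V_def)
  have setsA: "?A \<omega> \<in> sets M" if "\<omega> \<in> \<Omega>" for \<omega>
    using VJ sets1[OF that] by (intro sets.finite_INT) auto
  have prob1: "prob (X p -` {\<omega> (fst p) (snd p)} \<inter> space M) = 1 / real n" if w: "\<omega> \<in> \<Omega>" and p: "p \<in> V \<times> J" for \<omega> p
  proof -
    let ?a = "\<omega> (fst p) (snd p)"
    have a: "?a \<in> {1..n}" using memV[of \<omega> "fst p" "snd p"] w p by (auto simp: V_def)
    have "prob (X p -` {?a} \<inter> space M) = measure (distr M (count_space {1..n}) (X p)) {?a}"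
      using a by (subst measure_distr[OF rv[OF p]]) auto
    also have "distr M (count_space {1..n}) (X p) = uniform_count_measure {1..n}"
      using uni[of "fst p" "snd p"] p by (auto simp: V_def J_def)
    also have "measure (uniform_count_measure {1..n}) {?a} = 1 / real n"
      using a by (subst measure_uniform_count_measure) auto
    finally show ?thesis .
  qed
  have probA: "prob (?A \<omega>) = 1 / real (card \<Omega>)" if w: "\<omega> \<in> \<Omega>" for \<omega>
  proof -
    have "prob (?A \<omega>) = (\<Prod>p\<in>V \<times> J. prob (X p -` {\<omega> (fst p) (snd p)} \<inter> space M))"
      using ind VJ memV[OF w] unfolding V_def[symmetric] J_def[symmetric]
      by (intro indep_varsD_finite[where M' = "\<lambda>_. count_space V"]) auto
    also have "\<dots> = (\<Prod>p\<in>V \<times> J. 1 / real n)" using prob1[OF w] by (intro prod.cong) auto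
    also have "\<dots> = 1 / real (card \<Omega>)"
      by (simp add: card_\<Omega> power_one_over card_cartesian_product power_mult[symmetric] mult.commute)
    finally show ?thesis .
  qed
  let ?P = "{\<omega> \<in> \<Omega>. P \<omega>}"
  have E: "{w \<in> space M. P (W w)} = (\<Union>\<omega>\<in>?P. ?A \<omega>)"
  proof -
    have "{w \<in> space M. P (W w)} = (\<Union>\<omega>\<in>?P. {w \<in> space M. W w = \<omega>})" using W\<Omega> by auto
    also have "\<dots> = (\<Union>\<omega>\<in>?P. ?A \<omega>)" by (intro SUP_cong refl A) auto
    finally show ?thesis .
  qed
  show "{w \<in> space M. P (W w)} \<in> sets M" unfolding E using setsA by (intro sets.finite_UN) auto
  have "prob (\<Union>\<omega>\<in>?P. ?A \<omega>) = (\<Sum>\<omega>\<in>?P. prob (?A \<omega>))"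
  proof (rule finite_measure_finite_Union)
    show "?A ` ?P \<subseteq> sets M" using setsA by blast
    show "disjoint_family_on ?A ?P"
      unfolding disjoint_family_on_def
    proof (intro ballI impI)
      fix \<omega> \<omega>' assume P: "\<omega> \<in> ?P" "\<omega>' \<in> ?P" and ne: "\<omega> \<noteq> \<omega>'"
      have 1: "?A \<omega> = {w \<in> space M. W w = \<omega>}" by (rule A[symmetric]) (use P in simp)
      have 2: "?A \<omega>' = {w \<in> space M. W w = \<omega>'}" by (rule A[symmetric]) (use P in simp)
      show "?A \<omega> \<inter> ?A \<omega>' = {}" unfolding 1 2 using ne by blast
    qed
  qed simp
  also have "\<dots> = (\<Sum>\<omega>\<in>?P. 1 / real (card \<Omega>))" using probA by (intro sum.cong) auto
  also have "\<dots> = prb P" by (simp add: prb_card)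
  finally show "prob {w \<in> space M. P (W w)} = prb P" unfolding E .
qed

end

theorem theorem1p1:
  fixes r :: nat
    and M :: "nat \<Rightarrow> 'w measure"
    and L :: "nat \<Rightarrow> nat \<times> nat \<Rightarrow> 'w \<Rightarrow> nat"
  assumes "r \<ge> 2"
    and "\<And>n. n \<ge> 1 \<Longrightarrow> prob_space (M n)"
    and "\<And>n. n \<ge> 1 \<Longrightarrow>
           prob_space.indep_vars (M n) (\<lambda>_. count_space {1..n}) (L n) ({1..n} \<times> {1..r})"
    and "\<And>n i j. n \<ge> 1 \<Longrightarrow> i \<in> {1..n} \<Longrightarrow> j \<in> {1..r} \<Longrightarrow>
           distr (M n) (count_space {1..n}) (L n (i, j)) = uniform_count_measure {1..n}"
  shows "tendsto_in_prob M
           (\<lambda>n w. real (digraph_diam (out_digraph n r (\<lambda>ij. L n ij w))) / log (real r) (real n))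
           (1 + eta_const r) \<and>
         tendsto_in_prob M
           (\<lambda>n w. real (digraph_diam (largest_scc (out_digraph n r (\<lambda>ij. L n ij w))))
                    / log (real r) (real n))
           (1 + eta_const r)"
proof -
  let ?L = "\<lambda>n :: nat. log (real r) (real n)" and ?c = "1 + eta_const r"
  \<comment> \<open>Both diameters are handled at once: the argument uses of \<open>X\<close> only
    the bounds that \<open>main_event\<close> gives at a single outcome.\<close>
  have conv: "tendsto_in_prob M (\<lambda>n w. real (X n w) / ?L n) ?c"
    if X: "\<And>n w \<omega> A D. n \<ge> 1 \<Longrightarrow> \<omega> \<in> rout.\<Omega> n r \<Longrightarrow>
      (\<And>i j. i \<in> rout.V n \<Longrightarrow> j \<in> rout.J r \<Longrightarrow> L n (i, j) w = \<omega> i j) \<Longrightarrow> rout.main_event n r A D \<omega> \<Longrightarrow>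
      D < X n w \<and> X n w \<le> A" for X :: "nat \<Rightarrow> 'w \<Rightarrow> nat"
    unfolding tendsto_in_prob_def
  proof (intro allI impI)
    fix \<epsilon> :: real assume \<epsilon>: "\<epsilon> > 0"
    show "(\<lambda>n. measure (M n) {w \<in> space (M n). \<epsilon> < \<bar>real (X n w) / ?L n - ?c\<bar>}) \<longlonglongrightarrow> 0"
    proof (rule order_tendstoI)
      fix a :: real assume "a < 0"
      then show "\<forall>\<^sub>F n in sequentially. a < measure (M n) {w \<in> space (M n). \<epsilon> < \<bar>real (X n w) / ?L n - ?c\<bar>}"
        by (intro always_eventually allI) (meson less_le_trans measure_nonneg)
    next
      fix a :: real assume a: "0 < a"
      show "\<forall>\<^sub>F n in sequentially. measure (M n) {w \<in> space (M n). \<epsilon> < \<bar>real (X n w) / ?L n - ?c\<bar>} < a"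
        using main_whp[OF assms(1) \<epsilon> half_gt_zero[OF a]] eventually_ge_at_top[of 2]
      proof eventually_elim
        case (elim n)
        then obtain A D where AD: "real A \<le> (?c + \<epsilon>) * ?L n" "(?c - \<epsilon>) * ?L n \<le> real D"
          "rout.prb n r (\<lambda>\<omega>. \<not> rout.main_event n r A D \<omega>) \<le> a / 2" by blast
        have n1: "n \<ge> 1" using elim by simp
        interpret rout n r using n1 assms(1) by unfold_locales auto
        interpret prob_space "M n" by (rule assms(2)[OF n1])
        define W where "W = (\<lambda>w. \<lambda>i\<in>V. \<lambda>j\<in>J. L n (i, j) w)"
        have tr: "{w \<in> space (M n). P (W w)} \<in> sets (M n)" "measure (M n) {w \<in> space (M n). P (W w)} = prb P"
          "\<And>w. w \<in> space (M n) \<Longrightarrow> W w \<in> \<Omega>" for P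
          unfolding W_def
          using measure_eq_prb[where X = "L n", OF assms(2)[OF n1] assms(3)[OF n1]] assms(4)[OF n1] by blast+
        have Lpos: "?L n > 0" using elim assms(1) by simp
        have "measure (M n) {w \<in> space (M n). \<epsilon> < \<bar>real (X n w) / ?L n - ?c\<bar>} \<le>
          measure (M n) {w \<in> space (M n). \<not> main_event A D (W w)}"
        proof (intro finite_measure_mono tr(1) subsetI)
          fix w assume w: "w \<in> {w \<in> space (M n). \<epsilon> < \<bar>real (X n w) / ?L n - ?c\<bar>}"
          have "\<not> main_event A D (W w)"
          proof
            assume "main_event A D (W w)"
            then have "D < X n w \<and> X n w \<le> A"
              using w by (intro X[OF n1 tr(3)]) (auto simp: W_def)
            then have "(?c - \<epsilon>) * ?L n \<le> real (X n w)" "real (X n w) \<le> (?c + \<epsilon>) * ?L n" using AD by linarith+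
            then have "?c - \<epsilon> \<le> real (X n w) / ?L n" "real (X n w) / ?L n \<le> ?c + \<epsilon>"
              using Lpos by (simp_all only: pos_le_divide_eq pos_divide_le_eq)
            then show False using w by (auto simp: abs_if split: if_splits)
          qed
          then show "w \<in> {w \<in> space (M n). \<not> main_event A D (W w)}" using w by simp
        qed
        also have "\<dots> = prb (\<lambda>\<omega>. \<not> main_event A D \<omega>)" by (rule tr(2))
        also have "\<dots> < a" using AD(3) a by linarith
        finally show ?case .
      qed
    qed
  qed
  show ?thesis
  proof (intro conjI conv)
    fix n w \<omega> A D
    assume n1: "n \<ge> 1" and w: "\<omega> \<in> rout.\<Omega> n r" and m: "rout.main_event n r A D \<omega>"
      and f: "\<And>i j. i \<in> rout.V n \<Longrightarrow> j \<in> rout.J r \<Longrightarrow> L n (i, j) w = \<omega> i j"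
    have "rout n r" using n1 assms(1) by unfold_locales auto
    from rout.main_event_diam[OF this w f m]
    show "D < digraph_diam (out_digraph n r (\<lambda>ij. L n ij w))" "digraph_diam (out_digraph n r (\<lambda>ij. L n ij w)) \<le> A"
      "D < digraph_diam (largest_scc (out_digraph n r (\<lambda>ij. L n ij w)))"
      "digraph_diam (largest_scc (out_digraph n r (\<lambda>ij. L n ij w))) \<le> A" by blast+
  qed
qed

end
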